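(* If $\mathcal{A}\cap\bigcup_{\sigma>0}\mathcal{C}(\sigma)\neq\emptyset$, then $\mathcal{A}\subset\bigcup_{\sigma>0}\mathcal{C}(\sigma)$.
   Context: Setting: 2D NSE $\frac{du}{dt}+\nu Au+B(u,u)=g$ on $[0,L]^2$ with periodic boundary conditions, $\nu>0$, $\kappa_0=2\pi/L$; $H$ is the closure in $L^2([0,L]^2)^2$ of the divergence-free, mean-zero periodic trigonometric polynomials, norm $|\cdot|$; $A=-\Delta$ the Stokes operator with spectrally defined powers; $B(u,v)=\mathcal{P}((u\cdot\nabla)v)$ with $\mathcal{P}$ the Leray projection; $g\in H$ a time-independent force. The global attractor $\mathcal{A}$ is the set of $u_0\in H$ for which there is a solution $u(t)$, $t\in\mathbb{R}$, with $u(0)=u_0$ and $\sup_t|u(t)|<\infty$. For $\sigma>0$, $\mathcal{C}(\sigma)$ is the set of $u\in C^\infty([0,L]^2)\cap H$ for which there is $c_0=c_0(u)\in\mathbb{R}$ with $\frac{|A^{\alpha/2}u|^2}{\nu^2\kappa_0^{2\alpha}}\le c_0e^{\sigma\alpha^2}$ for all $\alpha\in\mathbb{N}$. *)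

theory Defs
  imports "HOL-Analysis.Analysis"
begin

text \<open>Fourier-coefficient model of the 2D periodic NSE on [0,L]^2.
 A field u(x) = sum over k in Z^2 of u_hat(k) exp(i kappa0 k.x) is represented by its
 coefficient family u_hat :: int*int => complex^2.\<close>

type_synonym fcoef = "int \<times> int \<Rightarrow> complex ^ 2"

definition kappa0 :: "real \<Rightarrow> real" where
  "kappa0 L = 2 * pi / L"

definition ksq :: "int \<times> int \<Rightarrow> real" where
  "ksq k = real_of_int ((fst k)\<^sup>2 + (snd k)\<^sup>2)"

definition vcnj :: "complex ^ 2 \<Rightarrow> complex ^ 2" where
  "vcnj v = (\<chi> i. cnj (v $ i))"

definition kdot :: "int \<times> int \<Rightarrow> complex ^ 2 \<Rightarrow> complex" where
  "kdot k w = of_int (fst k) * w $ 1 + of_int (snd k) * w $ 2"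

text \<open>Membership in H: real-valued, mean zero, divergence free, square summable.\<close>
definition inH :: "fcoef \<Rightarrow> bool" where
  "inH u \<longleftrightarrow> u (0, 0) = 0 \<and> (\<forall>k. u (- fst k, - snd k) = vcnj (u k))
     \<and> (\<forall>k. kdot k (u k) = 0) \<and> ((\<lambda>k. (norm (u k))\<^sup>2) summable_on UNIV)"

text \<open>|u|^2 (L^2 norm over [0,L]^2, by Parseval)\<close>
definition Hnorm2 :: "real \<Rightarrow> fcoef \<Rightarrow> real" where
  "Hnorm2 L u = L\<^sup>2 * (\<Sum>\<^sub>\<infinity>k. (norm (u k))\<^sup>2)"

text \<open>|A^(alpha/2) u|^2, A = -Delta; together with the finiteness (summability) condition\<close>
definition Apow_summable :: "real \<Rightarrow> nat \<Rightarrow> fcoef \<Rightarrow> bool" where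
  "Apow_summable L \<alpha> u \<longleftrightarrow> ((\<lambda>k. ((kappa0 L)\<^sup>2 * ksq k) ^ \<alpha> * (norm (u k))\<^sup>2) summable_on UNIV)"

definition Apow_norm2 :: "real \<Rightarrow> nat \<Rightarrow> fcoef \<Rightarrow> real" where
  "Apow_norm2 L \<alpha> u = L\<^sup>2 * (\<Sum>\<^sub>\<infinity>k. ((kappa0 L)\<^sup>2 * ksq k) ^ \<alpha> * (norm (u k))\<^sup>2)"

text \<open>||u||^2 = |A^(1/2) u|^2 as an extended nonnegative real (infinite if u not in V)\<close>
definition Vnorm2e :: "real \<Rightarrow> fcoef \<Rightarrow> ennreal" where
  "Vnorm2e L u = ennreal (L\<^sup>2) * (\<Sum>\<^sub>\<infinity>k. ennreal ((kappa0 L)\<^sup>2 * ksq k * (norm (u k))\<^sup>2))"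

definition leray :: "int \<times> int \<Rightarrow> complex ^ 2 \<Rightarrow> complex ^ 2" where
  "leray k w = (if k = (0, 0) then 0
     else w - (kdot k w / of_real (ksq k)) *s (\<chi> i. if i = 1 then of_int (fst k) else of_int (snd k)))"

text \<open>k-th Fourier coefficient of B(u,v) = P((u.grad) v)\<close>
definition Bcoef :: "real \<Rightarrow> fcoef \<Rightarrow> fcoef \<Rightarrow> fcoef" where
  "Bcoef L u v k = leray k (\<Sum>\<^sub>\<infinity>l.
      (\<i> * of_real (kappa0 L) *
        (u (fst k - fst l, snd k - snd l) $ 1 * of_int (fst l)
         + u (fst k - fst l, snd k - snd l) $ 2 * of_int (snd l))) *s v l)"

text \<open>Solution of du/dt + nu A u + B(u,u) = g on the whole real line (weak formulation,
  mode by mode in integrated form), with u in C(R;H) and u in L^2_loc(R;V).\<close>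
definition nse_solution :: "real \<Rightarrow> real \<Rightarrow> fcoef \<Rightarrow> (real \<Rightarrow> fcoef) \<Rightarrow> bool" where
  "nse_solution L \<nu> g u \<longleftrightarrow>
     (\<forall>t. inH (u t))
   \<and> (\<forall>t. ((\<lambda>s. Hnorm2 L (\<lambda>k. u s k - u t k)) \<longlongrightarrow> 0) (at t))
   \<and> (\<forall>s t. s \<le> t \<longrightarrow> (\<integral>\<^sup>+ \<tau>. indicator {s..t} \<tau> * Vnorm2e L (u \<tau>) \<partial>lborel) < \<infinity>)
   \<and> (\<forall>k s t. s \<le> t \<longrightarrow>
        ((\<lambda>\<tau>. g k - of_real (\<nu> * (kappa0 L)\<^sup>2 * ksq k) *s u \<tau> k - Bcoef L (u \<tau>) (u \<tau>) k)
          has_integral (u t k - u s k)) {s..t})"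

definition attractor :: "real \<Rightarrow> real \<Rightarrow> fcoef \<Rightarrow> fcoef set" where
  "attractor L \<nu> g = {u0. inH u0 \<and> (\<exists>u. nse_solution L \<nu> g u \<and> u 0 = u0
      \<and> (\<exists>M. \<forall>t. sqrt (Hnorm2 L (u t)) \<le> M))}"

fun iter_pd :: "2 list \<Rightarrow> (real ^ 2 \<Rightarrow> real ^ 2) \<Rightarrow> real ^ 2 \<Rightarrow> real ^ 2" where
  "iter_pd [] f = f"
| "iter_pd (i # is) f =
     (\<lambda>x. vector_derivative (\<lambda>t. iter_pd is f (x + t *\<^sub>R axis i 1)) (at 0))"

definition smooth_field :: "(real ^ 2 \<Rightarrow> real ^ 2) \<Rightarrow> bool" where
  "smooth_field f \<longleftrightarrow> (\<forall>is. continuous_on UNIV (iter_pd is f)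
      \<and> (\<forall>i x. (\<lambda>t. iter_pd is f (x + t *\<^sub>R axis i 1)) differentiable (at 0)))"

definition smooth_rep :: "real \<Rightarrow> fcoef \<Rightarrow> (real ^ 2 \<Rightarrow> real ^ 2) \<Rightarrow> bool" where
  "smooth_rep L u f \<longleftrightarrow> smooth_field f
     \<and> (\<forall>x i. f (x + L *\<^sub>R axis i 1) = f x)
     \<and> (\<forall>k m. u k $ m = (1 / (L\<^sup>2)) * integral (cbox 0 (\<chi> i. L))
           (\<lambda>x. complex_of_real (f x $ m)
                * cis (- kappa0 L * (real_of_int (fst k) * x $ 1 + real_of_int (snd k) * x $ 2))))"

definition Cclass :: "real \<Rightarrow> real \<Rightarrow> real \<Rightarrow> fcoef set" where
  "Cclass L \<nu> \<sigma> = {u. inH u \<and> (\<exists>f. smooth_rep L u f)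
     \<and> (\<exists>c0. \<forall>\<alpha>::nat. Apow_summable L \<alpha> u
          \<and> Apow_norm2 L \<alpha> u / (\<nu>\<^sup>2 * kappa0 L ^ (2 * \<alpha>)) \<le> c0 * exp (\<sigma> * (real \<alpha>)\<^sup>2))}"

end

theory Submission
  imports Defs
begin

text \<open>All estimates are made on the Fourier side, over windows [b, 0], for the envelopes
  U(k) = sup |u_k(t)| of a solution. By Duhamel's formula, shrinking the window by d gives
  |k| U'(k) \<le> C (U(k) / d + |g_k| / |k| + (U * U)(k)), a gain of one power of |k| over both U and the
  force. Solved for the force, the same formula gives
  |g_k| / |k| \<le> C (|k| |u_k(0)| + U(k) + (U * U)(k)), so if u(0) is in some C(sigma), then the
  force may be traded for u(0), and iteration bounds first all weighted sums of U and then those of g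
  by exp (C s^2). With g in that class, the first inequality gives the same for every other solution.
  The iteration starts from the summability of U. It is obtained from an enstrophy bound,
  which for a weak solution follows by absorption on a window where the integral of the enstrophy is
  small.\<close>

section \<open>Unordered sums of extended nonnegative reals\<close>

text \<open>The supremum over time is taken before the sum over frequencies, so a bound on |u(t)|
  uniform in t says nothing about the sum of the U(k). In exchange, the whole past of the nonlinear
  term in Duhamel's formula is dominated by one convolution that no longer depends on time. All
  windows end at 0, the only time at which a solution is known to lie in C(sigma); they can be long
  enough to be shortened from the left because a trajectory of the attractor has a past. The
  iteration is linear although the equation is not: in a weighted sum of U * U only one factor
  carries the weight, and the unweighted sum of the other stays bounded. Hence step s costs a factor
  of order 2^s and nothing worse. The constant in the exponent deteriorates on the way, which the
  union over sigma permits. The start is delicate in two dimensions: bounded enstrophy yields only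
  U(k) \<le> C |k|^-2, where the lattice sum just diverges, and the force is merely square summable.
  A further half power has to be gained, with the force treated separately.\<close>

abbreviation lsum :: "('a \<Rightarrow> ennreal) \<Rightarrow> ennreal" where
  "lsum f \<equiv> (\<integral>\<^sup>+k. f k \<partial>count_space UNIV)"

text \<open>Passage to the counting measure, where Tonelli, monotone convergence and Cauchy-Schwarz
  hold for extended nonnegative values without summability conditions. One inequality is by finite
  subsets, the other by enumerating the countable lattice.\<close>

lemma infsum_ennreal_eq_lsum:
  fixes f :: "int \<times> int \<Rightarrow> ennreal"
  shows "(\<Sum>\<^sub>\<infinity>k. f k) = lsum f"
proof (rule antisym)
  have "sum f F \<le> lsum f" if "finite F" for F
  proof -
    have "sum f F = (\<integral>\<^sup>+k. f k \<partial>count_space F)"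
      using that by (simp add: nn_integral_count_space_finite)
    also have "\<dots> \<le> lsum f"
      by (subst nn_integral_count_space_indicator)
         (auto intro!: nn_integral_mono simp: indicator_def)
    finally show ?thesis .
  qed
  then show "(\<Sum>\<^sub>\<infinity>k. f k) \<le> lsum f"
    by (subst nonneg_infsum_complete) (auto intro!: SUP_least)
next
  define e where "e = from_nat_into (UNIV :: (int \<times> int) set)"
  have e: "bij_betw e UNIV UNIV"
    unfolding e_def by (rule bij_betw_from_nat_into) (auto simp: finite_prod)
  have "lsum f = (\<Sum>n. f (e n))"
    by (simp flip: nn_integral_bij_count_space[OF e] add: nn_integral_count_space_nat)
  also have "\<dots> = (SUP n. \<Sum>i<n. f (e i))"
    by (rule suminf_eq_SUP)
  also have "\<dots> \<le> (\<Sum>\<^sub>\<infinity>k. f k)"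
  proof (rule SUP_least)
    fix n
    have "(\<Sum>i<n. f (e i)) = sum f (e ` {..<n})"
      using e by (subst sum.reindex) (auto simp: bij_betw_def inj_on_def)
    also have "\<dots> \<le> (\<Sum>\<^sub>\<infinity>k. f k)"
      by (subst nonneg_infsum_complete) (auto intro!: SUP_upper)
    finally show "(\<Sum>i<n. f (e i)) \<le> (\<Sum>\<^sub>\<infinity>k. f k)" .
  qed
  finally show "lsum f \<le> (\<Sum>\<^sub>\<infinity>k. f k)" .
qed

text \<open>Lets the estimates run in \<open>ennreal\<close>; summability of a real series is read
  off at the end from finiteness.\<close>

lemma summable_on_iff_lsum_finite:
  fixes f :: "int \<times> int \<Rightarrow> real"
  assumes nn: "\<And>k. 0 \<le> f k"
  shows "f summable_on UNIV \<longleftrightarrow> lsum (\<lambda>k. ennreal (f k)) < \<infinity>"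
proof -
  have eq: "(SUP F\<in>{F. finite F \<and> F \<subseteq> UNIV}. ennreal (sum f F)) = lsum (\<lambda>k. ennreal (f k))"
    by (simp add: nn nonneg_infsum_complete sum_ennreal flip: infsum_ennreal_eq_lsum)
  show ?thesis
  proof
    assume "f summable_on UNIV"
    from infsum_nonneg_is_SUPREMUM_ennreal[OF this] nn eq
    show "lsum (\<lambda>k. ennreal (f k)) < \<infinity>" by (metis ennreal_less_top infinity_ennreal_def)
  next
    assume fin: "lsum (\<lambda>k. ennreal (f k)) < \<infinity>"
    have "sum f F \<le> enn2real (lsum (\<lambda>k. ennreal (f k)))" if "finite F" for F
    proof -
      have "ennreal (sum f F) \<le> lsum (\<lambda>k. ennreal (f k))"
        unfolding eq[symmetric] using that by (intro SUP_upper) auto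
      then show ?thesis using fin
        by (metis enn2real_ennreal enn2real_mono infinity_ennreal_def nn sum_nonneg)
    qed
    then show "f summable_on UNIV"
      by (intro nonneg_bdd_above_summable_on nn bdd_aboveI2) auto
  qed
qed

lemma ennreal_infsum_eq_lsum:
  fixes f :: "int \<times> int \<Rightarrow> real"
  assumes "\<And>k. 0 \<le> f k" "f summable_on UNIV"
  shows "ennreal (\<Sum>\<^sub>\<infinity>k. f k) = lsum (\<lambda>k. ennreal (f k))"
proof -
  have "ennreal (\<Sum>\<^sub>\<infinity>k. f k) = (SUP F\<in>{F. finite F \<and> F \<subseteq> UNIV}. ennreal (sum f F))"
    using assms by (intro infsum_nonneg_is_SUPREMUM_ennreal) auto
  also have "\<dots> = (\<Sum>\<^sub>\<infinity>k. ennreal (f k))"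
    by (simp add: assms nonneg_infsum_complete sum_ennreal)
  finally show ?thesis by (simp add: infsum_ennreal_eq_lsum)
qed

lemma lsum_shift:
  fixes f :: "int \<times> int \<Rightarrow> ennreal"
  shows "lsum (\<lambda>l. f (l - k)) = lsum f"
  by (rule nn_integral_bij_count_space) (auto intro!: bij_betw_byWitness[where f' = "\<lambda>l. l + k"])

lemma lsum_reflect:
  fixes f :: "int \<times> int \<Rightarrow> ennreal"
  shows "lsum (\<lambda>l. f (k - l)) = lsum f"
  by (rule nn_integral_bij_count_space) (auto intro!: bij_betw_byWitness[where f' = "\<lambda>l. k - l"])

lemma lsum_swap:
  fixes f :: "int \<times> int \<Rightarrow> int \<times> int \<Rightarrow> ennreal"
  shows "lsum (\<lambda>k. lsum (\<lambda>l. f k l)) = lsum (\<lambda>l. lsum (\<lambda>k. f k l))"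
  by (rule nn_integral_count_space_nn_integral) auto

lemma lsum_mono: "(\<And>k. f k \<le> g k) \<Longrightarrow> lsum f \<le> lsum g"
  by (rule nn_integral_mono) auto

lemma lsum_cmult: "lsum (\<lambda>k. c * f k) = c * lsum f"
  by (rule nn_integral_cmult) auto

lemma lsum_multc: "lsum (\<lambda>k. f k * c) = lsum f * c"
  by (rule nn_integral_multc) auto

lemma lsum_add: "lsum (\<lambda>k. f k + g k) = lsum f + lsum g"
  by (rule nn_integral_add) auto

lemma le_lsum: "f k \<le> lsum f"
  by (rule nn_integral_ge_point) auto

text \<open>Tonelli, followed by a shift of k by l in the inner sum.\<close>

lemma lsum_conv_product:
  fixes f g :: "int \<times> int \<Rightarrow> ennreal"
  shows "lsum (\<lambda>k. lsum (\<lambda>l. f l * g (k - l))) = lsum f * lsum g"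
  by (subst lsum_swap) (simp add: lsum_cmult lsum_shift lsum_multc)

lemma lsum_Cauchy_Schwarz: "(lsum (\<lambda>k. f k * g k))\<^sup>2 \<le> lsum (\<lambda>k. (f k)\<^sup>2) * lsum (\<lambda>k. (g k)\<^sup>2)"
  by (rule Cauchy_Schwarz_nn_integral) auto

section \<open>The lattice of frequencies\<close>

definition kn :: "int \<times> int \<Rightarrow> real" where
  "kn k = sqrt (ksq k)"

lemma ksq_nonneg [simp]: "0 \<le> ksq k"
  by (simp add: ksq_def)

lemma kn_nonneg [simp]: "0 \<le> kn k"
  by (simp add: kn_def)

lemma kn_power2: "(kn k)\<^sup>2 = ksq k"
  by (simp add: kn_def)

lemma kn_eq_norm: "kn k = norm (real_of_int (fst k), real_of_int (snd k))"
  by (simp add: kn_def ksq_def norm_prod_def)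

lemma kn_zero [simp]: "kn 0 = 0"
  by (simp add: kn_def ksq_def)

lemma kn_ge_1: "k \<noteq> 0 \<Longrightarrow> 1 \<le> kn k"
proof -
  assume "k \<noteq> 0"
  then have "fst k \<noteq> 0 \<or> snd k \<noteq> 0" by (cases k) (auto simp: zero_prod_def)
  then have "0 < (fst k)\<^sup>2 + (snd k)\<^sup>2"
    by (simp add: sum_power2_gt_zero_iff)
  then have "1 \<le> (fst k)\<^sup>2 + (snd k)\<^sup>2" by linarith
  then have "1 \<le> ksq k" unfolding ksq_def by (metis of_int_1 of_int_le_iff)
  then show ?thesis by (simp add: kn_def)
qed

lemma kn_pos: "k \<noteq> 0 \<Longrightarrow> 0 < kn k"
  using kn_ge_1[of k] by linarith

lemma kn_triangle: "kn k \<le> kn l + kn (k - l)"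
proof -
  have "norm (real_of_int (fst k), real_of_int (snd k))
    = norm ((real_of_int (fst l), real_of_int (snd l)) + (real_of_int (fst (k - l)), real_of_int (snd (k - l))))"
    by simp
  also have "\<dots> \<le> kn l + kn (k - l)"
    unfolding kn_eq_norm by (rule norm_triangle_ineq)
  finally show ?thesis by (simp add: kn_eq_norm)
qed

lemma abs_fst_le_kn: "\<bar>real_of_int (fst k)\<bar> \<le> kn k"
  and abs_snd_le_kn: "\<bar>real_of_int (snd k)\<bar> \<le> kn k"
  by (auto simp: kn_def ksq_def intro!: real_le_rsqrt)

text \<open>Compares |k|^2 with a product of functions of the two components, so that lattice sums
  split into one-dimensional sums and lattice points never have to be counted.\<close>

lemma kn_product_bound:
  assumes "k \<noteq> 0"
  shows "(1 + \<bar>real_of_int (fst k)\<bar>) * (1 + \<bar>real_of_int (snd k)\<bar>) \<le> (2 * kn k)\<^sup>2"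
proof -
  have "(1 + \<bar>real_of_int (fst k)\<bar>) * (1 + \<bar>real_of_int (snd k)\<bar>) \<le> (2 * kn k) * (2 * kn k)"
    using abs_fst_le_kn[of k] abs_snd_le_kn[of k] kn_ge_1[OF assms] by (intro mult_mono) auto
  then show ?thesis by (simp add: power2_eq_square)
qed

text \<open>Discrete form of the integral of x^(-1/2): each term is at most 2 (sqrt (n + 1) - sqrt
  n), and these telescope.\<close>

lemma sum_inverse_sqrt_le: "(\<Sum>j<n. 1 / sqrt (1 + real j)) \<le> 2 * sqrt (real n)"
proof (induction n)
  case (Suc n)
  have "1 / sqrt (1 + real n) \<le> 2 * (sqrt (real n + 1) - sqrt (real n))"
  proof -
    let ?a = "sqrt (real n + 1)" and ?b = "sqrt (real n)"
    have "?a > 0" "?b \<le> ?a" "?a\<^sup>2 - ?b\<^sup>2 = 1" by auto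
    then have "1 = (?a - ?b) * (?a + ?b)" by (simp add: power2_eq_square algebra_simps)
    also have "\<dots> \<le> (?a - ?b) * (2 * ?a)" using \<open>?b \<le> ?a\<close> by (intro mult_left_mono) auto
    finally show ?thesis using \<open>?a > 0\<close> by (simp add: field_simps add.commute)
  qed
  then show ?case using Suc by (simp add: add.commute)
qed auto

text \<open>The index 0 belongs to both half-lines and is counted twice, hence an
  inequality.\<close>

lemma lsum_int_even_le:
  fixes f :: "int \<Rightarrow> ennreal"
  assumes "\<And>j. f (- j) = f j"
  shows "lsum f \<le> 2 * (\<Sum>n. f (int n))"
proof -
  have "lsum f \<le> lsum (\<lambda>j. f j * indicator (range int) j + f j * indicator (range (\<lambda>n. - int n)) j)"
  proof (rule lsum_mono)
    fix j :: int
    have "j \<in> range int \<or> j \<in> range (\<lambda>n. - int n)"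
      by (metis int_cases2 rangeI)
    then show "f j \<le> f j * indicator (range int) j + f j * indicator (range (\<lambda>n. - int n)) j"
      by (auto simp: indicator_def)
  qed
  also have "\<dots> = (\<integral>\<^sup>+j. f j \<partial>count_space (range int)) + (\<integral>\<^sup>+j. f j \<partial>count_space (range (\<lambda>n. - int n)))"
    by (simp add: lsum_add nn_integral_count_space_indicator)
  also have "(\<integral>\<^sup>+j. f j \<partial>count_space (range int)) = (\<integral>\<^sup>+n. f (int n) \<partial>count_space UNIV)"
    by (rule nn_integral_bij_count_space[symmetric]) (auto simp: bij_betw_def inj_on_def)
  also have "(\<integral>\<^sup>+j. f j \<partial>count_space (range (\<lambda>n. - int n))) = (\<integral>\<^sup>+n. f (- int n) \<partial>count_space UNIV)"
    by (rule nn_integral_bij_count_space[symmetric]) (auto simp: bij_betw_def inj_on_def)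
  finally show ?thesis
    by (simp add: assms nn_integral_count_space_nat mult_2)
qed

lemma lsum_product_eq:
  fixes f g :: "int \<Rightarrow> ennreal"
  shows "lsum (\<lambda>k. f (fst k) * g (snd k)) = lsum f * lsum g"
proof -
  have "lsum (\<lambda>k. f (fst k) * g (snd k)) = lsum (\<lambda>i. lsum (\<lambda>j. f i * g j))"
    using nn_integral_fst_count_space[of "\<lambda>k. f (fst k) * g (snd k)"] by simp
  then show ?thesis by (simp add: lsum_cmult lsum_multc)
qed

text \<open>\<open>kn_product_bound\<close> leaves two one-dimensional sums with exponent p/2 > 1.
  The zero frequency is harmless because \<open>0 powr (- p) = 0\<close>.\<close>

lemma lsum_kn_powr_finite:
  fixes p :: real
  assumes "p > 2"
  shows "lsum (\<lambda>k. ennreal (kn k powr (- p))) < \<infinity>"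
proof -
  define \<phi> :: "int \<Rightarrow> real" where "\<phi> j = (1 + \<bar>real_of_int j\<bar>) powr (- p / 2)" for j
  have bd: "ennreal (kn k powr (- p)) \<le> ennreal (2 powr p) * (ennreal (\<phi> (fst k)) * ennreal (\<phi> (snd k)))" for k
  proof (cases "k = 0")
    case False
    have "(2 * kn k) powr (- p) = ((2 * kn k)\<^sup>2) powr (- p / 2)"
    proof -
      have *: "(2 * kn k)\<^sup>2 = (2 * kn k) powr 2" using kn_pos[OF False] by (subst powr_numeral) auto
      show ?thesis unfolding * powr_powr by simp
    qed
    also have "\<dots> \<le> ((1 + \<bar>real_of_int (fst k)\<bar>) * (1 + \<bar>real_of_int (snd k)\<bar>)) powr (- p / 2)"
      using kn_product_bound[OF False] assms by (intro powr_mono2') auto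
    also have "\<dots> = \<phi> (fst k) * \<phi> (snd k)"
      unfolding \<phi>_def by (subst powr_mult) auto
    finally have "2 powr (- p) * kn k powr (- p) \<le> \<phi> (fst k) * \<phi> (snd k)"
      by (simp add: powr_mult)
    then have "2 powr p * (2 powr (- p) * kn k powr (- p)) \<le> 2 powr p * (\<phi> (fst k) * \<phi> (snd k))"
      by (intro mult_left_mono) auto
    then have "kn k powr (- p) \<le> 2 powr p * (\<phi> (fst k) * \<phi> (snd k))"
      by (simp add: powr_minus flip: mult.assoc)
    moreover have "\<phi> j \<ge> 0" for j by (simp add: \<phi>_def)
    ultimately show ?thesis by (simp add: ennreal_leI flip: ennreal_mult)
  qed simp
  have sm: "summable (\<lambda>n. \<phi> (int n))"
  proof -
    have "summable (\<lambda>n. real (Suc n) powr (- p / 2))"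
      using assms by (subst summable_Suc_iff) (simp add: summable_real_powr_iff)
    then show ?thesis by (simp add: \<phi>_def add.commute)
  qed
  have "lsum (\<lambda>j. ennreal (\<phi> j)) \<le> 2 * (\<Sum>n. ennreal (\<phi> (int n)))"
    by (rule lsum_int_even_le) (simp add: \<phi>_def)
  also have "\<dots> < \<infinity>"
  proof -
    have "(\<Sum>n. ennreal (\<phi> (int n))) = ennreal (\<Sum>n. \<phi> (int n))"
      by (rule suminf_ennreal2[OF _ sm]) (simp add: \<phi>_def)
    then show ?thesis by (simp add: ennreal_mult_less_top)
  qed
  finally have fin: "lsum (\<lambda>j. ennreal (\<phi> j)) < \<infinity>" .
  have "lsum (\<lambda>k. ennreal (kn k powr (- p)))
      \<le> ennreal (2 powr p) * (lsum (\<lambda>j. ennreal (\<phi> j)) * lsum (\<lambda>j. ennreal (\<phi> j)))"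
    unfolding lsum_product_eq[symmetric] unfolding lsum_cmult[symmetric] by (rule lsum_mono) (rule bd)
  also have "\<dots> < \<infinity>" using fin by (simp add: ennreal_mult_less_top)
  finally show ?thesis .
qed

text \<open>Lattice version of the integral of 1/|x| over a disc, which is linear in the radius. The
  zero frequency contributes nothing since \<open>1 / 0 = 0\<close>. The constant is 2 * 4^2 * 2: a
  factor 2 from the product bound, 4 sqrt N from each component, and N \<le> 2 r.\<close>

lemma lsum_inverse_kn_le:
  assumes "0 \<le> r"
  shows "lsum (\<lambda>k. if kn k \<le> r then ennreal (1 / kn k) else 0) \<le> ennreal (64 * r)"
proof (cases "r < 1")
  case True
  have "(if kn k \<le> r then ennreal (1 / kn k) else 0) = 0" for k
    using kn_ge_1[of k] True by (cases "k = 0") auto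
  then have "lsum (\<lambda>k. if kn k \<le> r then ennreal (1 / kn k) else 0) = 0" by (simp only: ) simp
  then show ?thesis by simp
next
  case False
  define \<psi> :: "int \<Rightarrow> real" where "\<psi> j = (if \<bar>real_of_int j\<bar> \<le> r then 1 / sqrt (1 + \<bar>real_of_int j\<bar>) else 0)" for j
  have bd: "(if kn k \<le> r then ennreal (1 / kn k) else 0) \<le> 2 * (ennreal (\<psi> (fst k)) * ennreal (\<psi> (snd k)))" for k
  proof (cases "k = 0 \<or> \<not> kn k \<le> r")
    case nz: False
    let ?x = "1 + \<bar>real_of_int (fst k)\<bar>" and ?y = "1 + \<bar>real_of_int (snd k)\<bar>"
    have "sqrt (?x * ?y) \<le> 2 * kn k"
      using kn_product_bound[of k] nz by (intro real_le_lsqrt) auto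
    then have "sqrt ?x * sqrt ?y \<le> 2 * kn k" by (simp only: real_sqrt_mult)
    moreover have "?x > 0" "?y > 0" by auto
    ultimately have "1 / kn k \<le> 2 * ((1 / sqrt ?x) * (1 / sqrt ?y))"
      using kn_pos[of k] nz by (simp add: field_simps)
    then have "1 / kn k \<le> 2 * (\<psi> (fst k) * \<psi> (snd k))"
      using abs_fst_le_kn[of k] abs_snd_le_kn[of k] nz by (simp add: \<psi>_def)
    moreover have "\<psi> j \<ge> 0" for j by (simp add: \<psi>_def)
    ultimately show ?thesis using nz by (simp add: ennreal_leI flip: ennreal_mult ennreal_numeral)
  qed auto
  \<comment> \<open>\<open>N\<close> counts the integers from 0 to floor r; it is at most 2 r
    because r \<ge> 1 in this case.\<close>
  define N where "N = Suc (nat \<lfloor>r\<rfloor>)"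
  have N: "real N \<le> 2 * r" using False unfolding N_def by linarith
  have "lsum (\<lambda>j. ennreal (\<psi> j)) \<le> 2 * (\<Sum>n. ennreal (\<psi> (int n)))"
    by (rule lsum_int_even_le) (simp add: \<psi>_def)
  also have "(\<Sum>n. ennreal (\<psi> (int n))) = (\<Sum>n<N. ennreal (\<psi> (int n)))"
    by (rule suminf_finite) (auto simp: \<psi>_def N_def not_less, linarith)
  also have "\<dots> = ennreal (\<Sum>n<N. \<psi> (int n))"
    by (rule sum_ennreal) (simp add: \<psi>_def)
  also have "(\<Sum>n<N. \<psi> (int n)) \<le> (\<Sum>n<N. 1 / sqrt (1 + real n))"
    by (rule sum_mono) (simp add: \<psi>_def)
  also have "\<dots> \<le> 2 * sqrt (real N)" by (rule sum_inverse_sqrt_le)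
  also have "2 * ennreal (2 * sqrt (real N)) = ennreal (4 * sqrt (real N))"
    by (simp flip: ennreal_mult ennreal_numeral)
  finally have \<psi>: "lsum (\<lambda>j. ennreal (\<psi> j)) \<le> ennreal (4 * sqrt (real N))"
    by (simp add: ennreal_leI mult_left_mono)
  have "lsum (\<lambda>k. if kn k \<le> r then ennreal (1 / kn k) else 0)
      \<le> 2 * (lsum (\<lambda>j. ennreal (\<psi> j)) * lsum (\<lambda>j. ennreal (\<psi> j)))"
    unfolding lsum_product_eq[symmetric] unfolding lsum_cmult[symmetric] by (rule lsum_mono) (rule bd)
  also have "\<dots> \<le> 2 * (ennreal (4 * sqrt (real N)) * ennreal (4 * sqrt (real N)))"
    by (intro mult_mono \<psi>) auto
  also have "\<dots> = ennreal (32 * real N)"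
    by (simp flip: ennreal_mult ennreal_numeral)
  also have "\<dots> \<le> ennreal (64 * r)" using N by (intro ennreal_leI) auto
  finally show ?thesis .
qed

section \<open>Convolutions\<close>

definition conv :: "(int \<times> int \<Rightarrow> ennreal) \<Rightarrow> (int \<times> int \<Rightarrow> ennreal) \<Rightarrow> int \<times> int \<Rightarrow> ennreal" where
  "conv a b k = lsum (\<lambda>l. a l * b (k - l))"

text \<open>Weighted l^1 norms replace the l^2 norms of \<open>Cclass\<close>: l^1 is closed under
  convolution, so the nonlinear term is controlled at order s without a loss of order.\<close>

definition wsum :: "nat \<Rightarrow> (int \<times> int \<Rightarrow> ennreal) \<Rightarrow> ennreal" where
  "wsum s a = lsum (\<lambda>k. ennreal (kn k ^ s) * a k)"

lemma wsum_0: "wsum 0 a = lsum a"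
  by (simp add: wsum_def)

lemma wsum_mono: "(\<And>k. a k \<le> b k) \<Longrightarrow> wsum s a \<le> wsum s b"
  unfolding wsum_def by (intro lsum_mono mult_left_mono) auto

lemma wsum_add: "wsum s (\<lambda>k. a k + b k) = wsum s a + wsum s b"
  by (simp add: wsum_def distrib_left lsum_add)

lemma wsum_cmult: "wsum s (\<lambda>k. c * a k) = c * wsum s a"
  by (simp add: wsum_def lsum_cmult mult.left_commute)

lemma wsum_kn_power: "wsum s (\<lambda>k. ennreal (kn k ^ r) * a k) = wsum (s + r) a"
  by (simp add: wsum_def power_add ennreal_mult mult.assoc)

lemma conv_mono: "(\<And>k. a k \<le> a' k) \<Longrightarrow> (\<And>k. b k \<le> b' k) \<Longrightarrow> conv a b k \<le> conv a' b' k"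
  unfolding conv_def by (intro lsum_mono mult_mono) auto

lemma add_power_le:
  fixes x y :: real
  assumes "0 \<le> x" "0 \<le> y"
  shows "(x + y) ^ s \<le> 2 ^ s * (x ^ s + y ^ s)"
proof -
  have "(x + y) ^ s \<le> (2 * max x y) ^ s" using assms by (intro power_mono) auto
  also have "\<dots> = 2 ^ s * max x y ^ s" by (simp add: power_mult_distrib)
  also have "max x y ^ s \<le> x ^ s + y ^ s" using assms by (auto simp: max_def)
  finally show ?thesis by simp
qed

text \<open>A tame estimate: by |k| \<le> |l| + |k - l| the weight falls on one factor at a time,
  while the other keeps weight 0. This makes the later recursion linear in the sum of order
  s.\<close>

lemma wsum_conv_le:
  "wsum s (conv a b) \<le> 2 ^ s * (wsum s a * wsum 0 b + wsum 0 a * wsum s b)"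
proof -
  have "wsum s (conv a b) = lsum (\<lambda>k. lsum (\<lambda>l. ennreal (kn k ^ s) * (a l * b (k - l))))"
    by (simp add: wsum_def conv_def lsum_cmult)
  also have "\<dots> \<le> lsum (\<lambda>k. lsum (\<lambda>l. 2 ^ s * ((ennreal (kn l ^ s) * a l) * b (k - l) + a l * (ennreal (kn (k - l) ^ s) * b (k - l)))))"
  proof (intro lsum_mono)
    fix k l
    have "kn k ^ s \<le> (kn l + kn (k - l)) ^ s"
      using kn_triangle by (intro power_mono) auto
    also have "\<dots> \<le> 2 ^ s * (kn l ^ s + kn (k - l) ^ s)"
      by (rule add_power_le) auto
    finally have "ennreal (kn k ^ s) \<le> ennreal (2 ^ s * (kn l ^ s + kn (k - l) ^ s))"
      by (rule ennreal_leI)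
    also have "\<dots> = 2 ^ s * (ennreal (kn l ^ s) + ennreal (kn (k - l) ^ s))"
      by (simp add: ennreal_mult ennreal_power[symmetric])
    finally have "ennreal (kn k ^ s) * (a l * b (k - l))
        \<le> 2 ^ s * (ennreal (kn l ^ s) + ennreal (kn (k - l) ^ s)) * (a l * b (k - l))"
      by (rule mult_right_mono) auto
    then show "ennreal (kn k ^ s) * (a l * b (k - l))
        \<le> 2 ^ s * ((ennreal (kn l ^ s) * a l) * b (k - l) + a l * (ennreal (kn (k - l) ^ s) * b (k - l)))"
      by (simp add: algebra_simps)
  qed
  also have "\<dots> = 2 ^ s * (wsum s a * wsum 0 b + wsum 0 a * wsum s b)"
    by (simp only: lsum_cmult lsum_add lsum_conv_product[of "\<lambda>l. ennreal (kn l ^ s) * a l" b]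
        lsum_conv_product[of a "\<lambda>l. ennreal (kn l ^ s) * b l"] wsum_def[of s] wsum_0)
  finally show ?thesis .
qed

lemma sum_power2_ennreal_le: "(x + y)\<^sup>2 \<le> 2 * x\<^sup>2 + 2 * (y::ennreal)\<^sup>2"
proof (cases "x = \<infinity> \<or> y = \<infinity>")
  case False
  then obtain p q where "x = ennreal p" "y = ennreal q" "p \<ge> 0" "q \<ge> 0"
    by (metis ennreal_cases infinity_ennreal_def)
  moreover have "(p + q)\<^sup>2 \<le> 2 * p\<^sup>2 + 2 * q\<^sup>2"
    using sum_squares_ge_zero[of "p - q" 0] by (simp add: power2_eq_square algebra_simps)
  ultimately show ?thesis
    by (simp add: ennreal_leI ennreal_power flip: ennreal_plus ennreal_mult ennreal_numeral)
qed (auto simp: power2_eq_square ennreal_mult_top ennreal_top_mult)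

text \<open>Ladyzhenskaya's inequality on the Fourier side. A Cauchy--Schwarz estimate of the convolution at
  a fixed frequency k diverges logarithmically over the frequencies l, k - l larger than k; in that
  range (G1 below) the two tails are estimated separately and the sum over k is taken first.\<close>

lemma lsum_conv_square_le:
  fixes a :: "int \<times> int \<Rightarrow> ennreal" and \<omega> :: "int \<times> int \<Rightarrow> real"
  assumes a0: "a 0 = 0" and \<omega>0: "\<omega> 0 = 0" and \<omega>nn: "\<And>k. 0 \<le> \<omega> k"
    and \<omega>2: "\<And>k m. kn k \<le> 2 * kn m \<Longrightarrow> \<omega> k \<le> 2 * \<omega> m"
  shows "lsum (\<lambda>k. (ennreal (\<omega> k) * conv a a k)\<^sup>2)
     \<le> 6144 * (lsum (\<lambda>l. ennreal (kn l) * (a l)\<^sup>2) * lsum (\<lambda>m. ennreal (kn m) * (ennreal (\<omega> m) * a m)\<^sup>2))"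
proof -
  define w where "w m = ennreal (\<omega> m) * a m" for m
  define P where "P = lsum (\<lambda>l. ennreal (kn l) * (a l)\<^sup>2)"
  define Q where "Q = lsum (\<lambda>m. ennreal (kn m) * (w m)\<^sup>2)"
  define G where "G k = lsum (\<lambda>l. if kn l \<le> kn (k - l) then a l * w (k - l) else 0)" for k
  define G1 where "G1 k = lsum (\<lambda>l. (if kn k < kn l then a l else 0) * (if kn k < kn (k - l) then w (k - l) else 0))" for k
  define G2 where "G2 k = lsum (\<lambda>l. if kn l \<le> kn (k - l) \<and> kn l \<le> kn k then a l * w (k - l) else 0)" for k
  \<comment> \<open>Exchanging l and k - l, the smaller frequency may be called l. Then |k| \<le> 2
    |k - l|, so \<open>\<omega>\<close> moves onto the larger frequency for a factor 2; the two
    halves together give 4.\<close>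
  have step1: "ennreal (\<omega> k) * conv a a k \<le> 4 * G k" for k
  proof -
    have "ennreal (\<omega> k) * conv a a k = lsum (\<lambda>l. ennreal (\<omega> k) * (a l * a (k - l)))"
      by (simp add: conv_def lsum_cmult)
    also have "\<dots> \<le> lsum (\<lambda>l. 2 * (if kn l \<le> kn (k - l) then a l * w (k - l) else 0)
         + 2 * (if kn (k - l) \<le> kn (k - (k - l)) then a (k - l) * w (k - (k - l)) else 0))"
    proof (rule lsum_mono)
      fix l
      have bd: "ennreal (\<omega> k) * (x * a m) \<le> 2 * (x * w m)" if "kn k \<le> 2 * kn m" for m x
      proof -
        have "ennreal (\<omega> k) \<le> 2 * ennreal (\<omega> m)"
          using \<omega>2[OF that] \<omega>nn[of m] by (simp add: ennreal_leI flip: ennreal_mult ennreal_numeral)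
        then have "ennreal (\<omega> k) * (x * a m) \<le> 2 * ennreal (\<omega> m) * (x * a m)"
          by (rule mult_right_mono) auto
        then show ?thesis by (simp add: w_def mult_ac)
      qed
      show "ennreal (\<omega> k) * (a l * a (k - l)) \<le> 2 * (if kn l \<le> kn (k - l) then a l * w (k - l) else 0)
         + 2 * (if kn (k - l) \<le> kn (k - (k - l)) then a (k - l) * w (k - (k - l)) else 0)"
      proof (cases "kn l \<le> kn (k - l)")
        case True
        with kn_triangle[of k l] have "kn k \<le> 2 * kn (k - l)" by simp
        from bd[OF this, of "a l"] True show ?thesis
          by (simp add: add_increasing2)
      next
        case False
        with kn_triangle[of k l] have "kn k \<le> 2 * kn l" by simp
        from bd[OF this, of "a (k - l)"] False show ?thesis
          by (simp add: mult_ac)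
      qed
    qed
    also have "\<dots> = 2 * G k + 2 * G k"
      by (simp only: lsum_add lsum_cmult G_def lsum_reflect[of "\<lambda>l. if kn l \<le> kn (k - l) then a l * w (k - l) else 0" k])
    finally show ?thesis by (simp add: distrib_right[symmetric])
  qed
  have step2: "G k \<le> G1 k + G2 k" for k
    unfolding G_def G1_def G2_def lsum_add[symmetric] by (rule lsum_mono) auto
  \<comment> \<open>Here Cauchy-Schwarz at fixed k with the weight (|l| |k - l|)^(1/2) succeeds: |k
    - l| \<ge> |k|/2, and the sum of 1/|l| over |l| \<le> |k| is at most 64 |k|, so the dual factor
    is at most (2/|k|) 64 |k| = 128.\<close>
  have sum_G2: "lsum (\<lambda>k. (G2 k)\<^sup>2) \<le> 128 * (P * Q)"
  proof -
    have "(G2 k)\<^sup>2 \<le> 128 * lsum (\<lambda>l. (ennreal (kn l) * (a l)\<^sup>2) * (ennreal (kn (k - l)) * (w (k - l))\<^sup>2))" for k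
    proof -
      define f where "f l = ennreal (sqrt (kn l * kn (k - l))) * (a l * w (k - l))" for l
      define h where "h l = (if kn l \<le> kn (k - l) \<and> kn l \<le> kn k then ennreal (1 / sqrt (kn l * kn (k - l))) else 0)" for l
      have "G2 k = lsum (\<lambda>l. f l * h l)"
        unfolding G2_def
      proof (rule nn_integral_cong)
        fix l
        show "(if kn l \<le> kn (k - l) \<and> kn l \<le> kn k then a l * w (k - l) else 0) = f l * h l"
        proof (cases "kn l \<le> kn (k - l) \<and> kn l \<le> kn k \<and> l \<noteq> 0")
          case True
          then have "kn l > 0" "kn (k - l) > 0" using kn_pos[of l] by auto
          then have "ennreal (sqrt (kn l * kn (k - l))) * ennreal (1 / sqrt (kn l * kn (k - l))) = 1"
            by (subst ennreal_mult[symmetric]) auto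
          then show ?thesis using True by (simp add: f_def h_def mult_ac)
        qed (auto simp: h_def f_def a0)
      qed
      then have "(G2 k)\<^sup>2 \<le> lsum (\<lambda>l. (f l)\<^sup>2) * lsum (\<lambda>l. (h l)\<^sup>2)"
        by (simp add: lsum_Cauchy_Schwarz)
      also have "lsum (\<lambda>l. (f l)\<^sup>2) = lsum (\<lambda>l. (ennreal (kn l) * (a l)\<^sup>2) * (ennreal (kn (k - l)) * (w (k - l))\<^sup>2))"
        by (intro nn_integral_cong) (simp add: f_def power_mult_distrib ennreal_power ennreal_mult mult_ac)
      also have "lsum (\<lambda>l. (h l)\<^sup>2) \<le> 128"
      proof -
        have "lsum (\<lambda>l. (h l)\<^sup>2) \<le> lsum (\<lambda>l. ennreal (2 / kn k) * (if kn l \<le> kn k then ennreal (1 / kn l) else 0))"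
        proof (rule lsum_mono)
          fix l
          show "(h l)\<^sup>2 \<le> ennreal (2 / kn k) * (if kn l \<le> kn k then ennreal (1 / kn l) else 0)"
          proof (cases "kn l \<le> kn (k - l) \<and> kn l \<le> kn k \<and> l \<noteq> 0")
            case True
            then have p: "kn l > 0" "kn (k - l) > 0" "kn k > 0" using kn_pos[of l] by auto
            have "kn k \<le> 2 * kn (k - l)" using kn_triangle[of k l] True by simp
            then have "1 / (kn l * kn (k - l)) \<le> (2 / kn k) * (1 / kn l)"
              using p by (simp add: field_simps)
            moreover have "(h l)\<^sup>2 = ennreal (1 / (kn l * kn (k - l)))"
              using True by (simp add: h_def ennreal_power power_divide)
            ultimately show ?thesis using True by (simp add: ennreal_leI flip: ennreal_mult)
          qed (auto simp: h_def)
        qed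
        also have "\<dots> \<le> ennreal (2 / kn k) * ennreal (64 * kn k)"
          unfolding lsum_cmult by (intro mult_left_mono lsum_inverse_kn_le) auto
        also have "\<dots> \<le> 128"
          by (cases "kn k = 0") (auto simp flip: ennreal_mult)
        finally show ?thesis .
      qed
      finally show ?thesis by (simp only: mult.commute[of 128] mult_left_mono zero_le)
    qed
    then have "lsum (\<lambda>k. (G2 k)\<^sup>2) \<le> lsum (\<lambda>k. 128 * lsum (\<lambda>l. (ennreal (kn l) * (a l)\<^sup>2) * (ennreal (kn (k - l)) * (w (k - l))\<^sup>2)))"
      by (rule lsum_mono)
    also have "\<dots> = 128 * (P * Q)"
      by (simp only: lsum_cmult P_def Q_def lsum_conv_product[of "\<lambda>l. ennreal (kn l) * (a l)\<^sup>2" "\<lambda>m. ennreal (kn m) * (w m)\<^sup>2"])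
    finally show ?thesis .
  qed
  \<comment> \<open>The first tail is at most P/|k|; the second, summed over k against 1/|k|, yields
    64 |m|. The frequency 0 is left out, as nothing can be gained from 1/|k| there;
    \<open>\<omega> 0 = 0\<close> removes it from the left-hand side of the lemma.\<close>
  have sum_G1: "lsum (\<lambda>k. if k = 0 then 0 else (G1 k)\<^sup>2) \<le> 64 * (P * Q)"
  proof -
    have "(if k = 0 then 0 else (G1 k)\<^sup>2) \<le> P * lsum (\<lambda>m. (if kn k \<le> kn m then ennreal (1 / kn k) else 0) * (w m)\<^sup>2)" for k
    proof (cases "k = 0")
      case False
      have "(G1 k)\<^sup>2 \<le> lsum (\<lambda>l. (if kn k < kn l then a l else 0)\<^sup>2) * lsum (\<lambda>l. (if kn k < kn (k - l) then w (k - l) else 0)\<^sup>2)"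
        unfolding G1_def by (rule lsum_Cauchy_Schwarz)
      also have "lsum (\<lambda>l. (if kn k < kn (k - l) then w (k - l) else 0)\<^sup>2) = lsum (\<lambda>m. (if kn k < kn m then w m else 0)\<^sup>2)"
        by (rule lsum_reflect)
      also have "lsum (\<lambda>l. (if kn k < kn l then a l else 0)\<^sup>2) \<le> lsum (\<lambda>l. ennreal (1 / kn k) * (ennreal (kn l) * (a l)\<^sup>2))"
      proof (rule lsum_mono)
        fix l
        show "(if kn k < kn l then a l else 0)\<^sup>2 \<le> ennreal (1 / kn k) * (ennreal (kn l) * (a l)\<^sup>2)"
        proof (cases "kn k < kn l")
          case True
          have "1 \<le> ennreal (1 / kn k * kn l)" using True kn_pos[OF False]
            by (subst ennreal_1[symmetric], intro ennreal_leI) (simp add: field_simps)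
          from mult_right_mono[OF this, of "(a l)\<^sup>2"] True show ?thesis
            by (simp add: ennreal_mult[of "1 / kn k" "kn l"] mult.assoc del: times_divide_eq_left)
        qed simp
      qed
      also have "\<dots> = ennreal (1 / kn k) * P" by (simp add: lsum_cmult P_def)
      also have "lsum (\<lambda>m. (if kn k < kn m then w m else 0)\<^sup>2) \<le> lsum (\<lambda>m. (if kn k \<le> kn m then 1 else 0) * (w m)\<^sup>2)"
        by (intro lsum_mono) auto
      finally have "(G1 k)\<^sup>2 \<le> ennreal (1 / kn k) * P * lsum (\<lambda>m. (if kn k \<le> kn m then 1 else 0) * (w m)\<^sup>2)"
        by (simp add: mult_mono)
      also have "\<dots> = P * lsum (\<lambda>m. ennreal (1 / kn k) * ((if kn k \<le> kn m then 1 else 0) * (w m)\<^sup>2))"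
        by (simp add: lsum_cmult mult_ac)
      also have "(\<lambda>m. ennreal (1 / kn k) * ((if kn k \<le> kn m then 1 else 0) * (w m)\<^sup>2))
          = (\<lambda>m. (if kn k \<le> kn m then ennreal (1 / kn k) else 0) * (w m)\<^sup>2)"
        by auto
      finally show ?thesis using False by simp
    qed simp
    then have "lsum (\<lambda>k. if k = 0 then 0 else (G1 k)\<^sup>2)
       \<le> lsum (\<lambda>k. P * lsum (\<lambda>m. (if kn k \<le> kn m then ennreal (1 / kn k) else 0) * (w m)\<^sup>2))"
      by (rule lsum_mono)
    also have "\<dots> = P * lsum (\<lambda>m. lsum (\<lambda>k. if kn k \<le> kn m then ennreal (1 / kn k) else 0) * (w m)\<^sup>2)"
      by (simp only: lsum_cmult, subst lsum_swap) (simp only: lsum_multc)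
    also have "\<dots> \<le> P * lsum (\<lambda>m. ennreal (64 * kn m) * (w m)\<^sup>2)"
      by (intro mult_left_mono lsum_mono mult_right_mono lsum_inverse_kn_le) auto
    also have "\<dots> = 64 * (P * Q)"
      by (simp add: Q_def ennreal_mult mult.assoc lsum_cmult) (simp add: mult.left_commute)
    finally show ?thesis .
  qed
  \<comment> \<open>32 = 2 * 4^2, with 4 from \<open>step1\<close> and 2 from the square of a sum;
    then 32 * 64 + 32 * 128 = 6144.\<close>
  have "lsum (\<lambda>k. (ennreal (\<omega> k) * conv a a k)\<^sup>2)
     \<le> lsum (\<lambda>k. 32 * (if k = 0 then 0 else (G1 k)\<^sup>2) + 32 * (G2 k)\<^sup>2)"
  proof (rule lsum_mono)
    fix k
    show "(ennreal (\<omega> k) * conv a a k)\<^sup>2 \<le> 32 * (if k = 0 then 0 else (G1 k)\<^sup>2) + 32 * (G2 k)\<^sup>2"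
    proof (cases "k = 0")
      case False
      have "(ennreal (\<omega> k) * conv a a k)\<^sup>2 \<le> (4 * (G1 k + G2 k))\<^sup>2"
        by (intro power_mono order_trans[OF step1] mult_left_mono step2) auto
      also have "\<dots> = 16 * (G1 k + G2 k)\<^sup>2" unfolding power_mult_distrib by simp
      also have "\<dots> \<le> 16 * (2 * (G1 k)\<^sup>2 + 2 * (G2 k)\<^sup>2)"
        by (intro mult_left_mono sum_power2_ennreal_le) auto
      also have "\<dots> = 32 * (G1 k)\<^sup>2 + 32 * (G2 k)\<^sup>2"
        by (simp add: distrib_left flip: mult.assoc)
      finally show ?thesis using False by simp
    qed (simp add: \<omega>0)
  qed
  also have "\<dots> = 32 * lsum (\<lambda>k. if k = 0 then 0 else (G1 k)\<^sup>2) + 32 * lsum (\<lambda>k. (G2 k)\<^sup>2)"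
    by (simp only: lsum_add lsum_cmult)
  also have "\<dots> \<le> 32 * (64 * (P * Q)) + 32 * (128 * (P * Q))"
    by (intro add_mono mult_left_mono sum_G1 sum_G2) auto
  also have "\<dots> = 6144 * (P * Q)"
    by (simp flip: mult.assoc distrib_right)
  finally show ?thesis by (simp add: P_def Q_def w_def)
qed

section \<open>Bounds for the Leray projection and for square summable coefficients\<close>

lemma norm_vector_smult: "norm (c *s (v :: complex ^ 2)) = norm c * norm v"
  by (simp add: norm_vec_def norm_mult L2_set_right_distrib)

lemma norm_kdot_le: "norm (kdot k w) \<le> 2 * kn k * norm w"
proof -
  have "norm (kdot k w) \<le> \<bar>real_of_int (fst k)\<bar> * norm (w $ 1) + \<bar>real_of_int (snd k)\<bar> * norm (w $ 2)"
    unfolding kdot_def by (rule order_trans[OF norm_triangle_ineq]) (simp add: norm_mult)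
  also have "\<dots> \<le> kn k * norm w + kn k * norm w"
    by (intro add_mono mult_mono abs_fst_le_kn abs_snd_le_kn Finite_Cartesian_Product.norm_nth_le) auto
  finally show ?thesis by (simp add: mult_ac)
qed

lemma kdot_diff: "kdot k (v - w) = kdot k v - kdot k w"
  by (simp add: kdot_def algebra_simps)

lemma leray_diff: "leray k (v - w) = leray k v - leray k w"
  by (simp add: leray_def kdot_diff vec_eq_iff diff_divide_distrib algebra_simps)

text \<open>A crude triangle inequality, 1 + 4 = 5. Orthogonality would give 1, but what matters is
  a constant uniform in k.\<close>

lemma norm_leray_le: "norm (leray k w) \<le> 5 * norm w"
proof (cases "k = 0")
  case False
  let ?v = "(\<chi> i. if i = 1 then of_int (fst k) else of_int (snd k)) :: complex ^ 2"
  have "norm ?v \<le> (\<Sum>i\<in>UNIV. norm (?v $ i))" unfolding norm_vec_def by (rule L2_set_le_sum) auto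
  also have "\<dots> \<le> 2 * kn k"
    using abs_fst_le_kn[of k] abs_snd_le_kn[of k] by (simp add: UNIV_2)
  finally have v: "norm ?v \<le> 2 * kn k" .
  have "norm (leray k w) \<le> norm w + norm (kdot k w) / ksq k * norm ?v"
    using False unfolding leray_def zero_prod_def
    by (auto intro!: order_trans[OF norm_triangle_ineq4] simp: norm_vector_smult norm_divide)
  also have "norm (kdot k w) / ksq k * norm ?v \<le> (2 * kn k * norm w) / ksq k * (2 * kn k)"
    by (intro mult_mono divide_right_mono norm_kdot_le v) auto
  also have "\<dots> = 4 * norm w"
    using kn_pos[OF False] by (simp add: kn_power2[symmetric] power2_eq_square)
  finally show ?thesis by simp
qed (simp add: leray_def zero_prod_def)

definition l2sq :: "fcoef \<Rightarrow> real" where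
  "l2sq a = (\<Sum>\<^sub>\<infinity>k. (norm (a k))\<^sup>2)"

abbreviation l2 :: "fcoef \<Rightarrow> bool" where
  "l2 a \<equiv> (\<lambda>k. (norm (a k))\<^sup>2) summable_on UNIV"

definition enorm :: "fcoef \<Rightarrow> int \<times> int \<Rightarrow> ennreal" where
  "enorm a k = ennreal (norm (a k))"

lemma l2sq_nonneg: "0 \<le> l2sq a"
  unfolding l2sq_def by (rule infsum_nonneg) auto

lemma lsum_enorm_square: "l2 a \<Longrightarrow> lsum (\<lambda>k. (enorm a k)\<^sup>2) = ennreal (l2sq a)"
  by (simp add: l2sq_def ennreal_infsum_eq_lsum enorm_def ennreal_power)

lemma conv_Cauchy_Schwarz:
  "(conv a b k)\<^sup>2 \<le> lsum (\<lambda>l. (a l)\<^sup>2) * lsum (\<lambda>l. (b l)\<^sup>2)"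
  unfolding conv_def
  by (rule order_trans[OF lsum_Cauchy_Schwarz]) (simp add: lsum_reflect[of "\<lambda>l. (b l)\<^sup>2"])

lemma ennreal_le_of_power2_le:
  assumes "x\<^sup>2 \<le> (ennreal c)\<^sup>2" "0 \<le> c"
  shows "x \<le> ennreal c"
proof (cases x)
  case (real r)
  with assms have "r\<^sup>2 \<le> c\<^sup>2" by (simp add: ennreal_power)
  then have "r \<le> c" using assms(2) by (rule power2_le_imp_le)
  with real show ?thesis by (simp add: ennreal_leI)
next
  case top
  with assms have "top \<le> ennreal (c\<^sup>2)" by (simp add: ennreal_power)
  then show ?thesis by (simp add: top_unique)
qed

lemma conv_enorm_le:
  assumes "l2 a" "l2 b"
  shows "conv (enorm a) (enorm b) k \<le> ennreal (sqrt (l2sq a) * sqrt (l2sq b))"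
proof (rule ennreal_le_of_power2_le)
  show "(conv (enorm a) (enorm b) k)\<^sup>2 \<le> (ennreal (sqrt (l2sq a) * sqrt (l2sq b)))\<^sup>2"
    using conv_Cauchy_Schwarz[of "enorm a" "enorm b" k] assms
    by (simp add: lsum_enorm_square ennreal_power power_mult_distrib l2sq_nonneg ennreal_mult)
qed (simp add: l2sq_nonneg)

section \<open>The bilinear term\<close>

text \<open>As u is divergence free, the frequency l of the differentiated factor may be replaced by the
  output frequency k; the series then converges for all square summable coefficients.\<close>

definition bilin :: "real \<Rightarrow> fcoef \<Rightarrow> fcoef \<Rightarrow> fcoef" where
  "bilin \<kappa> a b k = (\<Sum>\<^sub>\<infinity>l. (\<i> * of_real \<kappa> * kdot k (a (k - l))) *s b l)"

lemma Bcoef_eq_bilin: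
  assumes "inH u"
  shows "Bcoef L u v k = leray k (bilin (kappa0 L) u v k)"
proof -
  have "u (k - l) $ 1 * of_int (fst l) + u (k - l) $ 2 * of_int (snd l) = kdot k (u (k - l))" for l
  proof -
    have "kdot (k - l) (u (k - l)) = 0" using assms unfolding inH_def by blast
    then show ?thesis by (simp add: kdot_def algebra_simps)
  qed
  then show ?thesis by (simp add: Bcoef_def bilin_def minus_prod_def)
qed

text \<open>With the derivative on the output frequency, |k| leaves the sum and a plain convolution
  of moduli remains, finite by Cauchy-Schwarz. This |k| is the one power that the viscous gain of
  |k|^2 has to pay for.\<close>

lemma bilin_summable_bound:
  assumes "l2 a" "l2 b" "0 \<le> \<kappa>"
  shows "(\<lambda>l. norm ((\<i> * of_real \<kappa> * kdot k (a (k - l))) *s b l)) summable_on UNIV"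
    and "ennreal (norm (bilin \<kappa> a b k)) \<le> ennreal (2 * \<kappa> * kn k) * conv (enorm a) (enorm b) k"
proof -
  let ?f = "\<lambda>l. (\<i> * of_real \<kappa> * kdot k (a (k - l))) *s b l"
  have "lsum (\<lambda>l. ennreal (norm (?f l))) \<le> lsum (\<lambda>l. ennreal (2 * \<kappa> * kn k) * (enorm a (k - l) * enorm b (k - (k - l))))"
  proof (rule lsum_mono)
    fix l
    have "norm (?f l) \<le> \<kappa> * (2 * kn k * norm (a (k - l))) * norm (b l)"
      unfolding norm_vector_smult norm_mult using assms
      by (auto intro!: mult_right_mono mult_left_mono norm_kdot_le)
    then show "ennreal (norm (?f l)) \<le> ennreal (2 * \<kappa> * kn k) * (enorm a (k - l) * enorm b (k - (k - l)))"
      using assms by (simp add: enorm_def ennreal_leI mult_ac flip: ennreal_mult)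
  qed
  also have "\<dots> = ennreal (2 * \<kappa> * kn k) * conv (enorm a) (enorm b) k"
    unfolding lsum_cmult lsum_reflect[of "\<lambda>l. enorm a l * enorm b (k - l)" k] by (simp add: conv_def)
  finally have bd: "lsum (\<lambda>l. ennreal (norm (?f l))) \<le> ennreal (2 * \<kappa> * kn k) * conv (enorm a) (enorm b) k" .
  also have "\<dots> \<le> ennreal (2 * \<kappa> * kn k) * ennreal (sqrt (l2sq a) * sqrt (l2sq b))"
    by (intro mult_left_mono conv_enorm_le assms) auto
  also have "\<dots> < \<infinity>" by (simp add: ennreal_mult_less_top)
  finally show sm: "(\<lambda>l. norm (?f l)) summable_on UNIV"
    by (subst summable_on_iff_lsum_finite) auto
  have "ennreal (norm (bilin \<kappa> a b k)) \<le> ennreal (\<Sum>\<^sub>\<infinity>l. norm (?f l))"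
    unfolding bilin_def using sm by (intro ennreal_leI norm_infsum_bound)
  also have "\<dots> = lsum (\<lambda>l. ennreal (norm (?f l)))"
    using sm by (intro ennreal_infsum_eq_lsum) auto
  finally show "ennreal (norm (bilin \<kappa> a b k)) \<le> ennreal (2 * \<kappa> * kn k) * conv (enorm a) (enorm b) k"
    using bd by simp
qed

lemma norm_bilin_le:
  assumes "l2 a" "l2 b" "0 \<le> \<kappa>"
  shows "norm (bilin \<kappa> a b k) \<le> 2 * \<kappa> * kn k * (sqrt (l2sq a) * sqrt (l2sq b))"
proof -
  have "ennreal (norm (bilin \<kappa> a b k)) \<le> ennreal (2 * \<kappa> * kn k) * ennreal (sqrt (l2sq a) * sqrt (l2sq b))"
    by (intro order_trans[OF bilin_summable_bound(2)[OF assms]] mult_left_mono conv_enorm_le assms) auto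
  then show ?thesis
    using assms by (simp add: l2sq_nonneg ennreal_le_iff flip: ennreal_mult)
qed

lemma norm_Bcoef_le:
  assumes "inH u" "L > 0"
  shows "ennreal (norm (Bcoef L u u k)) \<le> ennreal (10 * kappa0 L * kn k) * conv (enorm u) (enorm u) k"
proof -
  have \<kappa>: "0 \<le> kappa0 L" using assms by (simp add: kappa0_def)
  have "ennreal (norm (Bcoef L u u k)) \<le> ennreal (5 * norm (bilin (kappa0 L) u u k))"
    unfolding Bcoef_eq_bilin[OF assms(1)] by (intro ennreal_leI norm_leray_le)
  also have "\<dots> = 5 * ennreal (norm (bilin (kappa0 L) u u k))" by (simp add: ennreal_mult)
  also have "\<dots> \<le> 5 * (ennreal (2 * kappa0 L * kn k) * conv (enorm u) (enorm u) k)"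
    using assms \<kappa> by (intro mult_left_mono bilin_summable_bound) (auto simp: inH_def)
  also have "\<dots> = ennreal (10 * kappa0 L * kn k) * conv (enorm u) (enorm u) k"
    using \<kappa> by (simp add: ennreal_mult flip: mult.assoc)
  finally show ?thesis .
qed

lemma l2_diff:
  assumes "l2 a" "l2 b"
  shows "l2 (\<lambda>k. a k - b k)"
proof (rule summable_on_comparison_test)
  show "(\<lambda>k. 2 * (norm (a k))\<^sup>2 + 2 * (norm (b k))\<^sup>2) summable_on UNIV"
    using assms by (intro summable_on_add summable_on_cmult_right)
  show "(norm (a k - b k))\<^sup>2 \<le> 2 * (norm (a k))\<^sup>2 + 2 * (norm (b k))\<^sup>2" for k
  proof -
    have "(norm (a k - b k))\<^sup>2 \<le> (norm (a k) + norm (b k))\<^sup>2"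
      by (intro power_mono norm_triangle_ineq4) auto
    also have "\<dots> \<le> 2 * (norm (a k))\<^sup>2 + 2 * (norm (b k))\<^sup>2"
      using sum_squares_ge_zero[of "norm (a k) - norm (b k)" 0] by (simp add: power2_eq_square algebra_simps)
    finally show ?thesis .
  qed
qed auto

lemma bilin_diff:
  assumes a: "l2 a" and b: "l2 b" and \<kappa>: "0 \<le> \<kappa>"
  shows "bilin \<kappa> a a k - bilin \<kappa> b b k = bilin \<kappa> (\<lambda>k. a k - b k) a k + bilin \<kappa> b (\<lambda>k. a k - b k) k"
proof -
  note d = l2_diff[OF a b]
  let ?t = "\<lambda>a b l. (\<i> * of_real \<kappa> * kdot k (a (k - l))) *s (b l :: complex ^ 2)"
  note s = bilin_summable_bound(1)[THEN abs_summable_summable, OF _ _ \<kappa>, of _ _ k]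
  have "bilin \<kappa> a a k = (\<Sum>\<^sub>\<infinity>l. ?t b b l + (?t (\<lambda>k. a k - b k) a l + ?t b (\<lambda>k. a k - b k) l))"
    unfolding bilin_def by (rule infsum_cong) (simp add: kdot_diff vec_eq_iff algebra_simps)
  also have "\<dots> = bilin \<kappa> b b k + (bilin \<kappa> (\<lambda>k. a k - b k) a k + bilin \<kappa> b (\<lambda>k. a k - b k) k)"
    unfolding bilin_def
    by (subst infsum_add; (intro summable_on_add s a b d)?) (subst infsum_add; (intro s a b d)?; rule refl)
  finally show ?thesis by simp
qed

text \<open>A local Lipschitz bound in l^2 at fixed frequency: it makes each mode of the nonlinear
  term continuous in time along a solution.\<close>

lemma norm_Bcoef_diff_le:
  assumes "inH u" "inH v" "L > 0"
  shows "norm (Bcoef L u u k - Bcoef L v v k)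
     \<le> 10 * kappa0 L * kn k * (sqrt (l2sq u) + sqrt (l2sq v)) * sqrt (l2sq (\<lambda>k. u k - v k))"
proof -
  have \<kappa>: "0 \<le> kappa0 L" using assms by (simp add: kappa0_def)
  have u: "l2 u" and v: "l2 v" using assms by (auto simp: inH_def)
  note d = l2_diff[OF u v]
  have "norm (Bcoef L u u k - Bcoef L v v k) \<le> 5 * norm (bilin (kappa0 L) u u k - bilin (kappa0 L) v v k)"
    unfolding Bcoef_eq_bilin[OF assms(1)] Bcoef_eq_bilin[OF assms(2)] leray_diff[symmetric] by (rule norm_leray_le)
  also have "\<dots> \<le> 5 * (2 * kappa0 L * kn k * (sqrt (l2sq (\<lambda>k. u k - v k)) * sqrt (l2sq u))
       + 2 * kappa0 L * kn k * (sqrt (l2sq v) * sqrt (l2sq (\<lambda>k. u k - v k))))"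
    unfolding bilin_diff[OF u v \<kappa>]
    by (intro mult_left_mono order_trans[OF norm_triangle_ineq] add_mono norm_bilin_le u v d \<kappa>) auto
  also have "\<dots> = 10 * kappa0 L * kn k * (sqrt (l2sq u) + sqrt (l2sq v)) * sqrt (l2sq (\<lambda>k. u k - v k))"
    by (simp add: algebra_simps)
  finally show ?thesis .
qed

section \<open>Bounded solutions, mode by mode\<close>

text \<open>With the integrating factor, exp (\<gamma> \<tau>) z has derivative exp (\<gamma>
  \<tau>) h, dominated by that of (H/\<gamma>) exp (\<gamma> \<tau>); the mean value inequality then
  uses h only through its bound.\<close>

lemma duhamel_bound:
  fixes z h :: "real \<Rightarrow> 'a::real_normed_vector"
  assumes "a \<le> t" "\<gamma> > 0"
    and z: "\<And>\<tau>. (z has_vector_derivative (h \<tau> - \<gamma> *\<^sub>R z \<tau>)) (at \<tau>)"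
    and h: "\<And>\<tau>. a \<le> \<tau> \<Longrightarrow> \<tau> \<le> t \<Longrightarrow> norm (h \<tau>) \<le> H"
  shows "norm (z t) \<le> exp (- \<gamma> * (t - a)) * norm (z a) + H / \<gamma>"
proof (cases "a = t")
  case True
  have "0 \<le> H" using h[of a] assms(1) by (meson norm_ge_zero order_trans order_refl)
  with True assms show ?thesis by simp
next
  case False
  have H: "0 \<le> H" using h[of a] assms(1) by (meson norm_ge_zero order_trans order_refl)
  define f where "f \<tau> = exp (\<gamma> * \<tau>) *\<^sub>R z \<tau>" for \<tau>
  define \<phi> where "\<phi> \<tau> = H / \<gamma> * exp (\<gamma> * \<tau>)" for \<tau>
  have f': "(f has_vector_derivative exp (\<gamma> * \<tau>) *\<^sub>R h \<tau>) (at \<tau>)" for \<tau>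
    unfolding f_def
    by (rule derivative_eq_intros z | simp)+ (simp add: scaleR_diff_right scaleR_scaleR mult.commute)
  have \<phi>': "(\<phi> has_vector_derivative H * exp (\<gamma> * \<tau>)) (at \<tau>)" for \<tau>
    unfolding \<phi>_def has_real_derivative_iff_has_vector_derivative[symmetric]
    using assms(2) by (auto intro!: derivative_eq_intros)
  have "norm (f t - f a) \<le> \<phi> t - \<phi> a"
  proof (rule differentiable_bound_general[where f' = "\<lambda>\<tau>. exp (\<gamma> * \<tau>) *\<^sub>R h \<tau>" and \<phi>' = "\<lambda>\<tau>. H * exp (\<gamma> * \<tau>)"])
    show "a < t" using False assms by simp
    show "continuous_on {a..t} f" "continuous_on {a..t} \<phi>"
      using f' \<phi>' by (auto intro!: continuous_at_imp_continuous_on has_vector_derivative_continuous)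
    show "norm (exp (\<gamma> * x) *\<^sub>R h x) \<le> H * exp (\<gamma> * x)" if "a < x" "x < t" for x
      using h[of x] that by simp
  qed (use f' \<phi>' in auto)
  moreover have "norm (f t) \<le> norm (f a) + norm (f t - f a)" by (metis norm_triangle_sub)
  ultimately have "exp (\<gamma> * t) * norm (z t) \<le> exp (\<gamma> * a) * norm (z a) + H / \<gamma> * exp (\<gamma> * t) - H / \<gamma> * exp (\<gamma> * a)"
    by (simp add: f_def \<phi>_def)
  also have "\<dots> \<le> exp (\<gamma> * a) * norm (z a) + H / \<gamma> * exp (\<gamma> * t)"
    using H assms by simp
  also have "\<dots> = exp (\<gamma> * t) * (exp (- \<gamma> * (t - a)) * norm (z a) + H / \<gamma>)"
    by (simp add: distrib_left mult.assoc[symmetric] exp_add[symmetric] algebra_simps)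
  finally show ?thesis by simp
qed

text \<open>Integrates the derivative of |z|^2; Young's inequality 2 z h \<le> |h|^2/\<gamma> +
  \<gamma> |z|^2 consumes half of the damping. The conclusion is in \<open>ennreal\<close> so that
  it can be summed over all frequencies.\<close>

lemma damped_energy_bound:
  fixes z h :: "real \<Rightarrow> 'a::real_inner"
  assumes "s \<le> t" "\<gamma> > 0"
    and z: "\<And>\<tau>. (z has_vector_derivative (h \<tau> - \<gamma> *\<^sub>R z \<tau>)) (at \<tau>)"
    and h: "continuous_on UNIV h"
  shows "ennreal ((norm (z t))\<^sup>2) + ennreal \<gamma> * (\<integral>\<^sup>+\<tau>. ennreal ((norm (z \<tau>))\<^sup>2) * indicator {s..t} \<tau> \<partial>lborel)
    \<le> ennreal ((norm (z s))\<^sup>2) + ennreal (1 / \<gamma>) * (\<integral>\<^sup>+\<tau>. ennreal ((norm (h \<tau>))\<^sup>2) * indicator {s..t} \<tau> \<partial>lborel)"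
proof -
  have cz: "continuous_on UNIV z"
    using z by (auto intro!: continuous_at_imp_continuous_on has_vector_derivative_continuous)
  define Z where "Z = integral {s..t} (\<lambda>\<tau>. (norm (z \<tau>))\<^sup>2)"
  define Hh where "Hh = integral {s..t} (\<lambda>\<tau>. (norm (h \<tau>))\<^sup>2)"
  have iZ: "((\<lambda>\<tau>. (norm (z \<tau>))\<^sup>2) has_integral Z) {s..t}"
    unfolding Z_def by (intro integrable_integral integrable_continuous_real continuous_intros continuous_on_subset[OF cz]) auto
  have iH: "((\<lambda>\<tau>. (norm (h \<tau>))\<^sup>2) has_integral Hh) {s..t}"
    unfolding Hh_def by (intro integrable_integral integrable_continuous_real continuous_intros continuous_on_subset[OF h]) auto
  have "((\<lambda>\<tau>. z \<tau> \<bullet> z \<tau>) has_vector_derivative 2 * (z \<tau> \<bullet> (h \<tau> - \<gamma> *\<^sub>R z \<tau>))) (at \<tau> within {s..t})" for \<tau>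
    using bounded_bilinear.has_vector_derivative[OF bounded_bilinear_inner z[THEN has_vector_derivative_at_within] z[THEN has_vector_derivative_at_within]]
    by (simp add: inner_commute)
  from fundamental_theorem_of_calculus[OF \<open>s \<le> t\<close> this]
  have "((\<lambda>\<tau>. 2 * (z \<tau> \<bullet> (h \<tau> - \<gamma> *\<^sub>R z \<tau>))) has_integral ((norm (z t))\<^sup>2 - (norm (z s))\<^sup>2)) {s..t}"
    by (simp add: power2_norm_eq_inner)
  moreover have "((\<lambda>\<tau>. (1 / \<gamma>) * (norm (h \<tau>))\<^sup>2 - \<gamma> * (norm (z \<tau>))\<^sup>2) has_integral ((1 / \<gamma>) * Hh - \<gamma> * Z)) {s..t}"
    by (intro has_integral_diff has_integral_mult_right iZ iH)
  moreover have "2 * (z \<tau> \<bullet> (h \<tau> - \<gamma> *\<^sub>R z \<tau>)) \<le> (1 / \<gamma>) * (norm (h \<tau>))\<^sup>2 - \<gamma> * (norm (z \<tau>))\<^sup>2" for \<tau>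
  proof -
    have "0 \<le> (norm (h \<tau> - \<gamma> *\<^sub>R z \<tau>))\<^sup>2" by simp
    also have "\<dots> = (norm (h \<tau>))\<^sup>2 - 2 * \<gamma> * (z \<tau> \<bullet> h \<tau>) + \<gamma>\<^sup>2 * (norm (z \<tau>))\<^sup>2"
      by (simp add: power2_norm_eq_inner inner_diff inner_commute) (simp add: power2_eq_square algebra_simps)
    finally have "2 * (z \<tau> \<bullet> h \<tau>) \<le> (1 / \<gamma>) * (norm (h \<tau>))\<^sup>2 + \<gamma> * (norm (z \<tau>))\<^sup>2"
      using assms(2) by (simp add: field_simps power2_eq_square)
    then show ?thesis by (simp add: inner_diff_right power2_norm_eq_inner)
  qed
  ultimately have "(norm (z t))\<^sup>2 - (norm (z s))\<^sup>2 \<le> (1 / \<gamma>) * Hh - \<gamma> * Z"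
    by (rule has_integral_le)
  then have "(norm (z t))\<^sup>2 + \<gamma> * Z \<le> (norm (z s))\<^sup>2 + (1 / \<gamma>) * Hh" by simp
  moreover have "0 \<le> Z" "0 \<le> Hh" unfolding Z_def Hh_def by (rule integral_nonneg; use iZ iH in auto)+
  ultimately have "ennreal ((norm (z t))\<^sup>2) + ennreal \<gamma> * ennreal Z \<le> ennreal ((norm (z s))\<^sup>2) + ennreal (1 / \<gamma>) * ennreal Hh"
    using assms(2) by (simp add: ennreal_leI flip: ennreal_mult ennreal_plus)
  then show ?thesis
    using nn_integral_has_integral_lebesgue'[OF _ iZ] nn_integral_has_integral_lebesgue'[OF _ iH] by simp
qed

text \<open>The source of all smoothing: damping at rate x, of order |k|^2, during a time d absorbs
  the factor x at the price 1/d, uniformly in the frequency.\<close>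

lemma mult_exp_minus_le: "x > 0 \<Longrightarrow> d > 0 \<Longrightarrow> x * exp (- x * d) \<le> 1 / d" for x d :: real
proof -
  assume "x > 0" "d > 0"
  have "x * d \<le> exp (x * d)" using exp_ge_add_one_self[of "x * d"] by linarith
  then show ?thesis using \<open>d > 0\<close> by (simp add: exp_minus field_simps)
qed

lemma norm_coeff_le: "l2 a \<Longrightarrow> norm (a k) \<le> sqrt (l2sq a)"
proof (rule real_le_rsqrt)
  assume "l2 a"
  then have "ennreal ((norm (a k))\<^sup>2) \<le> ennreal (l2sq a)"
    unfolding lsum_enorm_square[symmetric, OF \<open>l2 a\<close>]
    using le_lsum[of "\<lambda>k. (enorm a k)\<^sup>2" k] by (simp add: enorm_def ennreal_power)
  then show "(norm (a k))\<^sup>2 \<le> l2sq a" by (simp add: l2sq_nonneg)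
qed

locale bounded_solution =
  fixes L \<nu> :: real and g :: fcoef and u :: "real \<Rightarrow> fcoef" and M :: real
  assumes L: "L > 0" and \<nu>: "\<nu> > 0" and g: "inH g"
    and solution: "nse_solution L \<nu> g u"
    and bounded: "\<And>t. sqrt (Hnorm2 L (u t)) \<le> M"
begin

definition \<kappa> :: real where "\<kappa> = kappa0 L"
text \<open>The damping rate at |k| = 1; the mode k is damped at rate
  \<open>\<mu> * ksq k\<close>.\<close>

definition \<mu> :: real where "\<mu> = \<nu> * \<kappa>\<^sup>2"
definition m2 :: real where "m2 = M\<^sup>2 / L\<^sup>2"

lemma \<kappa>_pos: "\<kappa> > 0" using L by (simp add: \<kappa>_def kappa0_def)
lemma \<mu>_pos: "\<mu> > 0" using \<kappa>_pos \<nu> by (simp add: \<mu>_def)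
lemma m2_nonneg: "m2 \<ge> 0" by (simp add: m2_def)

lemma inH_u: "inH (u t)"
  using solution by (simp add: nse_solution_def)

lemma l2_u: "l2 (u t)" and u_0: "u t 0 = 0"
  using inH_u[of t] by (auto simp: inH_def zero_prod_def)

lemma l2_g: "l2 g" and g_0: "g 0 = 0"
  using g by (auto simp: inH_def zero_prod_def)

lemma l2sq_u_le: "l2sq (u t) \<le> m2"
proof -
  have "Hnorm2 L (u t) \<ge> 0" by (simp add: Hnorm2_def infsum_nonneg)
  then have "Hnorm2 L (u t) \<le> M\<^sup>2"
    using bounded[of t] by (metis order.trans real_sqrt_ge_zero real_sqrt_le_iff real_sqrt_pow2 power_mono)
  then show ?thesis
    using L by (simp add: m2_def Hnorm2_def l2sq_def field_simps)
qed

lemma l2sq_u_diff_tendsto: "((\<lambda>s. sqrt (l2sq (\<lambda>k. u s k - u t k))) \<longlongrightarrow> 0) (at t)"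
proof -
  have "((\<lambda>s. Hnorm2 L (\<lambda>k. u s k - u t k)) \<longlongrightarrow> 0) (at t)"
    using solution by (simp add: nse_solution_def)
  then have "((\<lambda>s. sqrt (Hnorm2 L (\<lambda>k. u s k - u t k) / L\<^sup>2)) \<longlongrightarrow> sqrt (0 / L\<^sup>2)) (at t)"
    by (intro tendsto_intros) (use L in auto)
  then show ?thesis using L by (simp add: Hnorm2_def l2sq_def)
qed

lemma continuous_u: "continuous_on UNIV (\<lambda>t. u t k)"
  unfolding continuous_on_def
proof
  fix t
  have "((\<lambda>s. u s k - u t k) \<longlongrightarrow> 0) (at t)"
    by (rule Lim_null_comparison[OF _ l2sq_u_diff_tendsto[of t]])
       (auto intro!: always_eventually norm_coeff_le[of "\<lambda>k. u _ k - u t k"] l2_diff l2_u)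
  then show "((\<lambda>t. u t k) \<longlongrightarrow> u t k) (at t within UNIV)"
    by (simp add: LIM_zero_iff)
qed

lemma continuous_B: "continuous_on UNIV (\<lambda>t. Bcoef L (u t) (u t) k)"
  unfolding continuous_on_def
proof
  fix t
  let ?c = "10 * kappa0 L * kn k * (sqrt m2 + sqrt m2)"
  have "norm (Bcoef L (u s) (u s) k - Bcoef L (u t) (u t) k) \<le> ?c * sqrt (l2sq (\<lambda>k. u s k - u t k))" for s
  proof -
    have "sqrt (l2sq (u s)) + sqrt (l2sq (u t)) \<le> sqrt m2 + sqrt m2"
      by (intro add_mono real_sqrt_le_mono l2sq_u_le)
    then have "10 * kappa0 L * kn k * (sqrt (l2sq (u s)) + sqrt (l2sq (u t))) \<le> ?c"
      using \<kappa>_pos by (intro mult_left_mono) (auto simp: \<kappa>_def)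
    then have "10 * kappa0 L * kn k * (sqrt (l2sq (u s)) + sqrt (l2sq (u t))) * sqrt (l2sq (\<lambda>k. u s k - u t k))
        \<le> ?c * sqrt (l2sq (\<lambda>k. u s k - u t k))"
      by (rule mult_right_mono) (simp add: l2sq_nonneg)
    with norm_Bcoef_diff_le[OF inH_u[of s] inH_u[of t] L, of k] show ?thesis by (rule order_trans)
  qed
  moreover have "((\<lambda>s. ?c * sqrt (l2sq (\<lambda>k. u s k - u t k))) \<longlongrightarrow> 0) (at t)"
    using tendsto_mult_left[OF l2sq_u_diff_tendsto[of t], of ?c] by simp
  ultimately have "((\<lambda>s. Bcoef L (u s) (u s) k - Bcoef L (u t) (u t) k) \<longlongrightarrow> 0) (at t)"
    by - (rule Lim_null_comparison[OF always_eventually], rule allI)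
  then show "((\<lambda>t. Bcoef L (u t) (u t) k) \<longlongrightarrow> Bcoef L (u t) (u t) k) (at t within UNIV)"
    by (simp add: LIM_zero_iff)
qed

text \<open>At a fixed frequency all terms of the integrated equation are continuous in time, so the
  fundamental theorem of calculus turns it into a differential equation valid at every time.\<close>

lemma derivative_u:
  "((\<lambda>t. u t k) has_vector_derivative (g k - Bcoef L (u t) (u t) k - (\<mu> * ksq k) *\<^sub>R u t k)) (at t)"
proof -
  define f where "f \<tau> = g k - Bcoef L (u \<tau>) (u \<tau>) k - (\<mu> * ksq k) *\<^sub>R u \<tau> k" for \<tau>
  have cf: "continuous_on UNIV f"
    unfolding f_def by (intro continuous_intros continuous_B continuous_u)
  have sc: "of_real c *s v = c *\<^sub>R v" for c and v :: "complex ^ 2"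
    by (simp add: vec_eq_iff) (simp add: scaleR_conv_of_real)
  have int: "(f has_integral (u t k - u s k)) {s..t}" if "s \<le> t" for s t
  proof -
    have "((\<lambda>\<tau>. g k - of_real (\<nu> * (kappa0 L)\<^sup>2 * ksq k) *s u \<tau> k - Bcoef L (u \<tau>) (u \<tau>) k)
          has_integral (u t k - u s k)) {s..t}"
      using solution that unfolding nse_solution_def by blast
    then show ?thesis
      unfolding f_def \<mu>_def \<kappa>_def sc by (simp only: diff_diff_eq add.commute)
  qed
  have "((\<lambda>x. integral {t - 1..x} f) has_vector_derivative f t) (at t within {t - 1..t + 1})"
    by (rule integral_has_vector_derivative) (auto intro: continuous_on_subset[OF cf])
  moreover have "at t within {t - 1..t + 1} = at t"
    by (rule at_within_interior) auto
  ultimately have "((\<lambda>x. u (t - 1) k + integral {t - 1..x} f) has_vector_derivative f t) (at t)"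
    by (auto intro!: derivative_eq_intros)
  moreover have "eventually (\<lambda>x. u (t - 1) k + integral {t - 1..x} f = u x k) (nhds t)"
  proof -
    have "eventually (\<lambda>x. x \<in> {t - 1<..}) (nhds t)" by (rule eventually_nhds_in_open) auto
    then show ?thesis
    proof eventually_elim
      fix x assume "x \<in> {t - 1<..}"
      then have "integral {t - 1..x} f = u x k - u (t - 1) k" by (intro integral_unique int) auto
      then show "u (t - 1) k + integral {t - 1..x} f = u x k" by simp
    qed
  qed
  ultimately show ?thesis
    unfolding f_def[symmetric]
    using has_vector_derivative_cong_ev[where x = t and S = UNIV and f = "\<lambda>x. u (t - 1) k + integral {t - 1..x} f" and g = "\<lambda>x. u x k"]
    by (auto dest: eventually_nhds_x_imp_x)
qed

text \<open>Duhamel's formula started at \<open>a\<close>, multiplied by the damping rate. As t - a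
  \<ge> b - a, the initial value costs 1/(b - a) by \<open>mult_exp_minus_le\<close>, uniformly for
  t in the shorter window.\<close>

lemma mode_smoothing:
  assumes "a < b" "b \<le> t" "k \<noteq> 0"
    and H: "\<And>\<tau>. a \<le> \<tau> \<Longrightarrow> \<tau> \<le> t \<Longrightarrow> norm (Bcoef L (u \<tau>) (u \<tau>) k) \<le> H"
  shows "\<mu> * ksq k * norm (u t k) \<le> norm (u a k) / (b - a) + norm (g k) + H"
proof -
  define l where "l = \<mu> * ksq k"
  have l: "l > 0" using kn_pos[OF assms(3)] \<mu>_pos by (simp add: l_def flip: kn_power2)
  have "norm (g k - Bcoef L (u \<tau>) (u \<tau>) k) \<le> norm (g k) + H" if "a \<le> \<tau>" "\<tau> \<le> t" for \<tau>
    using norm_triangle_ineq4[of "g k" "Bcoef L (u \<tau>) (u \<tau>) k"] H[OF that] by simp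
  then have "norm (u t k) \<le> exp (- l * (t - a)) * norm (u a k) + (norm (g k) + H) / l"
    using assms l by (intro duhamel_bound[OF _ _ derivative_u[of k, folded l_def]]) auto
  then have "l * norm (u t k) \<le> l * (exp (- l * (t - a)) * norm (u a k) + (norm (g k) + H) / l)"
    using l by (intro mult_left_mono) auto
  also have "\<dots> = (l * exp (- l * (t - a))) * norm (u a k) + (norm (g k) + H)"
    using l by (simp add: field_simps)
  also have "(l * exp (- l * (t - a))) * norm (u a k) \<le> (1 / (b - a)) * norm (u a k)"
  proof (rule mult_right_mono)
    have "l * exp (- l * (t - a)) \<le> 1 / (t - a)" using assms l by (intro mult_exp_minus_le) auto
    also have "\<dots> \<le> 1 / (b - a)" using assms by (intro divide_left_mono) auto
    finally show "l * exp (- l * (t - a)) \<le> 1 / (b - a)" .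
  qed auto
  finally show ?thesis by (simp add: l_def)
qed

text \<open>Duhamel's formula is solved for the force, which does not depend on time: its
  regularity is read off from u at the single time t and from the nonlinear term.\<close>

lemma mode_force_bound:
  assumes "a < t" "k \<noteq> 0"
    and H: "\<And>\<tau>. a \<le> \<tau> \<Longrightarrow> \<tau> \<le> t \<Longrightarrow> norm (Bcoef L (u \<tau>) (u \<tau>) k) \<le> H"
  shows "(1 - exp (- \<mu> * (t - a))) * norm (g k) \<le> \<mu> * ksq k * norm (u t k) + norm (u a k) / (t - a) + H"
proof -
  define l where "l = \<mu> * ksq k"
  have k1: "1 \<le> ksq k" using kn_ge_1[OF assms(2)] by (simp flip: kn_power2 add: one_le_power)
  then have l: "l > 0" and \<mu>l: "\<mu> \<le> l" using \<mu>_pos by (auto simp: l_def)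
  \<comment> \<open>Subtracting the stationary value of the linear equation removes the force from
    the equation for \<open>?z\<close>.\<close>
  let ?z = "\<lambda>\<tau>. u \<tau> k - (1 / l) *\<^sub>R g k"
  have "(?z has_vector_derivative (- Bcoef L (u \<tau>) (u \<tau>) k - l *\<^sub>R ?z \<tau>)) (at \<tau>)" for \<tau>
    using has_vector_derivative_diff[OF derivative_u[of k \<tau>, folded l_def] has_vector_derivative_const[of "(1 / l) *\<^sub>R g k"]] l
    by (simp add: scaleR_diff_right algebra_simps)
  then have "norm (?z t) \<le> exp (- l * (t - a)) * norm (?z a) + H / l"
    using assms l by (intro duhamel_bound) auto
  moreover have "exp (- l * (t - a)) * norm (?z a) \<le> exp (- l * (t - a)) * (norm (u a k) + norm (g k) / l)"
    using l by (intro mult_left_mono order_trans[OF norm_triangle_ineq4]) auto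
  moreover have "norm (g k) / l \<le> norm (u t k) + norm (?z t)"
    using norm_triangle_ineq4[of "u t k" "?z t"] l by simp
  ultimately have "norm (g k) / l \<le> norm (u t k) + (exp (- l * (t - a)) * (norm (u a k) + norm (g k) / l) + H / l)"
    by linarith
  then have "l * (norm (g k) / l) \<le> l * (norm (u t k) + (exp (- l * (t - a)) * (norm (u a k) + norm (g k) / l) + H / l))"
    using l by (intro mult_left_mono) auto
  then have "norm (g k) \<le> l * norm (u t k) + (l * exp (- l * (t - a))) * norm (u a k) + exp (- l * (t - a)) * norm (g k) + H"
    using l by (simp add: distrib_left)
  moreover have "(l * exp (- l * (t - a))) * norm (u a k) \<le> (1 / (t - a)) * norm (u a k)"
    using assms l by (intro mult_right_mono mult_exp_minus_le) auto
  \<comment> \<open>The factor left in front of g_k is largest for the slowest damping, |k| = 1;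
    with that value the term is absorbed on the left uniformly in k.\<close>
  moreover have "exp (- l * (t - a)) * norm (g k) \<le> exp (- \<mu> * (t - a)) * norm (g k)"
    using assms \<mu>l by (intro mult_right_mono) auto
  ultimately show ?thesis unfolding l_def[symmetric] by (simp add: algebra_simps)
qed

lemma mode_energy:
  assumes "s \<le> t" "k \<noteq> 0"
  shows "ennreal ((norm (u t k))\<^sup>2)
      + ennreal (\<mu> * ksq k) * (\<integral>\<^sup>+\<tau>. ennreal ((norm (u \<tau> k))\<^sup>2) * indicator {s..t} \<tau> \<partial>lborel)
    \<le> ennreal ((norm (u s k))\<^sup>2)
      + ennreal (1 / (\<mu> * ksq k)) * (\<integral>\<^sup>+\<tau>. ennreal ((norm (g k - Bcoef L (u \<tau>) (u \<tau>) k))\<^sup>2) * indicator {s..t} \<tau> \<partial>lborel)"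
  using kn_pos[OF assms(2)] \<mu>_pos
  by (intro damped_energy_bound[OF assms(1) _ derivative_u]) (auto intro!: continuous_intros continuous_B simp flip: kn_power2)

section \<open>Envelopes of a solution over windows ending at 0\<close>

definition env :: "real \<Rightarrow> int \<times> int \<Rightarrow> ennreal" where
  "env b k = (SUP t\<in>{b..0}. enorm (u t) k)"

lemma env_antimono: "a \<le> b \<Longrightarrow> env b k \<le> env a k"
  unfolding env_def by (rule SUP_subset_mono) auto

lemma enorm_le_env: "b \<le> t \<Longrightarrow> t \<le> 0 \<Longrightarrow> enorm (u t) k \<le> env b k"
  unfolding env_def by (rule SUP_upper) auto

lemma env_0 [simp]: "env b 0 = 0"
  by (simp add: env_def enorm_def u_0 bot_ennreal[symmetric])

lemma norm_B_le_conv_env: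
  assumes "a \<le> \<tau>" "\<tau> \<le> 0" "conv (env a) (env a) k = ennreal x" "0 \<le> x"
  shows "norm (Bcoef L (u \<tau>) (u \<tau>) k) \<le> 10 * \<kappa> * kn k * x"
proof -
  have "ennreal (norm (Bcoef L (u \<tau>) (u \<tau>) k)) \<le> ennreal (10 * \<kappa> * kn k) * conv (enorm (u \<tau>)) (enorm (u \<tau>)) k"
    unfolding \<kappa>_def by (rule norm_Bcoef_le[OF inH_u L])
  also have "\<dots> \<le> ennreal (10 * \<kappa> * kn k) * ennreal x"
    unfolding assms(3)[symmetric] using assms(1,2) by (intro mult_left_mono conv_mono enorm_le_env) auto
  finally show ?thesis using \<kappa>_pos assms(4) by (simp flip: ennreal_mult)
qed

text \<open>\<open>mode_smoothing\<close> divided by |k|: this cancels the |k| of the nonlinear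
  term, and the initial term is first enlarged by |k| \<ge> 1. What remains on the left is one power
  of |k|.\<close>

lemma env_smoothing:
  assumes "a < b" "b \<le> 0" "k \<noteq> 0"
  shows "ennreal (\<mu> * kn k) * env b k
     \<le> ennreal (1 / (b - a)) * env a k + ennreal (1 / kn k) * enorm g k + ennreal (10 * \<kappa>) * conv (env a) (env a) k"
proof (cases "conv (env a) (env a) k")
  case (real x)
  have k1: "1 \<le> kn k" using kn_ge_1[OF assms(3)] .
  have "ennreal (\<mu> * kn k) * enorm (u t) k
    \<le> ennreal (1 / (b - a)) * env a k + ennreal (1 / kn k) * enorm g k + ennreal (10 * \<kappa>) * ennreal x"
    if t: "t \<in> {b..0}" for t
  proof -
    have "\<mu> * ksq k * norm (u t k) \<le> norm (u a k) / (b - a) + norm (g k) + 10 * \<kappa> * kn k * x"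
      using assms t real by (intro mode_smoothing norm_B_le_conv_env) auto
    also have "norm (u a k) / (b - a) \<le> kn k * (norm (u a k) / (b - a))"
      using k1 assms mult_right_mono[OF k1, of "norm (u a k) / (b - a)"] by simp
    finally have "kn k * (\<mu> * kn k * norm (u t k)) \<le> kn k * (norm (u a k) / (b - a) + norm (g k) / kn k + 10 * \<kappa> * x)"
      using k1 by (simp add: algebra_simps power2_eq_square flip: kn_power2)
    then have "\<mu> * kn k * norm (u t k) \<le> 1 / (b - a) * norm (u a k) + 1 / kn k * norm (g k) + 10 * \<kappa> * x"
      using k1 by simp
    then have "ennreal (\<mu> * kn k * norm (u t k)) \<le> ennreal (1 / (b - a) * norm (u a k) + 1 / kn k * norm (g k) + 10 * \<kappa> * x)"
      by (rule ennreal_leI)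
    then have "ennreal (\<mu> * kn k) * enorm (u t) k
        \<le> ennreal (1 / (b - a)) * enorm (u a) k + ennreal (1 / kn k) * enorm g k + ennreal (10 * \<kappa>) * ennreal x"
      using \<mu>_pos \<kappa>_pos k1 assms real by (simp add: enorm_def ennreal_mult ennreal_plus del: times_divide_eq_left)
    also have "\<dots> \<le> ennreal (1 / (b - a)) * env a k + ennreal (1 / kn k) * enorm g k + ennreal (10 * \<kappa>) * ennreal x"
      using assms by (intro add_mono mult_left_mono enorm_le_env) auto
    finally show ?thesis .
  qed
  then show ?thesis
    unfolding real(2) env_def[of b] using assms by (subst SUP_mult_left_ennreal) (auto intro!: SUP_least)
next
  case top
  then show ?thesis using \<kappa>_pos by (simp add: ennreal_mult_top)
qed

text \<open>Only the value at the final time 0 is weighted by |k|; the past enters through the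
  unweighted envelope. The factor on the left is positive and does not depend on k.\<close>

lemma env_force_bound:
  assumes "a < 0" "k \<noteq> 0"
  shows "ennreal (1 - exp (\<mu> * a)) * (ennreal (1 / kn k) * enorm g k)
     \<le> ennreal (\<mu> * kn k) * enorm (u 0) k + ennreal (1 / (- a)) * env a k + ennreal (10 * \<kappa>) * conv (env a) (env a) k"
proof (cases "conv (env a) (env a) k")
  case (real x)
  have k1: "1 \<le> kn k" using kn_ge_1[OF assms(2)] .
  have ge: "0 \<le> 1 - exp (\<mu> * a)" using assms \<mu>_pos by (simp add: mult_pos_neg less_imp_le)
  have "(1 - exp (- \<mu> * (0 - a))) * norm (g k) \<le> \<mu> * ksq k * norm (u 0 k) + norm (u a k) / (0 - a) + 10 * \<kappa> * kn k * x"
    using assms real by (intro mode_force_bound norm_B_le_conv_env) auto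
  also have "norm (u a k) / (0 - a) \<le> kn k * (norm (u a k) / (0 - a))"
  proof -
    have "0 \<le> norm (u a k) / (0 - a)" using assms by (intro divide_nonneg_pos) auto
    from mult_right_mono[OF k1 this] show ?thesis by (simp only: mult_1)
  qed
  finally have "kn k * ((1 - exp (\<mu> * a)) * (1 / kn k * norm (g k))) \<le> kn k * (\<mu> * kn k * norm (u 0 k) + norm (u a k) / (- a) + 10 * \<kappa> * x)"
    using k1 by (simp add: algebra_simps power2_eq_square flip: kn_power2)
  then have "(1 - exp (\<mu> * a)) * (1 / kn k * norm (g k)) \<le> \<mu> * kn k * norm (u 0 k) + 1 / (- a) * norm (u a k) + 10 * \<kappa> * x"
    using k1 by (subst (asm) mult_le_cancel_left_pos) auto
  then have "ennreal ((1 - exp (\<mu> * a)) * (1 / kn k * norm (g k))) \<le> ennreal (\<mu> * kn k * norm (u 0 k) + 1 / (- a) * norm (u a k) + 10 * \<kappa> * x)"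
    by (rule ennreal_leI)
  also have "\<dots> = ennreal (\<mu> * kn k) * enorm (u 0) k + ennreal (1 / (- a)) * enorm (u a) k + ennreal (10 * \<kappa>) * ennreal x"
  proof -
    have "0 \<le> \<mu> * kn k * norm (u 0 k)" "0 \<le> 1 / (- a) * norm (u a k)" "0 \<le> 10 * \<kappa> * x" "0 \<le> 1 / - a" "0 \<le> \<mu> * kn k" "0 \<le> 10 * \<kappa>"
      using \<mu>_pos \<kappa>_pos assms real by (auto simp: divide_nonneg_neg intro!: mult_nonneg_nonneg)
    then show ?thesis using real
      by (simp only: enorm_def ennreal_plus ennreal_mult add_nonneg_nonneg norm_ge_zero)
  qed
  also have "\<dots> \<le> ennreal (\<mu> * kn k) * enorm (u 0) k + ennreal (1 / (- a)) * env a k + ennreal (10 * \<kappa>) * ennreal x"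
    using assms by (intro add_mono mult_left_mono enorm_le_env) auto
  also have "ennreal ((1 - exp (\<mu> * a)) * (1 / kn k * norm (g k))) = ennreal (1 - exp (\<mu> * a)) * (ennreal (1 / kn k) * enorm g k)"
    using ge by (simp only: enorm_def ennreal_mult mult_nonneg_nonneg norm_ge_zero zero_le_divide_1_iff kn_nonneg)
  finally show ?thesis using real by simp
next
  case top
  then show ?thesis using \<kappa>_pos by (simp add: ennreal_mult_top)
qed

end

section \<open>From finite energy to summable envelopes\<close>

lemma borel_measurable_lsum [measurable]:
  fixes f :: "int \<times> int \<Rightarrow> 'a \<Rightarrow> ennreal"
  assumes [measurable]: "\<And>k. f k \<in> borel_measurable N"
  shows "(\<lambda>x. lsum (\<lambda>k. f k x)) \<in> borel_measurable N"
proof -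
  define e where "e = from_nat_into (UNIV :: (int \<times> int) set)"
  have e: "bij_betw e UNIV UNIV"
    unfolding e_def by (rule bij_betw_from_nat_into) (auto simp: finite_prod)
  have "(\<lambda>x. lsum (\<lambda>k. f k x)) = (\<lambda>x. \<Sum>n. f (e n) x)"
    by (simp flip: nn_integral_bij_count_space[OF e] add: nn_integral_count_space_nat)
  also have "\<dots> \<in> borel_measurable N" by measurable
  finally show ?thesis .
qed

lemma ennreal_young:
  fixes z p q :: ennreal
  assumes z: "z\<^sup>2 \<le> p * q" and "\<eta> > 0"
  shows "z \<le> ennreal (1 / \<eta>) * p + ennreal \<eta> * q"
proof (cases "p = \<infinity> \<or> q = \<infinity>")
  case False
  then obtain a b where ab: "p = ennreal a" "q = ennreal b" "a \<ge> 0" "b \<ge> 0"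
    by (metis ennreal_cases infinity_ennreal_def)
  have "a * b \<le> (a / \<eta> + \<eta> * b)\<^sup>2"
  proof -
    have "a * b = (a / \<eta>) * (\<eta> * b)" using \<open>\<eta> > 0\<close> by simp
    also have "\<dots> \<le> (a / \<eta> + \<eta> * b) * (a / \<eta> + \<eta> * b)"
      using ab \<open>\<eta> > 0\<close> by (intro mult_mono) auto
    finally show ?thesis by (simp add: power2_eq_square)
  qed
  have "z\<^sup>2 \<le> ennreal (a * b)" using z ab by (simp add: ennreal_mult)
  also have "\<dots> \<le> ennreal ((a / \<eta> + \<eta> * b)\<^sup>2)" by (rule ennreal_leI) fact
  also have "\<dots> = (ennreal (a / \<eta> + \<eta> * b))\<^sup>2"
    using ab \<open>\<eta> > 0\<close> by (subst ennreal_power) auto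
  finally have "z\<^sup>2 \<le> (ennreal (a / \<eta> + \<eta> * b))\<^sup>2" .
  then have "z \<le> ennreal (a / \<eta> + \<eta> * b)"
    using ab \<open>\<eta> > 0\<close> by (intro ennreal_le_of_power2_le) auto
  then show ?thesis using ab \<open>\<eta> > 0\<close> by (simp add: ennreal_plus flip: ennreal_mult)
next
  case True
  then show ?thesis using \<open>\<eta> > 0\<close> by (auto simp: ennreal_mult_top)
qed

lemma ennreal_mult_le_sum_squares: "x * y \<le> x\<^sup>2 + (y::ennreal)\<^sup>2"
  using ennreal_young[of "x * y" "x\<^sup>2" "y\<^sup>2" 1] by (simp add: power_mult_distrib)

text \<open>The larger of x and y is at least z/2 and pays for z^(3/2); its remaining power -1/2 is
  handed to the smaller one. In the plane |k|^-2 convolved with itself decays like |k|^-2 up to a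
  logarithm; weight 3/2 gives up half a power and leaves the exponent -5/2, below the critical
  -2.\<close>

lemma powr_convolution_bound:
  fixes x y z :: real
  assumes "0 < x" "0 < y" "0 \<le> z" "z \<le> x + y"
  shows "z powr (3/2) * (x powr (-2) * y powr (-2)) \<le> 4 * (x powr (-5/2) + y powr (-5/2))"
proof -
  have *: "z powr (3/2) * (x powr (-2) * y powr (-2)) \<le> 4 * x powr (-5/2)"
    if "0 < x" "x \<le> y" "z \<le> x + y" for x y :: real
  proof -
    have "z powr (3/2) \<le> (2 * y) powr (3/2)" using that assms by (intro powr_mono2) auto
    also have "\<dots> = 2 powr (3/2) * y powr (3/2)" using that by (simp add: powr_mult)
    also have "\<dots> \<le> 2 powr 2 * y powr (3/2)" by (intro mult_right_mono powr_mono) auto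
    finally have "z powr (3/2) \<le> 4 * y powr (3/2)" by simp
    then have "z powr (3/2) * (x powr (-2) * y powr (-2)) \<le> 4 * y powr (3/2) * (x powr (-2) * y powr (-2))"
      by (intro mult_right_mono) auto
    also have "\<dots> = 4 * (x powr (-2) * (y powr (3/2) * y powr (-2)))" by simp
    also have "y powr (3/2) * y powr (-2) = y powr (-1/2)" by (simp flip: powr_add)
    also have "y powr (-1/2) \<le> x powr (-1/2)" using that by (intro powr_mono2') auto
    also have "x powr (-2) * x powr (-1/2) = x powr (-5/2)" by (simp flip: powr_add)
    finally show ?thesis by (simp add: mult_left_mono)
  qed
  show ?thesis
  proof (cases "x \<le> y")
    case True
    show ?thesis by (rule order_trans[OF *[OF assms(1) True assms(4)]]) simp
  next
    case False
    then have "z powr (3/2) * (y powr (-2) * x powr (-2)) \<le> 4 * y powr (-5/2)"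
      using assms by (intro *) auto
    also have "\<dots> \<le> 4 * (x powr (-5/2) + y powr (-5/2))" by simp
    finally show ?thesis by (simp only: mult.commute[of "y powr (-2)"])
  qed
qed

section \<open>Enstrophy bounds for weak solutions on a short window\<close>

context bounded_solution
begin

text \<open>\<open>Vnorm2e L (u t)\<close> without its factor
  \<open>L\<^sup>2 * \<kappa>\<^sup>2\<close>; it may be infinite at single times.\<close>

definition ens :: "real \<Rightarrow> ennreal" where
  "ens t = lsum (\<lambda>k. ennreal (ksq k) * (enorm (u t) k)\<^sup>2)"

lemma enorm_measurable [measurable]: "(\<lambda>t. enorm (u t) k) \<in> borel_measurable borel"
proof -
  have "(\<lambda>t. norm (u t k)) \<in> borel_measurable borel"
    by (intro borel_measurable_continuous_onI continuous_intros continuous_u)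
  then show ?thesis unfolding enorm_def by measurable
qed

lemma ens_measurable [measurable]: "ens \<in> borel_measurable borel"
  unfolding ens_def by measurable

lemma lsum_enorm_u_square_le: "lsum (\<lambda>k. (enorm (u t) k)\<^sup>2) \<le> ennreal m2"
  by (simp add: lsum_enorm_square[OF l2_u] ennreal_leI l2sq_u_le)

lemma ens_integral_finite:
  assumes "s \<le> t"
  shows "(\<integral>\<^sup>+\<tau>. ens \<tau> * indicator {s..t} \<tau> \<partial>lborel) < \<infinity>"
proof -
  have V: "Vnorm2e L (u \<tau>) = ennreal (L\<^sup>2 * \<kappa>\<^sup>2) * ens \<tau>" for \<tau>
  proof -
    have "Vnorm2e L (u \<tau>) = ennreal (L\<^sup>2) * lsum (\<lambda>k. ennreal (\<kappa>\<^sup>2) * (ennreal (ksq k) * (enorm (u \<tau>) k)\<^sup>2))"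
      by (simp add: Vnorm2e_def infsum_ennreal_eq_lsum enorm_def ennreal_power \<kappa>_def ennreal_mult mult.assoc)
    then show ?thesis by (simp add: lsum_cmult ens_def ennreal_mult mult.assoc)
  qed
  have "(\<integral>\<^sup>+ \<tau>. indicator {s..t} \<tau> * Vnorm2e L (u \<tau>) \<partial>lborel) < \<infinity>"
    using solution assms unfolding nse_solution_def by blast
  then have "ennreal (L\<^sup>2 * \<kappa>\<^sup>2) * (\<integral>\<^sup>+\<tau>. ens \<tau> * indicator {s..t} \<tau> \<partial>lborel) < \<infinity>"
    by (subst nn_integral_cmult[symmetric]) (auto simp: V mult_ac)
  then show ?thesis using L \<kappa>_pos by (auto simp: ennreal_mult_less_top)
qed

text \<open>By dominated convergence the enstrophy integral over [-1/(n + 1), 0] tends to 0. Since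
  it is finite, the enstrophy cannot be infinite throughout the open window, so a starting time with
  finite enstrophy can be chosen inside.\<close>

lemma small_window:
  assumes "\<epsilon> > 0"
  obtains s where "s < 0" "ens s < \<infinity>" "(\<integral>\<^sup>+\<tau>. ens \<tau> * indicator {s..0} \<tau> \<partial>lborel) \<le> ennreal \<epsilon>"
proof -
  define f where "f n \<tau> = ens \<tau> * indicator {- 1 / real (Suc n)..0} \<tau>" for n \<tau>
  have "(\<lambda>n. integral\<^sup>N lborel (f n)) \<longlonglongrightarrow> (\<integral>\<^sup>+(\<tau>::real). 0 \<partial>lborel)"
  proof (rule nn_integral_dominated_convergence[where u = f and w = "\<lambda>\<tau>. ens \<tau> * indicator {-1..0} \<tau>"])
    show "AE \<tau> in lborel. f n \<tau> \<le> ens \<tau> * indicator {-1..0} \<tau>" for n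
    proof (rule AE_I2)
      fix \<tau> :: real
      have "{- 1 / real (Suc n)..0} \<subseteq> {-1..0::real}"
        by (intro atLeastatMost_subset_iff[THEN iffD2]) (simp add: field_simps)
      moreover have "indicator A \<tau> \<le> (indicator B \<tau> :: ennreal)" if "A \<subseteq> B" for A B
        using that by (auto simp: indicator_def)
      ultimately have "indicator {- 1 / real (Suc n)..0} \<tau> \<le> (indicator {-1..0} \<tau> :: ennreal)"
        by blast
      then show "f n \<tau> \<le> ens \<tau> * indicator {-1..0} \<tau>" unfolding f_def by (rule mult_left_mono) simp
    qed
    show "(\<integral>\<^sup>+ \<tau>. ens \<tau> * indicator {-1..0} \<tau> \<partial>lborel) < \<infinity>" by (rule ens_integral_finite) simp
    have "(\<lambda>n. f n \<tau>) \<longlonglongrightarrow> 0" if "\<tau> \<noteq> 0" for \<tau>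
    proof (cases "\<tau> > 0")
      case True then show ?thesis by (simp add: f_def indicator_def)
    next
      case False
      with that have "\<tau> < 0" by simp
      then obtain N where N: "1 / real (Suc N) < - \<tau>" using nat_approx_posE[of "- \<tau>"] by auto
      have "eventually (\<lambda>n. f n \<tau> = 0) sequentially"
        unfolding eventually_sequentially
      proof (intro exI allI impI)
        fix n assume "N \<le> n"
        then have "1 / real (Suc n) \<le> 1 / real (Suc N)" by (intro divide_left_mono) auto
        with N show "f n \<tau> = 0" by (simp add: f_def indicator_def)
      qed
      then show ?thesis by (rule tendsto_eventually)
    qed
    moreover have "AE \<tau> in lborel. \<tau> \<noteq> (0::real)" by (rule AE_lborel_singleton)
    ultimately show "AE \<tau> in lborel. (\<lambda>n. f n \<tau>) \<longlonglongrightarrow> 0" by (auto elim: AE_mp)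
    show "f n \<in> borel_measurable lborel" for n unfolding f_def by measurable
  qed auto
  then have "eventually (\<lambda>n. integral\<^sup>N lborel (f n) < ennreal \<epsilon>) sequentially"
    using assms by (intro order_tendstoD) auto
  then obtain n where n: "integral\<^sup>N lborel (f n) < ennreal \<epsilon>"
    by (auto simp: eventually_sequentially)
  define d where "d = 1 / real (Suc n)"
  have d: "d > 0" by (simp add: d_def)
  have "\<exists>s\<in>{-d<..<0}. ens s < \<infinity>"
  proof (rule ccontr)
    assume "\<not> ?thesis"
    then have "\<infinity> * indicator {-d<..<0} \<tau> \<le> ens \<tau> * indicator {-d..0} \<tau>" for \<tau>
      by (auto simp: indicator_def not_less top_unique)
    then have "(\<integral>\<^sup>+\<tau>. \<infinity> * indicator {-d<..<0} \<tau> \<partial>lborel) \<le> (\<integral>\<^sup>+\<tau>. ens \<tau> * indicator {-d..0} \<tau> \<partial>lborel)"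
      by (intro nn_integral_mono) auto
    moreover have "(\<integral>\<^sup>+\<tau>. \<infinity> * indicator {-d<..<0} \<tau> \<partial>lborel) = \<infinity>"
      using d by (subst nn_integral_cmult) (auto simp: ennreal_top_mult)
    moreover have "(\<integral>\<^sup>+\<tau>. ens \<tau> * indicator {-d..0} \<tau> \<partial>lborel) < \<infinity>"
      using d by (intro ens_integral_finite) auto
    ultimately show False by simp
  qed
  then obtain s where s: "-d < s" "s < 0" "ens s < \<infinity>" by auto
  have "(\<integral>\<^sup>+\<tau>. ens \<tau> * indicator {s..0} \<tau> \<partial>lborel) \<le> integral\<^sup>N lborel (f n)"
    using s by (intro nn_integral_mono) (auto simp: f_def d_def indicator_def)
  with n s show ?thesis by (intro that[of s]) auto
qed

text \<open>The weight min |k| R makes all terms finite a priori, so that the right hand side can be absorbed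
  over a short window; the resulting bound does not depend on R.\<close>

lemma truncated_enstrophy_inequality:
  fixes R s :: real
  defines "\<omega> \<equiv> \<lambda>k. min (kn k) R"
  defines "E \<equiv> \<lambda>t. lsum (\<lambda>k. (ennreal (\<omega> k) * enorm (u t) k)\<^sup>2)"
  defines "D \<equiv> \<lambda>t. lsum (\<lambda>k. ennreal (ksq k) * (ennreal (\<omega> k) * enorm (u t) k)\<^sup>2)"
  defines "X \<equiv> SUP t\<in>{s..0}. E t"
  assumes R: "R \<ge> 1" and st: "s \<le> t" "t \<le> 0" and \<eta>: "\<eta> > 0"
  shows "E t + ennreal \<mu> * (\<integral>\<^sup>+\<tau>. D \<tau> * indicator {s..t} \<tau> \<partial>lborel)
    \<le> ens s + ennreal (2 / \<mu> * l2sq g * (- s)) + ennreal (1228800 * \<kappa>\<^sup>2 / \<mu>) *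
       (ennreal (1 / \<eta> * m2) * X * (\<integral>\<^sup>+\<tau>. ens \<tau> * indicator {s..0} \<tau> \<partial>lborel)
        + ennreal \<eta> * (\<integral>\<^sup>+\<tau>. D \<tau> * indicator {s..0} \<tau> \<partial>lborel))"
proof -
  have \<omega>0: "\<omega> 0 = 0" and \<omega>nn: "\<And>k. 0 \<le> \<omega> k" and \<omega>le: "\<And>k. \<omega> k \<le> kn k"
    and \<omega>2: "\<And>k m. kn k \<le> 2 * kn m \<Longrightarrow> \<omega> k \<le> 2 * \<omega> m"
    using R by (auto simp: \<omega>_def)
  define b where "b \<tau> k = ennreal ((norm (g k - Bcoef L (u \<tau>) (u \<tau>) k))\<^sup>2)" for \<tau> k
  have b_meas [measurable]: "(\<lambda>\<tau>. b \<tau> k) \<in> borel_measurable borel" for k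
  proof -
    have "(\<lambda>\<tau>. (norm (g k - Bcoef L (u \<tau>) (u \<tau>) k))\<^sup>2) \<in> borel_measurable borel"
      by (intro borel_measurable_continuous_onI continuous_intros continuous_B)
    then show ?thesis unfolding b_def by measurable
  qed
  have D_meas [measurable]: "D \<in> borel_measurable borel"
    unfolding D_def by measurable
  \<comment> \<open>The weight of |g_k - B_k|^2 after summation: 1/(\<mu> |k|^2) comes from
    \<open>mode_energy\<close> and cancels the |k|^2 contained in |B_k|^2.\<close>
  define c where "c k = ennreal ((\<omega> k)\<^sup>2 / (\<mu> * ksq k))" for k
  have mode: "(ennreal (\<omega> k) * enorm (u t) k)\<^sup>2
        + (\<integral>\<^sup>+\<tau>. ennreal \<mu> * (ennreal (ksq k) * (ennreal (\<omega> k) * enorm (u \<tau>) k)\<^sup>2) * indicator {s..t} \<tau> \<partial>lborel)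
      \<le> (ennreal (\<omega> k) * enorm (u s) k)\<^sup>2 + (\<integral>\<^sup>+\<tau>. c k * b \<tau> k * indicator {s..t} \<tau> \<partial>lborel)" for k
  proof (cases "k = 0")
    case False
    have "ennreal ((\<omega> k)\<^sup>2) * (ennreal ((norm (u t k))\<^sup>2)
        + ennreal (\<mu> * ksq k) * (\<integral>\<^sup>+\<tau>. ennreal ((norm (u \<tau> k))\<^sup>2) * indicator {s..t} \<tau> \<partial>lborel))
      \<le> ennreal ((\<omega> k)\<^sup>2) * (ennreal ((norm (u s k))\<^sup>2)
        + ennreal (1 / (\<mu> * ksq k)) * (\<integral>\<^sup>+\<tau>. b \<tau> k * indicator {s..t} \<tau> \<partial>lborel))"
      unfolding b_def by (intro mult_left_mono mode_energy st False) auto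
    moreover have "ennreal ((\<omega> k)\<^sup>2) * ennreal ((norm (u \<tau> k))\<^sup>2) = (ennreal (\<omega> k) * enorm (u \<tau>) k)\<^sup>2" for \<tau>
      by (simp add: enorm_def power_mult_distrib ennreal_power \<omega>nn)
    moreover have "ennreal ((\<omega> k)\<^sup>2) * (ennreal (\<mu> * ksq k) * (\<integral>\<^sup>+\<tau>. ennreal ((norm (u \<tau> k))\<^sup>2) * indicator {s..t} \<tau> \<partial>lborel))
       = (\<integral>\<^sup>+\<tau>. ennreal \<mu> * (ennreal (ksq k) * (ennreal (\<omega> k) * enorm (u \<tau>) k)\<^sup>2) * indicator {s..t} \<tau> \<partial>lborel)"
    proof -
      have "(\<lambda>\<tau>. ennreal ((norm (u \<tau> k))\<^sup>2)) = (\<lambda>\<tau>. (enorm (u \<tau>) k)\<^sup>2)"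
        by (simp add: enorm_def ennreal_power)
      then show ?thesis
        unfolding mult.assoc[of "ennreal ((\<omega> k)\<^sup>2)", symmetric] using \<mu>_pos
        by (subst nn_integral_cmult[symmetric])
           (auto intro!: nn_integral_cong simp: ennreal_mult ennreal_power \<omega>nn power_mult_distrib mult_ac fun_eq_iff)
    qed
    moreover have "ennreal ((\<omega> k)\<^sup>2) * (ennreal (1 / (\<mu> * ksq k)) * (\<integral>\<^sup>+\<tau>. b \<tau> k * indicator {s..t} \<tau> \<partial>lborel))
       = (\<integral>\<^sup>+\<tau>. c k * b \<tau> k * indicator {s..t} \<tau> \<partial>lborel)"
    proof -
      have "c k = ennreal ((\<omega> k)\<^sup>2) * ennreal (1 / (\<mu> * ksq k))"
        unfolding c_def using \<mu>_pos by (subst ennreal_mult[symmetric]) auto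
      then show ?thesis
        unfolding mult.assoc[of "ennreal ((\<omega> k)\<^sup>2)", symmetric]
        by (subst nn_integral_cmult[symmetric]) (auto intro!: nn_integral_cong simp: mult.assoc)
    qed
    ultimately show ?thesis by (simp only: distrib_left)
  qed (simp add: \<omega>0 c_def)
  \<comment> \<open>The constant is 200 * 6144, where 200 = 2 * 10^2 stems from the square of g - B
    and from \<open>norm_Bcoef_le\<close>, and 6144 from \<open>lsum_conv_square_le\<close>.\<close>
  have point: "lsum (\<lambda>k. c k * b \<tau> k) \<le> ennreal (2 / \<mu> * l2sq g)
     + ennreal (1228800 * \<kappa>\<^sup>2 / \<mu>) * (ennreal (1 / \<eta> * m2) * X * ens \<tau> + ennreal \<eta> * D \<tau>)" if \<tau>: "\<tau> \<in> {s..0}" for \<tau>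
  proof -
    define a where "a = enorm (u \<tau>)"
    have a0: "a 0 = 0" by (simp add: a_def enorm_def u_0)
    have "c k * b \<tau> k \<le> ennreal (2 / \<mu>) * (enorm g k)\<^sup>2 + ennreal (200 * \<kappa>\<^sup>2 / \<mu>) * (ennreal (\<omega> k) * conv a a k)\<^sup>2" for k
    proof (cases "k = 0")
      case False
      have kp: "0 < kn k" using kn_pos[OF False] .
      let ?B = "norm (Bcoef L (u \<tau>) (u \<tau>) k)"
      have "(norm (g k - Bcoef L (u \<tau>) (u \<tau>) k))\<^sup>2 \<le> (norm (g k) + ?B)\<^sup>2"
        by (intro power_mono norm_triangle_ineq4) auto
      also have "\<dots> \<le> 2 * (norm (g k))\<^sup>2 + 2 * ?B\<^sup>2"
        using sum_squares_ge_zero[of "norm (g k) - ?B" 0] by (simp add: power2_eq_square algebra_simps)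
      finally have "b \<tau> k \<le> ennreal (2 * (norm (g k))\<^sup>2 + 2 * ?B\<^sup>2)"
        unfolding b_def by (rule ennreal_leI)
      also have "\<dots> = 2 * (enorm g k)\<^sup>2 + 2 * (ennreal ?B)\<^sup>2"
        by (simp add: enorm_def ennreal_power ennreal_plus ennreal_mult)
      also have "\<dots> \<le> 2 * (enorm g k)\<^sup>2 + 2 * (ennreal (10 * \<kappa> * kn k) * conv a a k)\<^sup>2"
        unfolding a_def \<kappa>_def by (intro add_mono mult_left_mono power_mono norm_Bcoef_le inH_u L) auto
      finally have "c k * b \<tau> k \<le> c k * (2 * (enorm g k)\<^sup>2 + 2 * (ennreal (10 * \<kappa> * kn k) * conv a a k)\<^sup>2)"
        by (rule mult_left_mono) auto
      also have "\<dots> = (c k * 2) * (enorm g k)\<^sup>2 + (c k * 2 * ennreal ((10 * \<kappa> * kn k)\<^sup>2)) * (conv a a k)\<^sup>2"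
        using \<kappa>_pos by (simp add: distrib_left power_mult_distrib[of _ "conv a a k"] ennreal_power mult.assoc)
      also have "\<dots> \<le> ennreal (2 / \<mu>) * (enorm g k)\<^sup>2 + (ennreal (200 * \<kappa>\<^sup>2 / \<mu>) * (ennreal (\<omega> k))\<^sup>2) * (conv a a k)\<^sup>2"
      proof (intro add_mono mult_right_mono)
        show "c k * 2 \<le> ennreal (2 / \<mu>)"
      proof -
        have "(\<omega> k)\<^sup>2 \<le> ksq k" unfolding kn_power2[symmetric] by (intro power_mono \<omega>le \<omega>nn)
        then have "(\<omega> k)\<^sup>2 / (\<mu> * ksq k) * 2 \<le> 2 / \<mu>"
          using kp \<mu>_pos by (simp add: field_simps flip: kn_power2)
        then show ?thesis unfolding c_def using \<mu>_pos
          by (simp add: ennreal_leI flip: ennreal_mult ennreal_numeral)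
        qed
        have "c k * 2 * ennreal ((10 * \<kappa> * kn k)\<^sup>2) = ennreal (200 * \<kappa>\<^sup>2 / \<mu>) * (ennreal (\<omega> k))\<^sup>2"
      proof -
        have "(\<omega> k)\<^sup>2 / (\<mu> * ksq k) * 2 * (10 * \<kappa> * kn k)\<^sup>2 = 200 * \<kappa>\<^sup>2 / \<mu> * (\<omega> k)\<^sup>2"
          using kp \<mu>_pos by (simp add: field_simps flip: kn_power2)
        then show ?thesis unfolding c_def using \<mu>_pos \<kappa>_pos
          by (simp add: ennreal_power \<omega>nn flip: ennreal_mult ennreal_numeral)
        qed
        then show "c k * 2 * ennreal ((10 * \<kappa> * kn k)\<^sup>2) \<le> ennreal (200 * \<kappa>\<^sup>2 / \<mu>) * (ennreal (\<omega> k))\<^sup>2" by simp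
      qed auto
      finally show ?thesis by (simp add: power_mult_distrib mult.assoc)
    qed (simp add: c_def \<omega>0)
    then have "lsum (\<lambda>k. c k * b \<tau> k) \<le> lsum (\<lambda>k. ennreal (2 / \<mu>) * (enorm g k)\<^sup>2 + ennreal (200 * \<kappa>\<^sup>2 / \<mu>) * (ennreal (\<omega> k) * conv a a k)\<^sup>2)"
      by (rule lsum_mono)
    also have "\<dots> = ennreal (2 / \<mu>) * ennreal (l2sq g) + ennreal (200 * \<kappa>\<^sup>2 / \<mu>) * lsum (\<lambda>k. (ennreal (\<omega> k) * conv a a k)\<^sup>2)"
      by (simp only: lsum_add lsum_cmult lsum_enorm_square[OF l2_g])
    also have "ennreal (2 / \<mu>) * ennreal (l2sq g) = ennreal (2 / \<mu> * l2sq g)"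
      using \<mu>_pos l2sq_nonneg by (subst ennreal_mult) auto
    also have "lsum (\<lambda>k. (ennreal (\<omega> k) * conv a a k)\<^sup>2)
       \<le> 6144 * (lsum (\<lambda>l. ennreal (kn l) * (a l)\<^sup>2) * lsum (\<lambda>m. ennreal (kn m) * (ennreal (\<omega> m) * a m)\<^sup>2))"
      by (rule lsum_conv_square_le[of a \<omega>, OF a0 \<omega>0 \<omega>nn \<omega>2])
    also have "lsum (\<lambda>l. ennreal (kn l) * (a l)\<^sup>2) * lsum (\<lambda>m. ennreal (kn m) * (ennreal (\<omega> m) * a m)\<^sup>2)
       \<le> ennreal (1 / \<eta>) * (ennreal m2 * ens \<tau> * X) + ennreal \<eta> * D \<tau>"
    proof (rule ennreal_young[OF _ \<eta>])
      \<comment> \<open>Interpolation: the square of the norm of order one half is bounded by the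
        norms of orders 0 and 1. Used for \<open>a\<close> it gives the energy times the enstrophy,
        used for the truncated \<open>a\<close> it gives X times D.\<close>
      have CS: "(lsum (\<lambda>l. ennreal (kn l) * (d l)\<^sup>2))\<^sup>2 \<le> lsum (\<lambda>l. (d l)\<^sup>2) * lsum (\<lambda>l. ennreal (ksq l) * (d l)\<^sup>2)" for d
      proof -
        have eq: "ennreal (kn l) * (d l)\<^sup>2 = d l * (ennreal (kn l) * d l)" for l by (simp add: power2_eq_square mult_ac)
        show ?thesis unfolding eq
          by (rule order_trans[OF lsum_Cauchy_Schwarz]) (simp add: power_mult_distrib ennreal_power kn_power2)
      qed
      have "(lsum (\<lambda>l. ennreal (kn l) * (a l)\<^sup>2) * lsum (\<lambda>m. ennreal (kn m) * (ennreal (\<omega> m) * a m)\<^sup>2))\<^sup>2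
         \<le> (ennreal m2 * ens \<tau>) * (X * D \<tau>)"
        unfolding power_mult_distrib[of "lsum _" "lsum _"]
      proof (rule mult_mono)
        show "(lsum (\<lambda>l. ennreal (kn l) * (a l)\<^sup>2))\<^sup>2 \<le> ennreal m2 * ens \<tau>"
          by (rule order_trans[OF CS]) (simp add: a_def ens_def lsum_enorm_u_square_le mult_right_mono)
        have "E \<tau> \<le> X" unfolding X_def using \<tau> by (intro SUP_upper)
        then show "(lsum (\<lambda>m. ennreal (kn m) * (ennreal (\<omega> m) * a m)\<^sup>2))\<^sup>2 \<le> X * D \<tau>"
          by (intro order_trans[OF CS]) (simp add: a_def E_def D_def mult_right_mono)
      qed auto
      then show "(lsum (\<lambda>l. ennreal (kn l) * (a l)\<^sup>2) * lsum (\<lambda>m. ennreal (kn m) * (ennreal (\<omega> m) * a m)\<^sup>2))\<^sup>2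
         \<le> ennreal m2 * ens \<tau> * X * D \<tau>" by (simp only: mult.assoc)
    qed
    also have "ennreal (1 / \<eta>) * (ennreal m2 * ens \<tau> * X) = ennreal (1 / \<eta> * m2) * X * ens \<tau>"
      using \<eta> m2_nonneg by (subst ennreal_mult) (auto simp: mult_ac)
    finally have "lsum (\<lambda>k. c k * b \<tau> k) \<le> ennreal (2 / \<mu> * l2sq g) + ennreal (200 * \<kappa>\<^sup>2 / \<mu>) * (6144 * (ennreal (1 / \<eta> * m2) * X * ens \<tau> + ennreal \<eta> * D \<tau>))"
      by (simp add: mult_left_mono)
    also have "ennreal (200 * \<kappa>\<^sup>2 / \<mu>) * (6144 * (ennreal (1 / \<eta> * m2) * X * ens \<tau> + ennreal \<eta> * D \<tau>))
       = ennreal (1228800 * \<kappa>\<^sup>2 / \<mu>) * (ennreal (1 / \<eta> * m2) * X * ens \<tau> + ennreal \<eta> * D \<tau>)"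
      using \<mu>_pos unfolding mult.assoc[symmetric]
      by (simp flip: ennreal_mult ennreal_numeral)
    finally show ?thesis .
  qed
  have "E t + ennreal \<mu> * (\<integral>\<^sup>+\<tau>. D \<tau> * indicator {s..t} \<tau> \<partial>lborel)
     = lsum (\<lambda>k. (ennreal (\<omega> k) * enorm (u t) k)\<^sup>2
        + (\<integral>\<^sup>+\<tau>. ennreal \<mu> * (ennreal (ksq k) * (ennreal (\<omega> k) * enorm (u \<tau>) k)\<^sup>2) * indicator {s..t} \<tau> \<partial>lborel))"
  proof -
    have "ennreal \<mu> * (\<integral>\<^sup>+\<tau>. D \<tau> * indicator {s..t} \<tau> \<partial>lborel)
       = (\<integral>\<^sup>+\<tau>. lsum (\<lambda>k. ennreal \<mu> * (ennreal (ksq k) * (ennreal (\<omega> k) * enorm (u \<tau>) k)\<^sup>2) * indicator {s..t} \<tau>) \<partial>lborel)"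
      unfolding D_def lsum_multc unfolding lsum_cmult mult.assoc by (rule nn_integral_cmult[symmetric]) measurable
    also have "\<dots> = lsum (\<lambda>k. \<integral>\<^sup>+\<tau>. ennreal \<mu> * (ennreal (ksq k) * (ennreal (\<omega> k) * enorm (u \<tau>) k)\<^sup>2) * indicator {s..t} \<tau> \<partial>lborel)"
      by (rule nn_integral_count_space_nn_integral) auto
    finally show ?thesis by (simp only: lsum_add E_def)
  qed
  also have "\<dots> \<le> lsum (\<lambda>k. (ennreal (\<omega> k) * enorm (u s) k)\<^sup>2 + (\<integral>\<^sup>+\<tau>. c k * b \<tau> k * indicator {s..t} \<tau> \<partial>lborel))"
    by (rule lsum_mono) (rule mode)
  also have "\<dots> = lsum (\<lambda>k. (ennreal (\<omega> k) * enorm (u s) k)\<^sup>2) + lsum (\<lambda>k. \<integral>\<^sup>+\<tau>. c k * b \<tau> k * indicator {s..t} \<tau> \<partial>lborel)"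
    by (rule lsum_add)
  also have "lsum (\<lambda>k. (ennreal (\<omega> k) * enorm (u s) k)\<^sup>2) \<le> ens s"
    unfolding ens_def power_mult_distrib
    by (intro lsum_mono mult_right_mono)
       (auto simp: ennreal_power \<omega>nn \<omega>le simp flip: kn_power2 intro!: ennreal_leI power_mono)
  also have "lsum (\<lambda>k. \<integral>\<^sup>+\<tau>. c k * b \<tau> k * indicator {s..t} \<tau> \<partial>lborel) = (\<integral>\<^sup>+\<tau>. lsum (\<lambda>k. c k * b \<tau> k * indicator {s..t} \<tau>) \<partial>lborel)"
    by (rule nn_integral_count_space_nn_integral[symmetric]) auto
  also have "\<dots> \<le> (\<integral>\<^sup>+\<tau>. ennreal (2 / \<mu> * l2sq g) * indicator {s..0} \<tau>
     + ennreal (1228800 * \<kappa>\<^sup>2 / \<mu>) * (ennreal (1 / \<eta> * m2) * X * (ens \<tau> * indicator {s..0} \<tau>) + ennreal \<eta> * (D \<tau> * indicator {s..0} \<tau>)) \<partial>lborel)"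
  proof (intro nn_integral_mono)
    fix \<tau>
    show "lsum (\<lambda>k. c k * b \<tau> k * indicator {s..t} \<tau>) \<le> ennreal (2 / \<mu> * l2sq g) * indicator {s..0} \<tau>
     + ennreal (1228800 * \<kappa>\<^sup>2 / \<mu>) * (ennreal (1 / \<eta> * m2) * X * (ens \<tau> * indicator {s..0} \<tau>) + ennreal \<eta> * (D \<tau> * indicator {s..0} \<tau>))"
      using point[of \<tau>] st by (auto simp: lsum_multc indicator_def)
  qed
  also have "\<dots> = (\<integral>\<^sup>+\<tau>. ennreal (2 / \<mu> * l2sq g) * indicator {s..0} \<tau> \<partial>lborel)
     + ennreal (1228800 * \<kappa>\<^sup>2 / \<mu>) * (ennreal (1 / \<eta> * m2) * X * (\<integral>\<^sup>+\<tau>. ens \<tau> * indicator {s..0} \<tau> \<partial>lborel)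
        + ennreal \<eta> * (\<integral>\<^sup>+\<tau>. D \<tau> * indicator {s..0} \<tau> \<partial>lborel))"
    by (subst nn_integral_add, measurable, subst nn_integral_cmult, measurable, subst nn_integral_add, measurable,
        subst nn_integral_cmult, measurable, subst nn_integral_cmult, measurable)
  also have "(\<integral>\<^sup>+\<tau>. ennreal (2 / \<mu> * l2sq g) * indicator {s..0} \<tau> \<partial>lborel) = ennreal (2 / \<mu> * l2sq g * (- s))"
    using st \<mu>_pos l2sq_nonneg[of g] by (subst nn_integral_cmult_indicator) (auto simp flip: ennreal_mult)
  finally show ?thesis by (simp add: add.assoc add_mono)
qed

end

text \<open>Adding the two inequalities gives X + Y \<le> 2 A + (X + Y)/2. Finiteness of X and Y is
  what makes this subtraction legitimate.\<close>

lemma ennreal_absorb: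
  fixes X Y A :: ennreal
  assumes X: "X \<le> A + ennreal (1/4) * X + ennreal (1/4) * Y"
    and Y: "Y \<le> A + ennreal (1/4) * X + ennreal (1/4) * Y"
    and fin: "X < \<infinity>" "Y < \<infinity>"
  shows "X \<le> 4 * A"
proof (cases "A = \<infinity>")
  case False
  then obtain a x y where axy: "A = ennreal a" "X = ennreal x" "Y = ennreal y" "0 \<le> a" "0 \<le> x" "0 \<le> y"
    using fin by (metis ennreal_cases infinity_ennreal_def less_irrefl)
  have "x \<le> a + 1/4 * x + 1/4 * y" "y \<le> a + 1/4 * x + 1/4 * y"
    using X Y axy by (simp_all flip: ennreal_mult ennreal_plus)
  then have "x \<le> 4 * a" using axy(6) by linarith
  then show ?thesis using axy by (simp add: ennreal_leI flip: ennreal_mult ennreal_numeral)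
qed (simp add: ennreal_mult_top)

text \<open>The triangle inequality puts |k| on one factor, and products are split into squares. The
  sums without weight are bounded by those with weight |l|^2 because \<open>a 0 = 0\<close>, a
  Poincare inequality. The result bounds each mode of the nonlinear term uniformly in k.\<close>

lemma kn_conv_le_enstrophy:
  assumes "a 0 = 0"
  shows "ennreal (kn k) * conv a a k \<le> 4 * lsum (\<lambda>l. ennreal (ksq l) * (a l)\<^sup>2)"
proof -
  let ?E = "lsum (\<lambda>l. ennreal (ksq l) * (a l)\<^sup>2)"
  have "(a l)\<^sup>2 \<le> ennreal (ksq l) * (a l)\<^sup>2" for l
  proof (cases "l = 0")
    case False
    have "1 \<le> ennreal (ksq l)" using kn_ge_1[OF False]
      by (subst ennreal_1[symmetric], intro ennreal_leI) (simp flip: kn_power2 add: one_le_power)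
    from mult_right_mono[OF this, of "(a l)\<^sup>2"] show ?thesis by simp
  qed (simp add: assms)
  then have le: "lsum (\<lambda>l. (a l)\<^sup>2) \<le> ?E" by (rule lsum_mono)
  have "ennreal (kn k) * conv a a k = lsum (\<lambda>l. ennreal (kn k) * (a l * a (k - l)))"
    by (simp add: conv_def lsum_cmult)
  also have "\<dots> \<le> lsum (\<lambda>l. (ennreal (ksq l) * (a l)\<^sup>2 + (a l)\<^sup>2) + (ennreal (ksq (k - l)) * (a (k - l))\<^sup>2 + (a (k - l))\<^sup>2))"
  proof (rule lsum_mono)
    fix l
    have "ennreal (kn k) \<le> ennreal (kn l) + ennreal (kn (k - l))"
      using kn_triangle[of k l] by (simp flip: ennreal_plus add: ennreal_leI)
    then have "ennreal (kn k) * (a l * a (k - l)) \<le> (ennreal (kn l) + ennreal (kn (k - l))) * (a l * a (k - l))"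
      by (rule mult_right_mono) auto
    also have "\<dots> = (ennreal (kn l) * a l) * a (k - l) + (ennreal (kn (k - l)) * a (k - l)) * a l"
      by (simp add: distrib_left distrib_right mult_ac)
    also have "\<dots> \<le> ((ennreal (kn l) * a l)\<^sup>2 + (a (k - l))\<^sup>2) + ((ennreal (kn (k - l)) * a (k - l))\<^sup>2 + (a l)\<^sup>2)"
      by (intro add_mono ennreal_mult_le_sum_squares)
    also have "\<dots> = (ennreal (ksq l) * (a l)\<^sup>2 + (a l)\<^sup>2) + (ennreal (ksq (k - l)) * (a (k - l))\<^sup>2 + (a (k - l))\<^sup>2)"
      by (simp add: power_mult_distrib ennreal_power kn_power2 add_ac)
    finally show "ennreal (kn k) * (a l * a (k - l)) \<le> (ennreal (ksq l) * (a l)\<^sup>2 + (a l)\<^sup>2) + (ennreal (ksq (k - l)) * (a (k - l))\<^sup>2 + (a (k - l))\<^sup>2)" .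
  qed
  also have "\<dots> = (?E + lsum (\<lambda>l. (a l)\<^sup>2)) + (?E + lsum (\<lambda>l. (a l)\<^sup>2))"
    unfolding lsum_add lsum_reflect[of "\<lambda>l. ennreal (ksq l) * (a l)\<^sup>2" k] lsum_reflect[of "\<lambda>l. (a l)\<^sup>2" k] ..
  also have "\<dots> \<le> (?E + ?E) + (?E + ?E)" by (intro add_mono le order_refl)
  also have "\<dots> = 4 * ?E" by (simp flip: mult_2 mult.assoc)
  finally show ?thesis .
qed

context bounded_solution
begin

lemma enstrophy_bounded:
  obtains s e where "s < 0" "0 \<le> e" "\<And>t. s \<le> t \<Longrightarrow> t \<le> 0 \<Longrightarrow> ens t \<le> ennreal e"
proof -
  define c2 where "c2 = 1228800 * \<kappa>\<^sup>2 / \<mu>"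
  have c2: "c2 > 0" using \<kappa>_pos \<mu>_pos by (simp add: c2_def)
  \<comment> \<open>Chosen so that \<open>c2 * \<eta> = \<mu> / 4\<close>: a quarter of the
    dissipation.\<close>
  define \<eta> where "\<eta> = \<mu> / (4 * c2)"
  have \<eta>: "\<eta> > 0" using c2 \<mu>_pos by (simp add: \<eta>_def)
  \<comment> \<open>Makes the coefficient c2 m2 \<epsilon>/\<eta> of X at most 1/4; the summand 1
    guards against m2 = 0.\<close>
  define \<epsilon> where "\<epsilon> = \<eta> / (4 * c2 * (m2 + 1))"
  have \<epsilon>: "\<epsilon> > 0" using \<eta> c2 m2_nonneg by (simp add: \<epsilon>_def)
  obtain s where s: "s < 0" "ens s < \<infinity>" "(\<integral>\<^sup>+\<tau>. ens \<tau> * indicator {s..0} \<tau> \<partial>lborel) \<le> ennreal \<epsilon>"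
    using small_window[OF \<epsilon>] by blast
  define A where "A = ens s + ennreal (2 / \<mu> * l2sq g * (- s))"
  have A: "A < \<infinity>" using s by (simp add: A_def)
  define I where "I = (\<integral>\<^sup>+\<tau>. ens \<tau> * indicator {s..0} \<tau> \<partial>lborel)"
  have bound: "lsum (\<lambda>k. (ennreal (min (kn k) R) * enorm (u t) k)\<^sup>2) \<le> 4 * A" if R: "R \<ge> 1" and t: "s \<le> t" "t \<le> 0" for R t
  proof -
    define E where "E = (\<lambda>t. lsum (\<lambda>k. (ennreal (min (kn k) R) * enorm (u t) k)\<^sup>2))"
    define D where "D = (\<lambda>t. lsum (\<lambda>k. ennreal (ksq k) * (ennreal (min (kn k) R) * enorm (u t) k)\<^sup>2))"
    define X where "X = (SUP t\<in>{s..0}. E t)"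
    define Y where "Y = (\<integral>\<^sup>+\<tau>. D \<tau> * indicator {s..0} \<tau> \<partial>lborel)"
    have sq: "(ennreal (min (kn k) R) * enorm (u t) k)\<^sup>2 \<le> ennreal (R\<^sup>2) * (enorm (u t) k)\<^sup>2" for k t
    proof -
      have "(min (kn k) R)\<^sup>2 \<le> R\<^sup>2" using R by (intro power_mono) auto
      then have "ennreal ((min (kn k) R)\<^sup>2) * (enorm (u t) k)\<^sup>2 \<le> ennreal (R\<^sup>2) * (enorm (u t) k)\<^sup>2"
        by (intro mult_right_mono ennreal_leI) auto
      then show ?thesis using R by (simp add: power_mult_distrib ennreal_power)
    qed
    have "E t \<le> ennreal (R\<^sup>2 * m2)" for t
    proof -
      have "E t \<le> lsum (\<lambda>k. ennreal (R\<^sup>2) * (enorm (u t) k)\<^sup>2)"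
        unfolding E_def by (intro lsum_mono sq)
      also have "\<dots> \<le> ennreal (R\<^sup>2) * ennreal m2"
        unfolding lsum_cmult by (intro mult_left_mono lsum_enorm_u_square_le) auto
      finally show ?thesis using m2_nonneg by (simp add: ennreal_mult)
    qed
    then have "X \<le> ennreal (R\<^sup>2 * m2)" unfolding X_def by (intro SUP_least)
    then have Xfin: "X < \<infinity>" by (simp add: le_less_trans)
    have "D t \<le> ennreal (R\<^sup>2) * ens t" for t
    proof -
      have "D t \<le> lsum (\<lambda>k. ennreal (ksq k) * (ennreal (R\<^sup>2) * (enorm (u t) k)\<^sup>2))"
        unfolding D_def by (intro lsum_mono mult_left_mono sq) auto
      also have "\<dots> = ennreal (R\<^sup>2) * ens t"
        unfolding ens_def lsum_cmult[symmetric] by (simp add: mult.left_commute)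
      finally show ?thesis .
    qed
    then have "Y \<le> (\<integral>\<^sup>+\<tau>. ennreal (R\<^sup>2) * (ens \<tau> * indicator {s..0} \<tau>) \<partial>lborel)"
      unfolding Y_def by (intro nn_integral_mono) (auto simp: indicator_def)
    also have "\<dots> = ennreal (R\<^sup>2) * I" unfolding I_def by (rule nn_integral_cmult) measurable
    also have "\<dots> < \<infinity>" using s by (auto simp: I_def ennreal_mult_less_top le_less_trans)
    finally have Yfin: "Y < \<infinity>" .
    have ineq: "E t + ennreal \<mu> * (\<integral>\<^sup>+\<tau>. D \<tau> * indicator {s..t} \<tau> \<partial>lborel)
        \<le> A + ennreal (1/4) * X + ennreal (1/4) * (ennreal \<mu> * Y)" if "s \<le> t" "t \<le> 0" for t
    proof -
      have "E t + ennreal \<mu> * (\<integral>\<^sup>+\<tau>. D \<tau> * indicator {s..t} \<tau> \<partial>lborel)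
        \<le> A + ennreal c2 * (ennreal (1 / \<eta> * m2) * X * I + ennreal \<eta> * Y)"
        using truncated_enstrophy_inequality[OF R that \<eta>] unfolding E_def D_def X_def Y_def A_def c2_def I_def .
      also have "\<dots> \<le> A + ennreal c2 * (ennreal (1 / \<eta> * m2) * X * ennreal \<epsilon> + ennreal \<eta> * Y)"
        using s(3) by (intro add_mono mult_left_mono) (auto simp: I_def)
      also have "\<dots> = A + (ennreal c2 * ennreal (1 / \<eta> * m2) * ennreal \<epsilon> * X + ennreal c2 * ennreal \<eta> * Y)"
        by (simp add: distrib_left mult_ac)
      also have "ennreal c2 * ennreal (1 / \<eta> * m2) * ennreal \<epsilon> = ennreal (c2 * (1 / \<eta> * m2) * \<epsilon>)"
        using c2 \<eta> \<epsilon> m2_nonneg by (simp flip: ennreal_mult)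
      also have "ennreal c2 * ennreal \<eta> = ennreal (1/4) * ennreal \<mu>"
        using c2 \<eta> \<mu>_pos by (subst (1 2) ennreal_mult[symmetric]) (auto simp: \<eta>_def)
      also have "A + (ennreal (c2 * (1 / \<eta> * m2) * \<epsilon>) * X + ennreal (1/4) * ennreal \<mu> * Y)
          \<le> A + (ennreal (1/4) * X + ennreal (1/4) * ennreal \<mu> * Y)"
      proof (intro add_mono mult_right_mono ennreal_leI order_refl)
        have "c2 * (1 / \<eta> * m2) * \<epsilon> = m2 / (4 * (m2 + 1))"
          using c2 \<eta> m2_nonneg by (simp add: \<epsilon>_def)
        also have "\<dots> \<le> 1/4" using m2_nonneg by (simp add: field_simps)
        finally show "c2 * (1 / \<eta> * m2) * \<epsilon> \<le> 1/4" .
      qed auto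
      finally show ?thesis by (simp only: add.assoc mult.assoc)
    qed
    have "X \<le> 4 * A"
    proof (rule ennreal_absorb)
      show "X \<le> A + ennreal (1/4) * X + ennreal (1/4) * (ennreal \<mu> * Y)"
        unfolding X_def
      proof (rule SUP_least)
        fix t assume "t \<in> {s..0}"
        then have "E t \<le> E t + ennreal \<mu> * (\<integral>\<^sup>+\<tau>. D \<tau> * indicator {s..t} \<tau> \<partial>lborel)"
          by simp
        also have "\<dots> \<le> A + ennreal (1/4) * X + ennreal (1/4) * (ennreal \<mu> * Y)"
          using \<open>t \<in> {s..0}\<close> by (intro ineq) auto
        finally show "E t \<le> A + ennreal (1/4) * (SUP t\<in>{s..0}. E t) + ennreal (1/4) * (ennreal \<mu> * Y)"
          unfolding X_def .
      qed
      show "ennreal \<mu> * Y \<le> A + ennreal (1/4) * X + ennreal (1/4) * (ennreal \<mu> * Y)"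
        using ineq[of 0] s unfolding Y_def[symmetric] by (auto intro: order_trans[rotated])
      show "X < \<infinity>" by fact
      show "ennreal \<mu> * Y < \<infinity>" using Yfin by (simp add: ennreal_mult_less_top)
    qed
    moreover have "E t \<le> X" unfolding X_def using t by (intro SUP_upper) auto
    ultimately show ?thesis unfolding E_def by simp
  qed
  have "ens t \<le> 4 * A" if t: "s \<le> t" "t \<le> 0" for t
  proof -
    \<comment> \<open>The truncation levels are \<open>Suc n\<close> since \<open>bound\<close>
      requires R \<ge> 1; monotone convergence then removes the truncation.\<close>
    define f where "f n k = (ennreal (min (kn k) (real (Suc n))) * enorm (u t) k)\<^sup>2" for n k
    have "ens t \<le> lsum (\<lambda>k. SUP n. f n k)"
      unfolding ens_def
    proof (rule lsum_mono)
      fix k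
      obtain n where n: "kn k \<le> real n" using real_arch_simple by blast
      then have "ennreal (ksq k) * (enorm (u t) k)\<^sup>2 = f n k"
        by (simp add: f_def power_mult_distrib ennreal_power kn_power2 min_def)
      then show "ennreal (ksq k) * (enorm (u t) k)\<^sup>2 \<le> (SUP n. f n k)"
        using SUP_upper[of n UNIV "\<lambda>n. f n k"] by simp
    qed
    also have "\<dots> = (SUP n. lsum (f n))"
    proof (rule nn_integral_monotone_convergence_SUP)
      show "incseq f"
        by (intro monoI le_funI) (auto simp: f_def intro!: power_mono mult_right_mono ennreal_leI)
    qed simp
    also have "\<dots> \<le> 4 * A"
      unfolding f_def by (intro SUP_least bound t) auto
    finally show ?thesis .
  qed
  moreover have "4 * A = ennreal (enn2real (4 * A))"
    using A by (simp add: ennreal_mult_less_top)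
  ultimately show ?thesis
    using s by (intro that[of s "enn2real (4 * A)"]) auto
qed

text \<open>Bounded enstrophy makes the nonlinear modes bounded uniformly in k and in time, and the
  damping rate \<mu> |k|^2 turns bounded input into decay |k|^-2.\<close>

lemma env_inverse_square_bound:
  obtains b C where "b < 0" "0 \<le> C" "\<And>k. env b k \<le> ennreal (C * kn k powr (-2))"
proof -
  obtain s e where se: "s < 0" "0 \<le> e" "\<And>t. s \<le> t \<Longrightarrow> t \<le> 0 \<Longrightarrow> ens t \<le> ennreal e"
    using enstrophy_bounded by blast
  \<comment> \<open>The three terms of \<open>mode_smoothing\<close> between s and s/2; 40 = 10 * 4
    combines \<open>norm_Bcoef_le\<close> and \<open>kn_conv_le_enstrophy\<close>.\<close>
  define C where "C = (sqrt m2 / (s / 2 - s) + sqrt (l2sq g) + 40 * \<kappa> * e) / \<mu>"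
  have B: "norm (Bcoef L (u \<tau>) (u \<tau>) k) \<le> 40 * \<kappa> * e" if "s \<le> \<tau>" "\<tau> \<le> 0" for \<tau> k
  proof -
    have "ennreal (norm (Bcoef L (u \<tau>) (u \<tau>) k)) \<le> ennreal (10 * \<kappa> * kn k) * conv (enorm (u \<tau>)) (enorm (u \<tau>)) k"
      unfolding \<kappa>_def by (rule norm_Bcoef_le[OF inH_u L])
    also have "\<dots> = ennreal (10 * \<kappa>) * (ennreal (kn k) * conv (enorm (u \<tau>)) (enorm (u \<tau>)) k)"
      using \<kappa>_pos by (subst ennreal_mult) (auto simp: mult.assoc)
    also have "\<dots> \<le> ennreal (10 * \<kappa>) * (4 * ens \<tau>)"
      unfolding ens_def by (intro mult_left_mono kn_conv_le_enstrophy) (auto simp: enorm_def u_0)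
    also have "\<dots> \<le> ennreal (10 * \<kappa>) * (4 * ennreal e)"
      using se that by (intro mult_left_mono) auto
    also have "\<dots> = ennreal (40 * \<kappa> * e)"
      using \<kappa>_pos se by (simp flip: ennreal_mult ennreal_numeral)
    finally show ?thesis using \<kappa>_pos se by simp
  qed
  have C: "0 \<le> C" unfolding C_def using \<mu>_pos \<kappa>_pos se m2_nonneg l2sq_nonneg[of g]
    by (intro divide_nonneg_pos add_nonneg_nonneg) auto
  have "env (s / 2) k \<le> ennreal (C * kn k powr (-2))" for k
  proof (cases "k = 0")
    case False
    have kp: "kn k > 0" using kn_pos[OF False] .
    have "norm (u t k) \<le> C * kn k powr (-2)" if t: "t \<in> {s/2..0}" for t
    proof -
      have "\<mu> * ksq k * norm (u t k) \<le> norm (u s k) / (s / 2 - s) + norm (g k) + 40 * \<kappa> * e"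
        using se t by (intro mode_smoothing False B) auto
      also have "\<dots> \<le> sqrt m2 / (s / 2 - s) + sqrt (l2sq g) + 40 * \<kappa> * e"
      proof (intro add_mono divide_right_mono order_refl)
        have "norm (u s k) \<le> sqrt (l2sq (u s))" by (rule norm_coeff_le[OF l2_u])
        also have "\<dots> \<le> sqrt m2" by (simp add: l2sq_u_le)
        finally show "norm (u s k) \<le> sqrt m2" .
        show "norm (g k) \<le> sqrt (l2sq g)" by (rule norm_coeff_le[OF l2_g])
      qed (use se in auto)
      also have "\<dots> = \<mu> * C" using \<mu>_pos by (simp add: C_def)
      finally have "ksq k * norm (u t k) \<le> C" using \<mu>_pos by simp
      then show ?thesis using kp by (simp add: powr_minus field_simps flip: kn_power2)
    qed
    then show ?thesis unfolding env_def enorm_def by (intro SUP_least ennreal_leI) auto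
  qed simp
  with C show ?thesis using se by (intro that[of "s/2" C]) auto
qed

text \<open>The decay |k|^-2 is critical for summation in the plane. One more use of
  \<open>mode_smoothing\<close> improves the nonlinear and initial contributions to |k|^(-5/2). The
  contribution |k|^-2 |g_k| of the force is split by size into |k|^(-5/2) and |g_k|^2, both
  summable.\<close>

lemma lsum_env_finite:
  obtains c where "c < 0" "lsum (env c) < \<infinity>"
proof -
  obtain b C where b: "b < 0" "0 \<le> C" "\<And>k. env b k \<le> ennreal (C * kn k powr (-2))"
    using env_inverse_square_bound by blast
  define \<zeta> where "\<zeta> = lsum (\<lambda>k. ennreal (kn k powr (-5/2)))"
  have \<zeta>: "\<zeta> < \<infinity>" unfolding \<zeta>_def using lsum_kn_powr_finite[of "5/2"] by simp
  have cv: "ennreal (kn k powr (3/2)) * conv (env b) (env b) k \<le> ennreal (8 * C\<^sup>2) * \<zeta>" for k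
  proof -
    have "ennreal (kn k powr (3/2)) * conv (env b) (env b) k = lsum (\<lambda>l. ennreal (kn k powr (3/2)) * (env b l * env b (k - l)))"
      by (simp add: conv_def lsum_cmult)
    also have "\<dots> \<le> lsum (\<lambda>l. ennreal (4 * C\<^sup>2) * (ennreal (kn l powr (-5/2)) + ennreal (kn (k - l) powr (-5/2))))"
    proof (rule lsum_mono)
      fix l
      show "ennreal (kn k powr (3/2)) * (env b l * env b (k - l))
          \<le> ennreal (4 * C\<^sup>2) * (ennreal (kn l powr (-5/2)) + ennreal (kn (k - l) powr (-5/2)))"
      proof (cases "l = 0 \<or> k - l = 0")
        case False
        then have "kn k powr (3/2) * (kn l powr (-2) * kn (k - l) powr (-2)) \<le> 4 * (kn l powr (-5/2) + kn (k - l) powr (-5/2))"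
          using kn_pos[of l] kn_pos[of "k - l"] kn_triangle[of k l] by (intro powr_convolution_bound) auto
        then have "C\<^sup>2 * (kn k powr (3/2) * (kn l powr (-2) * kn (k - l) powr (-2))) \<le> C\<^sup>2 * (4 * (kn l powr (-5/2) + kn (k - l) powr (-5/2)))"
          by (intro mult_left_mono) auto
        then have *: "kn k powr (3/2) * ((C * kn l powr (-2)) * (C * kn (k - l) powr (-2))) \<le> 4 * C\<^sup>2 * (kn l powr (-5/2) + kn (k - l) powr (-5/2))"
          by (simp add: power2_eq_square mult_ac)
        have "ennreal (kn k powr (3/2)) * (env b l * env b (k - l))
            \<le> ennreal (kn k powr (3/2)) * (ennreal (C * kn l powr (-2)) * ennreal (C * kn (k - l) powr (-2)))"
          by (intro mult_left_mono mult_mono b) auto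
        also have "\<dots> = ennreal (kn k powr (3/2) * ((C * kn l powr (-2)) * (C * kn (k - l) powr (-2))))"
          using b(2) by (simp only: ennreal_mult mult_nonneg_nonneg powr_ge_zero)
        also have "\<dots> \<le> ennreal (4 * C\<^sup>2 * (kn l powr (-5/2) + kn (k - l) powr (-5/2)))"
          by (rule ennreal_leI) (rule *)
        also have "\<dots> = ennreal (4 * C\<^sup>2) * (ennreal (kn l powr (-5/2)) + ennreal (kn (k - l) powr (-5/2)))"
          by (subst ennreal_mult) (auto simp: ennreal_plus)
        finally show ?thesis .
      qed auto
    qed
    also have "\<dots> = ennreal (4 * C\<^sup>2) * (\<zeta> + \<zeta>)"
      unfolding lsum_cmult lsum_add \<zeta>_def lsum_reflect[of "\<lambda>l. ennreal (kn l powr (-5/2))" k] ..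
    also have "\<dots> = ennreal (8 * C\<^sup>2) * \<zeta>"
    proof -
      have "ennreal (8 * C\<^sup>2) = ennreal (4 * C\<^sup>2) * 2" by (simp flip: ennreal_mult ennreal_numeral)
      then show ?thesis by (simp only: mult_2[symmetric] mult.assoc)
    qed
    finally show ?thesis .
  qed
  obtain Z where Z: "ennreal (8 * C\<^sup>2) * \<zeta> = ennreal Z" "0 \<le> Z"
    using \<zeta> by (metis ennreal_cases ennreal_mult_less_top ennreal_less_top infinity_ennreal_def less_irrefl)
  \<comment> \<open>The summand 1 is the coefficient of the force term and also ensures 1 \<le>
    \<mu> K, which is used for the part with |g_k|^2.\<close>
  define K where "K = (C / (b / 2 - b) + 1 + 10 * \<kappa> * Z) / \<mu>"
  have pieces: "0 \<le> C / (b / 2 - b)" "0 \<le> 10 * \<kappa> * Z"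
    by (rule divide_nonneg_pos) (use b(1,2) \<kappa>_pos Z(2) in auto)
  then have K: "0 \<le> K" unfolding K_def using \<mu>_pos by simp
  have bd: "env (b / 2) k \<le> ennreal K * (ennreal (kn k powr (-5/2)) + (enorm g k)\<^sup>2)" for k
  proof (cases "k = 0")
    case False
    have kp: "kn k > 0" and k1: "kn k \<ge> 1" using kn_pos[OF False] kn_ge_1[OF False] by auto
    obtain x where x: "conv (env b) (env b) k = ennreal x" "0 \<le> x" "kn k powr (3/2) * x \<le> Z"
    proof -
      have fin: "conv (env b) (env b) k < \<infinity>"
        using cv[of k] Z kp by (cases "conv (env b) (env b) k") (auto simp: ennreal_mult_top top_unique)
      then obtain x where "conv (env b) (env b) k = ennreal x" "0 \<le> x"
        by (metis ennreal_cases infinity_ennreal_def less_irrefl)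
      moreover from this cv[of k] Z have "kn k powr (3/2) * x \<le> Z" by (simp flip: ennreal_mult)
      ultimately show ?thesis using that by blast
    qed
    have main: "norm (u t k) \<le> K * (kn k powr (-5/2) + (norm (g k))\<^sup>2)" if t: "t \<in> {b/2..0}" for t
    proof -
      have "\<mu> * ksq k * norm (u t k) \<le> norm (u b k) / (b / 2 - b) + norm (g k) + 10 * \<kappa> * kn k * x"
        using b(1) t x by (intro mode_smoothing False norm_B_le_conv_env) auto
      moreover have "norm (u b k) \<le> C * kn k powr (-2)"
        using order_trans[OF enorm_le_env[of b b k] b(3)[of k]] b by (simp add: enorm_def)
      then have "norm (u b k) / (b / 2 - b) \<le> C / (b / 2 - b) * kn k powr (-2)"
        using b by (simp add: field_simps)
      moreover have "C / (b / 2 - b) * kn k powr (-2) \<le> C / (b / 2 - b) * kn k powr (-1/2)"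
        using k1 pieces by (intro mult_left_mono powr_mono) auto
      moreover have "10 * \<kappa> * kn k * x \<le> 10 * \<kappa> * Z * kn k powr (-1/2)"
      proof -
        have "kn k * x = kn k powr (-1/2) * (kn k powr (3/2) * x)"
          using kp by (simp flip: powr_add mult.assoc)
        also have "\<dots> \<le> kn k powr (-1/2) * Z" using x by (intro mult_left_mono) auto
        finally show ?thesis using \<kappa>_pos by (simp add: mult_ac)
      qed
      \<comment> \<open>If |g_k| exceeds |k|^(-1/2), then 1 \<le> |g_k| |k|^(1/2) \<le> |g_k| |k|^2,
        and multiplying by |g_k| gives the second term.\<close>
      moreover have "norm (g k) \<le> kn k powr (-1/2) + ksq k * (norm (g k))\<^sup>2"
      proof (cases "norm (g k) \<le> kn k powr (-1/2)")
        case False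
        have "1 = kn k powr (-1/2) * kn k powr (1/2)" using kp by (simp flip: powr_add)
        also have "\<dots> \<le> norm (g k) * kn k powr (1/2)" using False by (intro mult_right_mono) auto
        also have "\<dots> \<le> norm (g k) * kn k powr 2" using k1 by (intro mult_left_mono powr_mono) auto
        finally have "norm (g k) * 1 \<le> norm (g k) * (norm (g k) * kn k powr 2)" by (intro mult_left_mono) auto
        then have "norm (g k) \<le> ksq k * (norm (g k))\<^sup>2"
          using kp by (simp add: power2_eq_square mult_ac flip: kn_power2)
        then show ?thesis by (simp add: add_increasing)
      qed (simp add: add_increasing2)
      ultimately have "\<mu> * ksq k * norm (u t k) \<le> C / (b / 2 - b) * kn k powr (-1/2) + (kn k powr (-1/2) + ksq k * (norm (g k))\<^sup>2) + 10 * \<kappa> * Z * kn k powr (-1/2)"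
        by linarith
      also have "\<dots> = (\<mu> * K) * kn k powr (-1/2) + ksq k * (norm (g k))\<^sup>2"
      proof -
        have "\<mu> * K = C / (b / 2 - b) + 1 + 10 * \<kappa> * Z" using \<mu>_pos by (simp add: K_def)
        then show ?thesis by (simp only: distrib_right mult_1)
      qed
      also have "\<dots> \<le> (\<mu> * K) * kn k powr (-1/2) + (\<mu> * K) * (ksq k * (norm (g k))\<^sup>2)"
      proof -
        have "\<mu> * K = C / (b / 2 - b) + 1 + 10 * \<kappa> * Z" using \<mu>_pos by (simp add: K_def)
        with pieces have "1 \<le> \<mu> * K" by linarith
        from mult_right_mono[OF this, of "ksq k * (norm (g k))\<^sup>2"] show ?thesis by simp
      qed
      also have "\<dots> = \<mu> * ksq k * (K * (kn k powr (-5/2) + (norm (g k))\<^sup>2))"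
      proof -
        have ksq: "ksq k = kn k powr 2" using kp by (simp flip: kn_power2)
        have "ksq k * kn k powr (-5/2) = kn k powr (-1/2)"
          unfolding ksq powr_add[symmetric] by simp
        then show ?thesis by (simp add: algebra_simps)
      qed
      finally show ?thesis using \<mu>_pos kp by (simp flip: kn_power2)
    qed
    have "env (b / 2) k \<le> ennreal (K * (kn k powr (-5/2) + (norm (g k))\<^sup>2))"
      unfolding env_def enorm_def using main by (intro SUP_least ennreal_leI) auto
    also have "\<dots> = ennreal K * (ennreal (kn k powr (-5/2)) + (enorm g k)\<^sup>2)"
      using K by (simp add: ennreal_mult ennreal_plus enorm_def ennreal_power)
    finally show ?thesis .
  qed simp
  have "lsum (env (b / 2)) \<le> lsum (\<lambda>k. ennreal K * (ennreal (kn k powr (-5/2)) + (enorm g k)\<^sup>2))"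
    by (rule lsum_mono) (rule bd)
  also have "\<dots> = ennreal K * (\<zeta> + ennreal (l2sq g))"
    by (simp only: lsum_cmult lsum_add lsum_enorm_square[OF l2_g] \<zeta>_def)
  also have "\<dots> < \<infinity>" using \<zeta> by (simp add: ennreal_mult_less_top)
  finally show ?thesis using b by (intro that[of "b/2"]) auto
qed

end

section \<open>Bootstrapping\<close>

text \<open>The l^1 counterpart of the union of all C(\<sigma>). With \<sigma> quantified away it is
  stable under sums, powers of |k| and self-convolution, each of which may raise \<sigma>.\<close>

definition rapid :: "(int \<times> int \<Rightarrow> ennreal) \<Rightarrow> bool" where
  "rapid a \<longleftrightarrow> (\<exists>C \<sigma>. 0 \<le> C \<and> 0 \<le> \<sigma> \<and> (\<forall>s. wsum s a \<le> ennreal (C * exp (\<sigma> * (real s)\<^sup>2))))"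

lemma rapidI:
  "0 \<le> C \<Longrightarrow> 0 \<le> \<sigma> \<Longrightarrow> (\<And>s. wsum s a \<le> ennreal (C * exp (\<sigma> * (real s)\<^sup>2))) \<Longrightarrow> rapid a"
  unfolding rapid_def by blast

lemma rapidE:
  assumes "rapid a"
  obtains C \<sigma> where "0 \<le> C" "0 \<le> \<sigma>" "\<And>s. wsum s a \<le> ennreal (C * exp (\<sigma> * (real s)\<^sup>2))"
  using assms unfolding rapid_def by blast

lemma rapid_mono: "rapid b \<Longrightarrow> (\<And>k. a k \<le> b k) \<Longrightarrow> rapid a"
  unfolding rapid_def by (meson wsum_mono order_trans)

lemma rapid_cmult:
  assumes "rapid a"
  shows "rapid (\<lambda>k. ennreal c * a k)"
  using assms
proof (rule rapidE)
  fix C \<sigma> assume *: "0 \<le> C" "0 \<le> \<sigma>" "\<And>s. wsum s a \<le> ennreal (C * exp (\<sigma> * (real s)\<^sup>2))"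
  show ?thesis
  proof (rule rapidI)
    show "0 \<le> \<bar>c\<bar> * C" "0 \<le> \<sigma>" using * by auto
    fix s
    have "wsum s (\<lambda>k. ennreal c * a k) \<le> ennreal \<bar>c\<bar> * ennreal (C * exp (\<sigma> * (real s)\<^sup>2))"
      unfolding wsum_cmult by (intro mult_mono * ennreal_leI) auto
    also have "\<dots> = ennreal (\<bar>c\<bar> * C * exp (\<sigma> * (real s)\<^sup>2))"
      using *(1) by (simp add: mult.assoc flip: ennreal_mult)
    finally show "wsum s (\<lambda>k. ennreal c * a k) \<le> ennreal (\<bar>c\<bar> * C * exp (\<sigma> * (real s)\<^sup>2))" .
  qed
qed

lemma rapid_add:
  assumes "rapid a" "rapid b"
  shows "rapid (\<lambda>k. a k + b k)"
proof -
  obtain A \<sigma> where A: "0 \<le> A" "0 \<le> \<sigma>" "\<And>s. wsum s a \<le> ennreal (A * exp (\<sigma> * (real s)\<^sup>2))"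
    using rapidE[OF assms(1)] by blast
  obtain B \<rho> where B: "0 \<le> B" "0 \<le> \<rho>" "\<And>s. wsum s b \<le> ennreal (B * exp (\<rho> * (real s)\<^sup>2))"
    using rapidE[OF assms(2)] by blast
  show ?thesis
  proof (rule rapidI)
    show "0 \<le> A + B" "0 \<le> \<sigma> + \<rho>" using A B by auto
    fix s
    have "wsum s (\<lambda>k. a k + b k) \<le> ennreal (A * exp (\<sigma> * (real s)\<^sup>2)) + ennreal (B * exp (\<rho> * (real s)\<^sup>2))"
      unfolding wsum_add by (intro add_mono A B)
    also have "\<dots> = ennreal (A * exp (\<sigma> * (real s)\<^sup>2) + B * exp (\<rho> * (real s)\<^sup>2))"
      using A B by (simp add: ennreal_plus)
    also have "\<dots> \<le> ennreal ((A + B) * exp ((\<sigma> + \<rho>) * (real s)\<^sup>2))"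
      unfolding distrib_right[of A B] using A B
      by (intro ennreal_leI add_mono mult_left_mono) (auto simp: distrib_right)
    finally show "wsum s (\<lambda>k. a k + b k) \<le> ennreal ((A + B) * exp ((\<sigma> + \<rho>) * (real s)\<^sup>2))" .
  qed
qed

text \<open>From (s + r)^2 \<le> 2 s^2 + 2 r^2: the shift of the order doubles \<sigma> and
  otherwise changes only the constant.\<close>

lemma rapid_kn_power:
  assumes "rapid a"
  shows "rapid (\<lambda>k. ennreal (kn k ^ r) * a k)"
proof -
  obtain A \<sigma> where A: "0 \<le> A" "0 \<le> \<sigma>" "\<And>s. wsum s a \<le> ennreal (A * exp (\<sigma> * (real s)\<^sup>2))"
    using rapidE[OF assms(1)] by blast
  show ?thesis
  proof (rule rapidI)
    show "0 \<le> A * exp (2 * \<sigma> * (real r)\<^sup>2)" "0 \<le> 2 * \<sigma>" using A by auto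
    fix s
    have "wsum s (\<lambda>k. ennreal (kn k ^ r) * a k) \<le> ennreal (A * exp (\<sigma> * (real (s + r))\<^sup>2))"
      unfolding wsum_kn_power by (rule A)
    also have "\<dots> \<le> ennreal (A * exp (2 * \<sigma> * (real r)\<^sup>2) * exp (2 * \<sigma> * (real s)\<^sup>2))"
    proof (rule ennreal_leI)
      have "(real (s + r))\<^sup>2 \<le> 2 * (real r)\<^sup>2 + 2 * (real s)\<^sup>2"
        using sum_squares_ge_zero[of "real s - real r" 0] by (simp add: power2_eq_square algebra_simps)
      then have "\<sigma> * (real (s + r))\<^sup>2 \<le> \<sigma> * (2 * (real r)\<^sup>2 + 2 * (real s)\<^sup>2)"
        using A by (intro mult_left_mono) auto
      then have "exp (\<sigma> * (real (s + r))\<^sup>2) \<le> exp (2 * \<sigma> * (real r)\<^sup>2) * exp (2 * \<sigma> * (real s)\<^sup>2)"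
        unfolding exp_add[symmetric] by (simp add: algebra_simps)
      then show "A * exp (\<sigma> * (real (s + r))\<^sup>2) \<le> A * exp (2 * \<sigma> * (real r)\<^sup>2) * exp (2 * \<sigma> * (real s)\<^sup>2)"
        unfolding mult.assoc[of A] using A by (intro mult_left_mono) auto
    qed
    finally show "wsum s (\<lambda>k. ennreal (kn k ^ r) * a k) \<le> ennreal (A * exp (2 * \<sigma> * (real r)\<^sup>2) * exp (2 * \<sigma> * (real s)\<^sup>2))" .
  qed
qed

lemma two_power_le_exp: "(2::real) ^ s \<le> exp (real s)"
proof -
  have "(2::real) \<le> exp 1" using exp_ge_add_one_self[of 1] by simp
  then have "(2::real) ^ s \<le> exp 1 ^ s" by (intro power_mono) auto
  then show ?thesis by (simp flip: exp_of_nat_mult)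
qed

text \<open>The factor 2^s of the tame estimate is at most exp (s^2) and is paid by raising \<sigma>
  by 1.\<close>

lemma rapid_conv:
  assumes "rapid a"
  shows "rapid (conv a a)"
proof -
  obtain A \<sigma> where A: "0 \<le> A" "0 \<le> \<sigma>" "\<And>s. wsum s a \<le> ennreal (A * exp (\<sigma> * (real s)\<^sup>2))"
    using rapidE[OF assms(1)] by blast
  show ?thesis
  proof (rule rapidI)
    show "0 \<le> 2 * A\<^sup>2" "0 \<le> \<sigma> + 1" using A by auto
    fix s
    have W0: "wsum 0 a \<le> ennreal A" using A(3)[of 0] by simp
    have "wsum s (conv a a) \<le> 2 ^ s * (wsum s a * wsum 0 a + wsum 0 a * wsum s a)" by (rule wsum_conv_le)
    also have "\<dots> \<le> 2 ^ s * (ennreal (A * exp (\<sigma> * (real s)\<^sup>2)) * ennreal A + ennreal A * ennreal (A * exp (\<sigma> * (real s)\<^sup>2)))"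
      by (intro mult_left_mono add_mono mult_mono A W0) auto
    also have "\<dots> = ennreal (2 ^ s * (2 * A\<^sup>2 * exp (\<sigma> * (real s)\<^sup>2)))"
    proof -
      have "(2::ennreal) ^ s = ennreal (2 ^ s)" by (simp flip: ennreal_power)
      then show ?thesis using A(1)
        by (simp add: power2_eq_square mult_ac flip: ennreal_mult ennreal_plus)
    qed
    also have "\<dots> \<le> ennreal (2 * A\<^sup>2 * exp ((\<sigma> + 1) * (real s)\<^sup>2))"
    proof (rule ennreal_leI)
      have "real s \<le> (real s)\<^sup>2" by (cases s) (auto simp: power2_eq_square)
      then have "2 ^ s \<le> exp ((real s)\<^sup>2)" using two_power_le_exp[of s] by (meson exp_le_cancel_iff order_trans)
      then have "2 ^ s * (2 * A\<^sup>2 * exp (\<sigma> * (real s)\<^sup>2)) \<le> exp ((real s)\<^sup>2) * (2 * A\<^sup>2 * exp (\<sigma> * (real s)\<^sup>2))"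
        by (intro mult_right_mono) auto
      also have "\<dots> = 2 * A\<^sup>2 * exp ((\<sigma> + 1) * (real s)\<^sup>2)"
        by (simp add: distrib_right exp_add)
      finally show "2 ^ s * (2 * A\<^sup>2 * exp (\<sigma> * (real s)\<^sup>2)) \<le> 2 * A\<^sup>2 * exp ((\<sigma> + 1) * (real s)\<^sup>2)" .
    qed
    finally show "wsum s (conv a a) \<le> ennreal (2 * A\<^sup>2 * exp ((\<sigma> + 1) * (real s)\<^sup>2))" .
  qed
qed

text \<open>The step from s to s + 1 shortens the window by a multiple of 2^-s and so costs a factor
  C 2^s; the product of these factors is of order exp (C s^2).\<close>

lemma bootstrap:
  fixes V :: "real \<Rightarrow> int \<times> int \<Rightarrow> ennreal"
  assumes c: "c < 0" and anti: "\<And>a b k. a \<le> b \<Longrightarrow> V b k \<le> V a k"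
    and fin: "lsum (V c) < \<infinity>" and q: "rapid q" and K: "0 \<le> K"
    and step: "\<And>a b k. c \<le> a \<Longrightarrow> a < b \<Longrightarrow> b \<le> c / 2 \<Longrightarrow>
        ennreal (kn k) * V b k \<le> ennreal (K / (b - a)) * V a k + q k + ennreal K * conv (V a) (V a) k"
  shows "rapid (V (c / 2))"
proof -
  obtain Cq \<sigma> where q: "0 \<le> Cq" "0 \<le> \<sigma>" "\<And>s. wsum s q \<le> ennreal (Cq * exp (\<sigma> * (real s)\<^sup>2))"
    using rapidE[OF q] by blast
  obtain w where w: "lsum (V c) = ennreal w" "0 \<le> w"
    using fin by (metis ennreal_cases infinity_ennreal_def less_irrefl)
  \<comment> \<open>Left endpoints moving from c towards c/2, each step halving the remaining
    distance; the step after \<open>s\<close> has length -c / (4 * 2^s).\<close>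
  define b where "b s = c / 2 * (1 + (1/2) ^ s)" for s :: nat
  have b0: "b 0 = c" by (simp add: b_def)
  have bge: "c \<le> b s" for s
  proof -
    have "(1/2::real) ^ s \<le> 1" by (intro power_le_one) auto
    then have "1 + (1/2::real) ^ s \<le> 2" by simp
    then have "c / 2 * 2 \<le> c / 2 * (1 + (1/2) ^ s)" using c by (intro mult_left_mono_neg) auto
    then show ?thesis by (simp add: b_def)
  qed
  have ble: "b s \<le> c / 2" for s
  proof -
    have "c / 2 * (1 + (1/2) ^ s) \<le> c / 2 * 1" using c by (intro mult_left_mono_neg) auto
    then show ?thesis by (simp add: b_def)
  qed
  have bdiff: "b (Suc s) - b s = (- c) / (4 * 2 ^ s)" for s
    by (simp add: b_def field_simps power_one_over)
  \<comment> \<open>The first part comes from the step length of \<open>b\<close>, the second from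
    the convolution, where \<open>w\<close> bounds the unweighted sum on every window. Both occur
    with the same factor 2^s.\<close>
  define N where "N = 4 * K / (- c) + 2 * K * w"
  have N: "0 \<le> N" unfolding N_def using K c w by (intro add_nonneg_nonneg divide_nonneg_pos) auto
  have rec: "wsum (Suc s) (V (b (Suc s))) \<le> ennreal (N * 2 ^ s) * wsum s (V (b s)) + wsum s q" for s
  proof -
    have "wsum (Suc s) (V (b (Suc s))) = wsum s (\<lambda>k. ennreal (kn k) * V (b (Suc s)) k)"
      using wsum_kn_power[of s 1] by simp
    also have "\<dots> \<le> wsum s (\<lambda>k. ennreal (K / (b (Suc s) - b s)) * V (b s) k + q k + ennreal K * conv (V (b s)) (V (b s)) k)"
    proof (rule wsum_mono, rule step)
      have "0 < b (Suc s) - b s" unfolding bdiff using c by (intro divide_pos_pos) auto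
      then show "b s < b (Suc s)" by simp
    qed (use bge ble in auto)
    also have "\<dots> = ennreal (K / (b (Suc s) - b s)) * wsum s (V (b s)) + wsum s q + ennreal K * wsum s (conv (V (b s)) (V (b s)))"
      by (simp only: wsum_add wsum_cmult)
    also have "wsum s (conv (V (b s)) (V (b s))) \<le> 2 ^ s * (wsum s (V (b s)) * wsum 0 (V (b s)) + wsum 0 (V (b s)) * wsum s (V (b s)))"
      by (rule wsum_conv_le)
    also have "\<dots> = (2 ^ s * 2 * wsum 0 (V (b s))) * wsum s (V (b s))"
      by (simp add: mult_ac flip: mult_2)
    also have "\<dots> \<le> (2 ^ s * 2 * ennreal w) * wsum s (V (b s))"
      unfolding w(1)[symmetric] wsum_0 by (intro mult_right_mono mult_left_mono lsum_mono anti bge) auto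
    also have "(2 ^ s * 2 * ennreal w) = ennreal (2 ^ s * 2 * w)"
    proof -
      have "(2::ennreal) ^ s = ennreal (2 ^ s)" by (simp flip: ennreal_power)
      then show ?thesis using w(2) by (simp flip: ennreal_mult ennreal_numeral)
    qed
    finally have "wsum (Suc s) (V (b (Suc s))) \<le> ennreal (K / (b (Suc s) - b s)) * wsum s (V (b s)) + wsum s q + ennreal K * (ennreal (2 ^ s * 2 * w) * wsum s (V (b s)))"
      by (simp add: mult_left_mono add_left_mono)
    also have "\<dots> = (ennreal (K / (b (Suc s) - b s)) + ennreal K * ennreal (2 ^ s * 2 * w)) * wsum s (V (b s)) + wsum s q"
      by (simp add: distrib_right mult.assoc add_ac)
    also have "ennreal (K / (b (Suc s) - b s)) + ennreal K * ennreal (2 ^ s * 2 * w) = ennreal (N * 2 ^ s)"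
    proof -
      have "K / (b (Suc s) - b s) + K * (2 ^ s * 2 * w) = N * 2 ^ s"
        unfolding bdiff N_def using c by (simp add: field_simps)
      moreover have "0 \<le> K / (b (Suc s) - b s)" unfolding bdiff using K c by (intro divide_nonneg_pos divide_pos_pos) auto
      moreover have "0 \<le> K * (2 ^ s * 2 * w)" using K w by simp
      ultimately show ?thesis using K w by (simp flip: ennreal_mult ennreal_plus)
    qed
    finally show ?thesis .
  qed
  define D where "D = w + Cq"
  \<comment> \<open>Since (s + 1)^2 - s^2 = 2 s + 1, the induction needs \<rho> (2 s + 1) to
    dominate the logarithm of N 2^s + 1, which is at most N + s; the summand \<sigma> lets the
    inhomogeneity \<open>q\<close> be included.\<close>
  define \<rho> where "\<rho> = \<sigma> + N + 1"
  have D: "0 \<le> D" using w q by (simp add: D_def)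
  have main: "wsum s (V (b s)) \<le> ennreal (D * exp (\<rho> * (real s)\<^sup>2))" for s
  proof (induction s)
    case 0
    show ?case unfolding wsum_0 b0 w(1) using q by (simp add: D_def ennreal_leI)
  next
    case (Suc s)
    have "wsum (Suc s) (V (b (Suc s))) \<le> ennreal (N * 2 ^ s) * ennreal (D * exp (\<rho> * (real s)\<^sup>2)) + ennreal (Cq * exp (\<sigma> * (real s)\<^sup>2))"
      by (intro order_trans[OF rec] add_mono mult_left_mono Suc.IH q) auto
    also have "\<dots> = ennreal (N * 2 ^ s * (D * exp (\<rho> * (real s)\<^sup>2)) + Cq * exp (\<sigma> * (real s)\<^sup>2))"
      using N D q by (simp add: ennreal_plus flip: ennreal_mult)
    also have "\<dots> \<le> ennreal (D * exp (\<rho> * (real (Suc s))\<^sup>2))"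
    proof (rule ennreal_leI)
      have "Cq * exp (\<sigma> * (real s)\<^sup>2) \<le> D * exp (\<rho> * (real s)\<^sup>2)"
        using q w N by (intro mult_mono) (auto simp: D_def \<rho>_def intro!: mult_right_mono)
      then have "N * 2 ^ s * (D * exp (\<rho> * (real s)\<^sup>2)) + Cq * exp (\<sigma> * (real s)\<^sup>2)
          \<le> (N * 2 ^ s + 1) * (D * exp (\<rho> * (real s)\<^sup>2))" by (simp add: distrib_right)
      also have "\<dots> \<le> exp (\<rho> * (2 * real s + 1)) * (D * exp (\<rho> * (real s)\<^sup>2))"
      proof (rule mult_right_mono)
        have "N * 2 ^ s + 1 \<le> (N + 1) * 2 ^ s" by (simp add: distrib_right)
        also have "\<dots> \<le> exp N * exp (real s)"
          using exp_ge_add_one_self[of N] N by (intro mult_mono two_power_le_exp) (auto simp: add.commute)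
        also have "\<dots> = exp (N + real s)" by (simp add: exp_add)
        also have "N + real s \<le> \<rho> * (2 * real s + 1)"
        proof -
          have "N + real s \<le> (N + 1) * (2 * real s + 1)"
            using N by (simp add: algebra_simps)
          also have "\<dots> \<le> \<rho> * (2 * real s + 1)" using q by (intro mult_right_mono) (auto simp: \<rho>_def)
          finally show ?thesis .
        qed
        finally show "N * 2 ^ s + 1 \<le> exp (\<rho> * (2 * real s + 1))" by simp
      qed (use D in auto)
      also have "\<dots> = D * (exp (\<rho> * (2 * real s + 1)) * exp (\<rho> * (real s)\<^sup>2))" by simp
      also have "exp (\<rho> * (2 * real s + 1)) * exp (\<rho> * (real s)\<^sup>2) = exp (\<rho> * (real (Suc s))\<^sup>2)"
        unfolding exp_add[symmetric] by (simp add: power2_eq_square algebra_simps)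
      finally show "N * 2 ^ s * (D * exp (\<rho> * (real s)\<^sup>2)) + Cq * exp (\<sigma> * (real s)\<^sup>2) \<le> D * exp (\<rho> * (real (Suc s))\<^sup>2)" .
    qed
    finally show ?case .
  qed
  show ?thesis
  proof (rule rapidI)
    show "0 \<le> D" "0 \<le> \<rho>" using D q N by (auto simp: \<rho>_def)
    show "wsum s (V (c / 2)) \<le> ennreal (D * exp (\<rho> * (real s)\<^sup>2))" for s
      by (rule order_trans[OF wsum_mono main]) (intro anti ble)
  qed
qed

lemma ennreal_divide_left:
  assumes "ennreal p * x \<le> y" "p > 0"
  shows "x \<le> ennreal (1 / p) * y"
proof -
  have "x = ennreal (1 / p) * (ennreal p * x)"
    using assms(2) by (simp flip: mult.assoc ennreal_mult)
  also have "\<dots> \<le> ennreal (1 / p) * y" by (intro mult_left_mono assms(1)) auto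
  finally show ?thesis .
qed

lemma inverse_kn_mult_le: "ennreal (1 / kn k) * x \<le> x"
proof -
  have "1 / kn k \<le> 1" using kn_ge_1[of k] by (cases "k = 0") auto
  then have "ennreal (1 / kn k) * x \<le> ennreal 1 * x" by (intro mult_right_mono ennreal_leI) auto
  then show ?thesis by simp
qed

section \<open>Transfer of decay between the force and a solution\<close>

context bounded_solution
begin

text \<open>\<open>env_smoothing\<close> fed into \<open>bootstrap\<close> with the force as
  inhomogeneity; its factor 1/|k| is simply dropped.\<close>

lemma rapid_solution:
  assumes "rapid (enorm g)"
  shows "rapid (enorm (u 0))"
proof -
  obtain c where c: "c < 0" "lsum (env c) < \<infinity>" using lsum_env_finite by blast
  have "rapid (env (c / 2))"
  proof (rule bootstrap[where V = env, OF c(1) env_antimono c(2)])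
    show "rapid (\<lambda>k. ennreal (1 / \<mu>) * enorm g k)" by (rule rapid_cmult[OF assms])
    \<comment> \<open>\<open>bootstrap\<close> takes one constant for both terms; this sum dominates
      1/\<mu> as well as 10 \<kappa>/\<mu>.\<close>
    show "0 \<le> (1 + 10 * \<kappa>) / \<mu>" using \<mu>_pos \<kappa>_pos by simp
    fix a b k assume ab: "c \<le> a" "a < b" "b \<le> c / 2"
    show "ennreal (kn k) * env b k \<le> ennreal ((1 + 10 * \<kappa>) / \<mu> / (b - a)) * env a k + ennreal (1 / \<mu>) * enorm g k
        + ennreal ((1 + 10 * \<kappa>) / \<mu>) * conv (env a) (env a) k"
    proof (cases "k = 0")
      case False
      have "ennreal \<mu> * (ennreal (kn k) * env b k) \<le> ennreal (1 / (b - a)) * env a k + enorm g k + ennreal (10 * \<kappa>) * conv (env a) (env a) k"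
        using order_trans[OF env_smoothing[of a b k] add_mono[OF add_mono[OF order_refl inverse_kn_mult_le] order_refl]] ab c False \<mu>_pos
        by (simp add: ennreal_mult mult.assoc)
      then have "ennreal (kn k) * env b k \<le> ennreal (1 / \<mu>) * (ennreal (1 / (b - a)) * env a k + enorm g k + ennreal (10 * \<kappa>) * conv (env a) (env a) k)"
        using \<mu>_pos by (rule ennreal_divide_left)
      also have "\<dots> = (ennreal (1 / \<mu>) * ennreal (1 / (b - a))) * env a k + ennreal (1 / \<mu>) * enorm g k + (ennreal (1 / \<mu>) * ennreal (10 * \<kappa>)) * conv (env a) (env a) k"
        by (simp add: distrib_left mult.assoc)
      also have "\<dots> \<le> ennreal ((1 + 10 * \<kappa>) / \<mu> / (b - a)) * env a k + ennreal (1 / \<mu>) * enorm g k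
        + ennreal ((1 + 10 * \<kappa>) / \<mu>) * conv (env a) (env a) k"
      proof (intro add_mono mult_right_mono order_refl)
        show "ennreal (1 / \<mu>) * ennreal (1 / (b - a)) \<le> ennreal ((1 + 10 * \<kappa>) / \<mu> / (b - a))"
          using \<mu>_pos \<kappa>_pos ab by (subst ennreal_mult[symmetric]) (auto intro!: ennreal_leI divide_right_mono simp: field_simps)
        show "ennreal (1 / \<mu>) * ennreal (10 * \<kappa>) \<le> ennreal ((1 + 10 * \<kappa>) / \<mu>)"
          using \<mu>_pos \<kappa>_pos by (subst ennreal_mult[symmetric]) (auto intro!: ennreal_leI divide_right_mono)
      qed auto
      finally show ?thesis .
    qed simp
  qed
  then show ?thesis by (rule rapid_mono) (intro enorm_le_env, use c in auto)
qed

lemma rapid_force: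
  assumes "rapid (enorm (u 0))"
  shows "rapid (enorm g)"
proof -
  obtain c where c: "c < 0" "lsum (env c) < \<infinity>" using lsum_env_finite by blast
  \<comment> \<open>The factor in \<open>env_force_bound\<close> is smallest on the shortest window;
    all windows below start at c/2 or earlier, so \<open>\<theta>\<close> serves for all of
    them.\<close>
  define \<theta> where "\<theta> = 1 - exp (\<mu> * (c / 2))"
  have \<theta>: "\<theta> > 0" using c \<mu>_pos by (simp add: \<theta>_def mult_pos_neg)
  have force: "ennreal (1 / kn k) * enorm g k
      \<le> ennreal (1 / \<theta>) * (ennreal (\<mu> * kn k) * enorm (u 0) k + ennreal (1 / (- a)) * env a k + ennreal (10 * \<kappa>) * conv (env a) (env a) k)"
    if a: "a \<le> c / 2" "k \<noteq> 0" for a k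
  proof (rule ennreal_divide_left[OF _ \<theta>])
    have "\<theta> \<le> 1 - exp (\<mu> * a)" using a \<mu>_pos by (simp add: \<theta>_def)
    then have "ennreal \<theta> * (ennreal (1 / kn k) * enorm g k) \<le> ennreal (1 - exp (\<mu> * a)) * (ennreal (1 / kn k) * enorm g k)"
      by (intro mult_right_mono ennreal_leI) auto
    also have "\<dots> \<le> ennreal (\<mu> * kn k) * enorm (u 0) k + ennreal (1 / (- a)) * env a k + ennreal (10 * \<kappa>) * conv (env a) (env a) k"
      using a c by (intro env_force_bound) auto
    finally show "ennreal \<theta> * (ennreal (1 / kn k) * enorm g k) \<le> ennreal (\<mu> * kn k) * enorm (u 0) k + ennreal (1 / (- a)) * env a k + ennreal (10 * \<kappa>) * conv (env a) (env a) k" .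
  qed
  have "rapid (env (c / 2))"
  proof (rule bootstrap[where V = env, OF c(1) env_antimono c(2)])
    show "rapid (\<lambda>k. ennreal (1 / \<theta>) * (ennreal (kn k ^ 1) * enorm (u 0) k))" by (intro rapid_cmult rapid_kn_power assms)
    \<comment> \<open>1 + 1/\<theta> adds the direct contribution and the one that arrives through
      the force; 1 + 10 \<kappa> covers both the initial and the convolution coefficient.\<close>
    define K where "K = (1 + 10 * \<kappa>) * (1 + 1 / \<theta>) / \<mu>"
    show "0 \<le> K" using \<mu>_pos \<kappa>_pos \<theta> by (simp add: K_def)
    fix a b k assume ab: "c \<le> a" "a < b" "b \<le> c / 2"
    show "ennreal (kn k) * env b k \<le> ennreal (K / (b - a)) * env a k + ennreal (1 / \<theta>) * (ennreal (kn k ^ 1) * enorm (u 0) k)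
        + ennreal K * conv (env a) (env a) k"
    proof (cases "k = 0")
      case False
      define \<delta> where "\<delta> = b - a"
      have \<delta>: "\<delta> > 0" using ab by (simp add: \<delta>_def)
      let ?c = "conv (env a) (env a) k"
      have "ennreal (1 / kn k) * enorm g k
        \<le> ennreal (1 / \<theta>) * (ennreal (\<mu> * kn k) * enorm (u 0) k + ennreal (1 / (- a)) * env a k + ennreal (10 * \<kappa>) * ?c)"
        using ab False by (intro force) auto
      also have "\<dots> \<le> ennreal (1 / \<theta>) * (ennreal (\<mu> * kn k) * enorm (u 0) k + ennreal (1 / \<delta>) * env a k + ennreal (10 * \<kappa>) * ?c)"
      proof (intro mult_left_mono add_mono mult_right_mono ennreal_leI order_refl)
        \<comment> \<open>The force is estimated over [a, 0], which is longer than [a, b] because b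
          < 0; its window cost is therefore no larger.\<close>
        show "1 / (- a) \<le> 1 / \<delta>" unfolding \<delta>_def using ab c(1) by (intro divide_left_mono mult_pos_pos) auto
      qed auto
      finally have g: "ennreal (1 / kn k) * enorm g k \<le> ennreal (1 / \<theta>) * (ennreal (\<mu> * kn k) * enorm (u 0) k + ennreal (1 / \<delta>) * env a k + ennreal (10 * \<kappa>) * ?c)" .
      have "ennreal \<mu> * (ennreal (kn k) * env b k) = ennreal (\<mu> * kn k) * env b k"
        using \<mu>_pos by (simp add: ennreal_mult mult.assoc)
      also have "\<dots> \<le> ennreal (1 / (b - a)) * env a k + ennreal (1 / kn k) * enorm g k + ennreal (10 * \<kappa>) * ?c"
        using ab c False by (intro env_smoothing) auto
      also have "\<dots> \<le> ennreal (1 / \<delta>) * env a k + ennreal (1 / \<theta>) * (ennreal (\<mu> * kn k) * enorm (u 0) k + ennreal (1 / \<delta>) * env a k + ennreal (10 * \<kappa>) * ?c) + ennreal (10 * \<kappa>) * ?c"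
        unfolding \<delta>_def[symmetric] by (intro add_mono g order_refl)
      finally have "ennreal (kn k) * env b k \<le> ennreal (1 / \<mu>) * (ennreal (1 / \<delta>) * env a k + ennreal (1 / \<theta>) * (ennreal (\<mu> * kn k) * enorm (u 0) k + ennreal (1 / \<delta>) * env a k + ennreal (10 * \<kappa>) * ?c) + ennreal (10 * \<kappa>) * ?c)"
        using \<mu>_pos by (rule ennreal_divide_left)
      also have "\<dots> = (ennreal (1 / \<mu>) * (ennreal (1 / \<delta>) + ennreal (1 / \<theta>) * ennreal (1 / \<delta>))) * env a k
           + (ennreal (1 / \<mu>) * (ennreal (1 / \<theta>) * ennreal (\<mu> * kn k))) * enorm (u 0) k
           + (ennreal (1 / \<mu>) * (ennreal (1 / \<theta>) * ennreal (10 * \<kappa>) + ennreal (10 * \<kappa>))) * ?c"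
        by (simp add: distrib_left distrib_right mult.assoc add_ac)
      also have "\<dots> \<le> ennreal (K / \<delta>) * env a k + (ennreal (1 / \<theta>) * ennreal (kn k)) * enorm (u 0) k + ennreal K * ?c"
      proof (intro add_mono mult_right_mono)
        have "1 / \<mu> * (1 / \<delta> + 1 / \<theta> * (1 / \<delta>)) \<le> K / \<delta>"
        proof -
          have "1 / \<mu> * (1 / \<delta> + 1 / \<theta> * (1 / \<delta>)) = 1 * (1 + 1 / \<theta>) / \<mu> / \<delta>" by (simp add: distrib_left add_divide_distrib mult_ac)
          also have "\<dots> \<le> K / \<delta>" unfolding K_def using \<theta> \<mu>_pos \<kappa>_pos \<delta> by (intro divide_right_mono mult_right_mono) auto
          finally show ?thesis .
        qed
        then show "ennreal (1 / \<mu>) * (ennreal (1 / \<delta>) + ennreal (1 / \<theta>) * ennreal (1 / \<delta>)) \<le> ennreal (K / \<delta>)"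
          using \<theta> \<mu>_pos \<delta> by (simp add: ennreal_leI flip: ennreal_mult ennreal_plus)
        show "ennreal (1 / \<mu>) * (ennreal (1 / \<theta>) * ennreal (\<mu> * kn k)) \<le> ennreal (1 / \<theta>) * ennreal (kn k)"
          using \<theta> \<mu>_pos by (simp flip: ennreal_mult)
        have "1 / \<mu> * (1 / \<theta> * (10 * \<kappa>) + 10 * \<kappa>) \<le> K"
        proof -
          have "1 / \<mu> * (1 / \<theta> * (10 * \<kappa>) + 10 * \<kappa>) = 10 * \<kappa> * (1 + 1 / \<theta>) / \<mu>" by (simp add: distrib_left add_divide_distrib mult_ac)
          also have "\<dots> \<le> K" unfolding K_def using \<theta> \<mu>_pos \<kappa>_pos by (intro divide_right_mono mult_right_mono) auto
          finally show ?thesis .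
        qed
        then show "ennreal (1 / \<mu>) * (ennreal (1 / \<theta>) * ennreal (10 * \<kappa>) + ennreal (10 * \<kappa>)) \<le> ennreal K"
          using \<theta> \<mu>_pos \<kappa>_pos by (simp add: ennreal_leI flip: ennreal_mult ennreal_plus)
      qed auto
      finally show ?thesis by (simp add: \<delta>_def mult.assoc)
    qed simp
  qed
  \<comment> \<open>A majorant of the force, assembled from sequences now known to be rapid; the
    outer factor |k| undoes the division by |k| in \<open>force\<close>.\<close>
  then have "rapid (\<lambda>k. ennreal (kn k ^ 1) * (ennreal (1 / \<theta>) * ((ennreal \<mu> * (ennreal (kn k ^ 1) * enorm (u 0) k)
     + ennreal (1 / (- (c / 2))) * env (c / 2) k) + ennreal (10 * \<kappa>) * conv (env (c / 2)) (env (c / 2)) k)))"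
    by (intro rapid_kn_power rapid_cmult rapid_add rapid_conv assms)
  then show ?thesis
  proof (rule rapid_mono)
    fix k
    show "enorm g k \<le> ennreal (kn k ^ 1) * (ennreal (1 / \<theta>) * ((ennreal \<mu> * (ennreal (kn k ^ 1) * enorm (u 0) k)
     + ennreal (1 / (- (c / 2))) * env (c / 2) k) + ennreal (10 * \<kappa>) * conv (env (c / 2)) (env (c / 2)) k))"
    proof (cases "k = 0")
      case False
      have "enorm g k = ennreal (kn k) * (ennreal (1 / kn k) * enorm g k)"
        using kn_pos[OF False] by (simp flip: mult.assoc ennreal_mult)
      also have "\<dots> \<le> ennreal (kn k) * (ennreal (1 / \<theta>) * (ennreal (\<mu> * kn k) * enorm (u 0) k + ennreal (1 / (- (c / 2))) * env (c / 2) k + ennreal (10 * \<kappa>) * conv (env (c / 2)) (env (c / 2)) k))"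
        by (intro mult_left_mono force False) auto
      finally show ?thesis using \<mu>_pos by (simp add: ennreal_mult mult.assoc)
    qed (simp add: enorm_def g_0)
  qed
qed

end

section \<open>Comparison of weighted sums with the classes C(\<sigma>)\<close>

text \<open>Passage from l^2 to l^1: the l^2 bound of order s + 3 bounds each single coefficient,
  and the spare factor |k|^-3 is summable over the plane lattice.\<close>

lemma Cclass_imp_rapid:
  assumes u: "u \<in> Cclass L \<nu> \<sigma>" and L: "L > 0" and \<nu>: "\<nu> > 0"
  shows "rapid (enorm u)"
proof -
  have u0: "u 0 = 0" using u by (auto simp: Cclass_def inH_def zero_prod_def)
  obtain c0 where c0: "\<And>\<alpha>. Apow_summable L \<alpha> u" "\<And>\<alpha>. Apow_norm2 L \<alpha> u / (\<nu>\<^sup>2 * kappa0 L ^ (2 * \<alpha>)) \<le> c0 * exp (\<sigma> * (real \<alpha>)\<^sup>2)"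
    using u unfolding Cclass_def by blast
  define \<kappa> where "\<kappa> = kappa0 L"
  have \<kappa>: "\<kappa> > 0" using L by (simp add: \<kappa>_def kappa0_def)
  \<comment> \<open>The absolute value and the summand 1 give y = C exp (|\<sigma>| \<alpha>^2)
    \<ge> 1, so that x^2 \<le> y implies x^2 \<le> y^2 and no square root appears in the
    bound.\<close>
  define C where "C = \<bar>\<nu>\<^sup>2 / L\<^sup>2 * c0\<bar> + 1"
  have pt: "kn k ^ \<alpha> * norm (u k) \<le> C * exp (\<bar>\<sigma>\<bar> * (real \<alpha>)\<^sup>2)" for k \<alpha>
  proof -
    let ?f = "\<lambda>k. (\<kappa>\<^sup>2 * ksq k) ^ \<alpha> * (norm (u k))\<^sup>2"
    have sm: "?f summable_on UNIV" using c0(1)[of \<alpha>] by (simp add: Apow_summable_def \<kappa>_def)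
    have "ennreal (?f k) \<le> ennreal (infsum ?f UNIV)"
      using sm by (subst ennreal_infsum_eq_lsum) (auto intro: le_lsum)
    then have le: "?f k \<le> infsum ?f UNIV" by (simp add: infsum_nonneg)
    have "L\<^sup>2 * infsum ?f UNIV \<le> (\<nu>\<^sup>2 * \<kappa> ^ (2 * \<alpha>)) * (c0 * exp (\<sigma> * (real \<alpha>)\<^sup>2))"
      using c0(2)[of \<alpha>] \<kappa> \<nu> by (simp add: Apow_norm2_def \<kappa>_def[symmetric] field_simps)
    then have "L\<^sup>2 * ?f k \<le> (\<nu>\<^sup>2 * \<kappa> ^ (2 * \<alpha>)) * (c0 * exp (\<sigma> * (real \<alpha>)\<^sup>2))"
      using mult_left_mono[OF le, of "L\<^sup>2"] by simp
    moreover have "?f k = \<kappa> ^ (2 * \<alpha>) * (kn k ^ \<alpha> * norm (u k))\<^sup>2"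
      by (simp add: power_mult_distrib power_mult[symmetric] mult.commute flip: kn_power2)
    ultimately have "\<kappa> ^ (2 * \<alpha>) * (L\<^sup>2 * (kn k ^ \<alpha> * norm (u k))\<^sup>2) \<le> \<kappa> ^ (2 * \<alpha>) * (\<nu>\<^sup>2 * (c0 * exp (\<sigma> * (real \<alpha>)\<^sup>2)))"
      by (simp add: mult_ac)
    then have "L\<^sup>2 * (kn k ^ \<alpha> * norm (u k))\<^sup>2 \<le> \<nu>\<^sup>2 * (c0 * exp (\<sigma> * (real \<alpha>)\<^sup>2))"
      using \<kappa> by simp
    then have "(kn k ^ \<alpha> * norm (u k))\<^sup>2 \<le> (\<nu>\<^sup>2 / L\<^sup>2 * c0) * exp (\<sigma> * (real \<alpha>)\<^sup>2)"
      using L by (simp add: field_simps)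
    also have "\<dots> \<le> C * exp (\<bar>\<sigma>\<bar> * (real \<alpha>)\<^sup>2)"
    proof (intro mult_mono)
      show "\<nu>\<^sup>2 / L\<^sup>2 * c0 \<le> C" unfolding C_def using abs_ge_self[of "\<nu>\<^sup>2 / L\<^sup>2 * c0"] by linarith
    qed (auto simp: C_def intro!: mult_right_mono)
    also have "\<dots> \<le> (C * exp (\<bar>\<sigma>\<bar> * (real \<alpha>)\<^sup>2))\<^sup>2"
    proof -
      have "1 * 1 \<le> C * exp (\<bar>\<sigma>\<bar> * (real \<alpha>)\<^sup>2)" by (intro mult_mono) (auto simp: C_def)
      then have "1 \<le> C * exp (\<bar>\<sigma>\<bar> * (real \<alpha>)\<^sup>2)" by simp
      from self_le_power[OF this, of 2] show ?thesis by simp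
    qed
    finally show ?thesis by (rule power2_le_imp_le) (simp add: C_def)
  qed
  define \<zeta> where "\<zeta> = lsum (\<lambda>k. ennreal (kn k powr (- 3)))"
  have "\<zeta> < \<infinity>" unfolding \<zeta>_def using lsum_kn_powr_finite[of 3] by simp
  then obtain z where z: "\<zeta> = ennreal z" "0 \<le> z"
    by (metis ennreal_cases infinity_ennreal_def less_irrefl)
  have C: "0 \<le> C" by (simp add: C_def)
  show ?thesis
  proof (rule rapidI)
    \<comment> \<open>18 = 2 * 3^2 and the doubled exponent come from (s + 3)^2 \<le> 18 + 2
      s^2.\<close>
    show "0 \<le> C * exp (\<bar>\<sigma>\<bar> * 18) * z" "0 \<le> \<bar>\<sigma>\<bar> * 2" using z C by auto
    fix s
    have "wsum s (enorm u) \<le> lsum (\<lambda>k. ennreal (C * exp (\<bar>\<sigma>\<bar> * (real (s + 3))\<^sup>2)) * ennreal (kn k powr (- 3)))"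
      unfolding wsum_def
    proof (rule lsum_mono)
      fix k
      show "ennreal (kn k ^ s) * enorm u k \<le> ennreal (C * exp (\<bar>\<sigma>\<bar> * (real (s + 3))\<^sup>2)) * ennreal (kn k powr (- 3))"
      proof (cases "k = 0")
        case False
        have "kn k ^ s * norm (u k) = (kn k ^ (s + 3) * norm (u k)) * kn k powr (- 3)"
          using kn_pos[OF False] by (simp add: power_add powr_minus)
        also have "\<dots> \<le> (C * exp (\<bar>\<sigma>\<bar> * (real (s + 3))\<^sup>2)) * kn k powr (- 3)"
          by (intro mult_right_mono pt) auto
        finally show ?thesis using C by (simp add: enorm_def ennreal_leI flip: ennreal_mult)
      qed (simp add: enorm_def u0)
    qed
    also have "\<dots> = ennreal (C * exp (\<bar>\<sigma>\<bar> * (real (s + 3))\<^sup>2) * z)"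
      unfolding lsum_cmult \<zeta>_def[symmetric] z(1) using C z by (simp flip: ennreal_mult)
    also have "\<dots> \<le> ennreal (C * exp (\<bar>\<sigma>\<bar> * 18) * z * exp (\<bar>\<sigma>\<bar> * 2 * (real s)\<^sup>2))"
    proof (rule ennreal_leI)
      have "(real (s + 3))\<^sup>2 \<le> 18 + 2 * (real s)\<^sup>2"
        using sum_squares_ge_zero[of "real s - 3" 0] by (simp add: power2_eq_square algebra_simps)
      then have "\<bar>\<sigma>\<bar> * (real (s + 3))\<^sup>2 \<le> \<bar>\<sigma>\<bar> * (18 + 2 * (real s)\<^sup>2)" by (intro mult_left_mono) auto
      then have "exp (\<bar>\<sigma>\<bar> * (real (s + 3))\<^sup>2) \<le> exp (\<bar>\<sigma>\<bar> * 18) * exp (\<bar>\<sigma>\<bar> * 2 * (real s)\<^sup>2)"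
        unfolding exp_add[symmetric] by (simp add: algebra_simps)
      then have "(C * z) * exp (\<bar>\<sigma>\<bar> * (real (s + 3))\<^sup>2) \<le> (C * z) * (exp (\<bar>\<sigma>\<bar> * 18) * exp (\<bar>\<sigma>\<bar> * 2 * (real s)\<^sup>2))"
        using C z by (intro mult_left_mono) auto
      then show "C * exp (\<bar>\<sigma>\<bar> * (real (s + 3))\<^sup>2) * z \<le> C * exp (\<bar>\<sigma>\<bar> * 18) * z * exp (\<bar>\<sigma>\<bar> * 2 * (real s)\<^sup>2)"
        by (simp only: mult_ac)
    qed
    finally show "wsum s (enorm u) \<le> ennreal (C * exp (\<bar>\<sigma>\<bar> * 18) * z * exp (\<bar>\<sigma>\<bar> * 2 * (real s)\<^sup>2))" .
  qed
qed

text \<open>In |k|^(2 \<alpha>) |u_k|^2 one factor |u_k| is bounded by C, the other is summed at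
  order 2 \<alpha>; (2 \<alpha>)^2 explains the exponent 4 \<sigma>. The summand 1 makes the new
  exponent strictly positive even if \<sigma> = 0.\<close>

lemma rapid_imp_Apow_bound:
  assumes u: "rapid (enorm u)" and L: "L > 0" and \<nu>: "\<nu> > 0"
  obtains \<sigma> c0 where "\<sigma> > 0" "\<And>\<alpha>. Apow_summable L \<alpha> u"
    "\<And>\<alpha>. Apow_norm2 L \<alpha> u / (\<nu>\<^sup>2 * kappa0 L ^ (2 * \<alpha>)) \<le> c0 * exp (\<sigma> * (real \<alpha>)\<^sup>2)"
proof -
  obtain C \<sigma> where C: "0 \<le> C" "0 \<le> \<sigma>" "\<And>s. wsum s (enorm u) \<le> ennreal (C * exp (\<sigma> * (real s)\<^sup>2))"
    using rapidE[OF u] by blast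
  define \<kappa> where "\<kappa> = kappa0 L"
  have \<kappa>: "\<kappa> > 0" using L by (simp add: \<kappa>_def kappa0_def)
  have en: "enorm u k \<le> ennreal C" for k
    using order_trans[OF le_lsum[of "enorm u"] C(3)[of 0, unfolded wsum_0]] by simp
  have bd: "lsum (\<lambda>k. ennreal ((\<kappa>\<^sup>2 * ksq k) ^ \<alpha> * (norm (u k))\<^sup>2)) \<le> ennreal (\<kappa> ^ (2 * \<alpha>) * (C\<^sup>2 * exp (4 * \<sigma> * (real \<alpha>)\<^sup>2)))" for \<alpha>
  proof -
    have "lsum (\<lambda>k. ennreal ((\<kappa>\<^sup>2 * ksq k) ^ \<alpha> * (norm (u k))\<^sup>2)) \<le> lsum (\<lambda>k. (ennreal (\<kappa> ^ (2 * \<alpha>)) * ennreal C) * (ennreal (kn k ^ (2 * \<alpha>)) * enorm u k))"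
    proof (rule lsum_mono)
      fix k
      have "(\<kappa>\<^sup>2 * ksq k) ^ \<alpha> * (norm (u k))\<^sup>2 = \<kappa> ^ (2 * \<alpha>) * norm (u k) * (kn k ^ (2 * \<alpha>) * norm (u k))"
        by (simp add: power_mult_distrib power_mult kn_power2 power2_eq_square[of "norm (u k)"])
      then have "ennreal ((\<kappa>\<^sup>2 * ksq k) ^ \<alpha> * (norm (u k))\<^sup>2) = (ennreal (\<kappa> ^ (2 * \<alpha>)) * enorm u k) * (ennreal (kn k ^ (2 * \<alpha>)) * enorm u k)"
        using \<kappa> by (simp add: enorm_def ennreal_mult)
      also have "\<dots> \<le> (ennreal (\<kappa> ^ (2 * \<alpha>)) * ennreal C) * (ennreal (kn k ^ (2 * \<alpha>)) * enorm u k)"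
        by (intro mult_right_mono mult_left_mono en) auto
      finally show "ennreal ((\<kappa>\<^sup>2 * ksq k) ^ \<alpha> * (norm (u k))\<^sup>2) \<le> (ennreal (\<kappa> ^ (2 * \<alpha>)) * ennreal C) * (ennreal (kn k ^ (2 * \<alpha>)) * enorm u k)" .
    qed
    also have "\<dots> = (ennreal (\<kappa> ^ (2 * \<alpha>)) * ennreal C) * wsum (2 * \<alpha>) (enorm u)"
      by (simp only: lsum_cmult wsum_def)
    also have "\<dots> \<le> (ennreal (\<kappa> ^ (2 * \<alpha>)) * ennreal C) * ennreal (C * exp (\<sigma> * (real (2 * \<alpha>))\<^sup>2))"
      by (intro mult_left_mono C) auto
    also have "\<dots> = ennreal (\<kappa> ^ (2 * \<alpha>) * (C\<^sup>2 * exp (4 * \<sigma> * (real \<alpha>)\<^sup>2)))"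
      using \<kappa> C(1) by (simp add: power2_eq_square mult_ac flip: ennreal_mult)
    finally show ?thesis .
  qed
  have sm: "Apow_summable L \<alpha> u" for \<alpha>
    unfolding Apow_summable_def \<kappa>_def[symmetric]
    by (subst summable_on_iff_lsum_finite) (auto intro: le_less_trans[OF bd])
  moreover have "Apow_norm2 L \<alpha> u / (\<nu>\<^sup>2 * kappa0 L ^ (2 * \<alpha>)) \<le> (L\<^sup>2 * C\<^sup>2 / \<nu>\<^sup>2) * exp ((4 * \<sigma> + 1) * (real \<alpha>)\<^sup>2)" for \<alpha>
  proof -
    let ?f = "\<lambda>k. (\<kappa>\<^sup>2 * ksq k) ^ \<alpha> * (norm (u k))\<^sup>2"
    have "ennreal (infsum ?f UNIV) \<le> ennreal (\<kappa> ^ (2 * \<alpha>) * (C\<^sup>2 * exp (4 * \<sigma> * (real \<alpha>)\<^sup>2)))"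
      using sm[of \<alpha>] bd[of \<alpha>] unfolding Apow_summable_def \<kappa>_def[symmetric] by (subst ennreal_infsum_eq_lsum) auto
    then have "infsum ?f UNIV \<le> \<kappa> ^ (2 * \<alpha>) * (C\<^sup>2 * exp (4 * \<sigma> * (real \<alpha>)\<^sup>2))"
      using \<kappa> by simp
    then have "Apow_norm2 L \<alpha> u / (\<nu>\<^sup>2 * kappa0 L ^ (2 * \<alpha>)) \<le> L\<^sup>2 * (\<kappa> ^ (2 * \<alpha>) * (C\<^sup>2 * exp (4 * \<sigma> * (real \<alpha>)\<^sup>2))) / (\<nu>\<^sup>2 * \<kappa> ^ (2 * \<alpha>))"
      unfolding Apow_norm2_def \<kappa>_def[symmetric] using \<kappa> by (intro divide_right_mono mult_left_mono) auto
    also have "\<dots> = (L\<^sup>2 * C\<^sup>2 / \<nu>\<^sup>2) * exp (4 * \<sigma> * (real \<alpha>)\<^sup>2)"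
      using \<kappa> \<nu> by (simp add: field_simps)
    also have "\<dots> \<le> (L\<^sup>2 * C\<^sup>2 / \<nu>\<^sup>2) * exp ((4 * \<sigma> + 1) * (real \<alpha>)\<^sup>2)"
      by (intro mult_left_mono) (auto simp: distrib_right)
    finally show ?thesis .
  qed
  ultimately show ?thesis using C by (intro that[of "4 * \<sigma> + 1" "L\<^sup>2 * C\<^sup>2 / \<nu>\<^sup>2"]) auto
qed

section \<open>Smooth representatives\<close>

definition wave :: "real \<Rightarrow> int \<times> int \<Rightarrow> real ^ 2 \<Rightarrow> complex" where
  "wave \<kappa> k x = cis (\<kappa> * (real_of_int (fst k) * x $ 1 + real_of_int (snd k) * x $ 2))"

definition trig :: "real \<Rightarrow> (int \<times> int \<Rightarrow> complex) \<Rightarrow> real ^ 2 \<Rightarrow> complex" where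
  "trig \<kappa> a x = (\<Sum>\<^sub>\<infinity>k. a k * wave \<kappa> k x)"

text \<open>Plain rapid decrease: the dependence of the bounds on s is forgotten, which is all that
  smoothness of the Fourier series asks for.\<close>

definition decays :: "(int \<times> int \<Rightarrow> complex) \<Rightarrow> bool" where
  "decays a \<longleftrightarrow> (\<forall>s. (\<lambda>k. kn k ^ s * norm (a k)) summable_on UNIV)"

definition freq :: "2 \<Rightarrow> int \<times> int \<Rightarrow> real" where
  "freq i k = (if i = 1 then real_of_int (fst k) else real_of_int (snd k))"

text \<open>The Fourier multiplier of the partial derivative in direction i.\<close>

definition pd_coeff :: "real \<Rightarrow> 2 \<Rightarrow> (int \<times> int \<Rightarrow> complex) \<Rightarrow> int \<times> int \<Rightarrow> complex" where
  "pd_coeff \<kappa> i a k = \<i> * of_real (\<kappa> * freq i k) * a k"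

lemma norm_wave [simp]: "norm (wave \<kappa> k x) = 1"
  by (simp add: wave_def)

lemma abs_freq_le: "\<bar>freq i k\<bar> \<le> kn k"
  by (simp add: freq_def abs_fst_le_kn abs_snd_le_kn)

lemma wave_shift: "wave \<kappa> k (x + t *\<^sub>R axis i 1) = wave \<kappa> k x * cis (\<kappa> * freq i k * t)"
proof -
  have "i = 1 \<or> i = 2" using exhaust_2 by blast
  then show ?thesis
    by (auto simp: wave_def freq_def cis_mult axis_def algebra_simps)
qed

lemma decays_summable: "decays a \<Longrightarrow> (\<lambda>k. norm (a k)) summable_on UNIV"
  unfolding decays_def by (drule spec[of _ 0]) simp

lemma decays_pd_coeff:
  assumes "decays a"
  shows "decays (pd_coeff \<kappa> i a)"
  unfolding decays_def
proof
  fix s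
  have "(\<lambda>k. \<bar>\<kappa>\<bar> * (kn k ^ (s + 1) * norm (a k))) summable_on UNIV"
    using assms unfolding decays_def by (intro summable_on_cmult_right) blast
  then show "(\<lambda>k. kn k ^ s * norm (pd_coeff \<kappa> i a k)) summable_on UNIV"
  proof (rule summable_on_comparison_test)
    fix k
    have "kn k ^ s * norm (pd_coeff \<kappa> i a k) = \<bar>\<kappa>\<bar> * (kn k ^ s * \<bar>freq i k\<bar> * norm (a k))"
      by (simp add: pd_coeff_def norm_mult abs_mult mult_ac)
    also have "\<dots> \<le> \<bar>\<kappa>\<bar> * (kn k ^ s * kn k * norm (a k))"
      by (intro mult_left_mono mult_right_mono abs_freq_le) auto
    finally show "kn k ^ s * norm (pd_coeff \<kappa> i a k) \<le> \<bar>\<kappa>\<bar> * (kn k ^ (s + 1) * norm (a k))"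
      by (simp add: mult_ac)
  qed auto
qed

lemma trig_term_summable:
  assumes "decays a"
  shows "(\<lambda>k. a k * wave \<kappa> k x) summable_on UNIV"
  by (rule abs_summable_summable) (simp add: norm_mult decays_summable[OF assms])

lemma trig_uniform_limit:
  assumes "decays a"
  shows "uniform_limit Y (\<lambda>X x. \<Sum>k\<in>X. a k * wave \<kappa> k x) (trig \<kappa> a) (finite_subsets_at_top UNIV)"
  unfolding trig_def
  by (rule Weierstrass_m_test_general[OF _ decays_summable[OF assms]]) (simp add: norm_mult)

lemma continuous_wave: "continuous_on S (wave \<kappa> k)"
  unfolding wave_def cis_conv_exp by (intro continuous_intros)

lemma continuous_trig:
  assumes "decays a"
  shows "continuous_on S (trig \<kappa> a)"
  by (rule uniform_limit_theorem[OF _ trig_uniform_limit[OF assms]])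
     (auto intro!: always_eventually continuous_intros continuous_wave)

lemma norm_cis_diff_le: "norm (cis y - 1) \<le> \<bar>y\<bar>"
proof -
  have "norm (cis y - 1) = 2 * \<bar>sin (y / 2)\<bar>"
    using dist_exp_i_1[of y] by (simp add: dist_norm cis_conv_exp)
  also have "\<dots> \<le> \<bar>y\<bar>" using abs_sin_le_one abs_sin_x_le_abs_x[of "y/2"] by simp
  finally show ?thesis .
qed

lemma has_vector_derivative_cis:
  "((\<lambda>t. cis (c * t)) has_vector_derivative (\<i> * of_real c * cis (c * t))) (at t within S)"
proof -
  have "((\<lambda>z. exp (\<i> * of_real c * z)) has_field_derivative (\<i> * of_real c * cis (c * t))) (at (of_real t))"
    by (rule derivative_eq_intros refl)+ (simp add: cis_conv_exp mult_ac)
  from has_vector_derivative_real_field[OF this, of S] show ?thesis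
    by (simp add: cis_conv_exp mult_ac)
qed

text \<open>Mean value inequality for cis t - i t, whose derivative i (cis t - 1) is at most |y| in
  modulus for |t| \<le> |y|.\<close>

lemma norm_cis_taylor_le: "norm (cis y - 1 - \<i> * of_real y) \<le> y\<^sup>2"
proof -
  have "norm ((cis y - \<i> * of_real y) - (cis 0 - \<i> * of_real 0)) \<le> \<bar>y\<bar> * norm (y - 0)"
  proof (rule differentiable_bound[where f' = "\<lambda>t h. h *\<^sub>R (\<i> * (cis t - 1))" and S = "{-\<bar>y\<bar>..\<bar>y\<bar>}" and f = "\<lambda>t. cis t - \<i> * of_real t"])
    fix t assume t: "t \<in> {-\<bar>y\<bar>..\<bar>y\<bar>}"
    have "((\<lambda>t. cis t - \<i> * of_real t) has_vector_derivative (\<i> * (cis t - 1))) (at t within {-\<bar>y\<bar>..\<bar>y\<bar>})"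
      using has_vector_derivative_diff[OF has_vector_derivative_cis[of 1 t]
          has_vector_derivative_mult_right[OF has_vector_derivative_of_real[OF DERIV_ident], of \<i>]]
      by (simp add: right_diff_distrib)
    then show "((\<lambda>t. cis t - \<i> * of_real t) has_derivative (\<lambda>h. h *\<^sub>R (\<i> * (cis t - 1)))) (at t within {-\<bar>y\<bar>..\<bar>y\<bar>})"
      by (simp add: has_vector_derivative_def)
    show "onorm (\<lambda>h. h *\<^sub>R (\<i> * (cis t - 1))) \<le> \<bar>y\<bar>"
    proof (rule onorm_le)
      fix h :: real
      have "norm (cis t - 1) \<le> \<bar>y\<bar>" using norm_cis_diff_le[of t] t by auto
      then show "norm (h *\<^sub>R (\<i> * (cis t - 1))) \<le> \<bar>y\<bar> * norm h"
        by (simp add: norm_mult mult.commute mult_left_mono)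
    qed
  qed auto
  then show ?thesis by (simp add: power2_eq_square algebra_simps)
qed

text \<open>Termwise differentiation through the remainder: the second-order remainders
  \<open>R t\<close> sum to at most t^2 C with C finite, so their difference quotient is at most |t|
  C.\<close>

lemma trig_partial_derivative:
  assumes a: "decays a"
  shows "((\<lambda>t. trig \<kappa> a (x + t *\<^sub>R axis i 1)) has_vector_derivative trig \<kappa> (pd_coeff \<kappa> i a) x) (at 0)"
proof -
  define R where "R t k = a k * wave \<kappa> k x * (cis (\<kappa> * freq i k * t) - 1 - \<i> * of_real (\<kappa> * freq i k * t))" for t k
  define C where "C = (\<Sum>\<^sub>\<infinity>k. \<kappa>\<^sup>2 * (kn k ^ 2 * norm (a k)))"
  have smC: "(\<lambda>k. \<kappa>\<^sup>2 * (kn k ^ 2 * norm (a k))) summable_on UNIV"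
    using a unfolding decays_def by (intro summable_on_cmult_right) blast
  have Rle: "norm (R t k) \<le> t\<^sup>2 * (\<kappa>\<^sup>2 * (kn k ^ 2 * norm (a k)))" for t k
  proof -
    have "norm (R t k) \<le> norm (a k) * (\<kappa> * freq i k * t)\<^sup>2"
      unfolding R_def norm_mult norm_wave using norm_cis_taylor_le[of "\<kappa> * freq i k * t"]
      by (simp add: mult_left_mono)
    also have "\<dots> = t\<^sup>2 * (\<kappa>\<^sup>2 * (\<bar>freq i k\<bar>\<^sup>2 * norm (a k)))" by (simp add: power_mult_distrib mult_ac)
    also have "\<dots> \<le> t\<^sup>2 * (\<kappa>\<^sup>2 * (kn k ^ 2 * norm (a k)))"
      by (intro mult_left_mono mult_right_mono power_mono abs_freq_le) auto
    finally show ?thesis .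
  qed
  have sm2: "(\<lambda>k. t\<^sup>2 * (\<kappa>\<^sup>2 * (kn k ^ 2 * norm (a k)))) summable_on UNIV" for t
    using smC by (rule summable_on_cmult_right)
  have Rabs: "(\<lambda>k. norm (R t k)) summable_on UNIV" for t
    by (rule summable_on_comparison_test[OF sm2[of t]]) (auto intro: Rle)
  have Rsum: "norm (infsum (R t) UNIV) \<le> t\<^sup>2 * C" for t
  proof -
    have "norm (infsum (R t) UNIV) \<le> (\<Sum>\<^sub>\<infinity>k. norm (R t k))" by (rule norm_infsum_bound[OF Rabs])
    also have "\<dots> \<le> (\<Sum>\<^sub>\<infinity>k. t\<^sup>2 * (\<kappa>\<^sup>2 * (kn k ^ 2 * norm (a k))))"
      by (intro infsum_mono Rabs sm2 Rle)
    also have "\<dots> = t\<^sup>2 * C" unfolding C_def by (rule infsum_cmult_right) (use smC in auto)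
    finally show ?thesis .
  qed
  have expand: "trig \<kappa> a (x + t *\<^sub>R axis i 1) = trig \<kappa> a x + of_real t * trig \<kappa> (pd_coeff \<kappa> i a) x + infsum (R t) UNIV" for t
  proof -
    have s1: "(\<lambda>k. a k * wave \<kappa> k x) summable_on UNIV" by (rule trig_term_summable[OF a])
    have s2: "(\<lambda>k. of_real t * (pd_coeff \<kappa> i a k * wave \<kappa> k x)) summable_on UNIV"
      by (intro summable_on_cmult_right trig_term_summable decays_pd_coeff a)
    have s3: "R t summable_on UNIV" by (rule abs_summable_summable[OF Rabs])
    have "trig \<kappa> a (x + t *\<^sub>R axis i 1) = (\<Sum>\<^sub>\<infinity>k. (a k * wave \<kappa> k x + of_real t * (pd_coeff \<kappa> i a k * wave \<kappa> k x)) + R t k)"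
      unfolding trig_def by (rule infsum_cong) (simp add: wave_shift R_def pd_coeff_def algebra_simps)
    also have "\<dots> = (\<Sum>\<^sub>\<infinity>k. a k * wave \<kappa> k x + of_real t * (pd_coeff \<kappa> i a k * wave \<kappa> k x)) + infsum (R t) UNIV"
      by (intro infsum_add summable_on_add s1 s2 s3)
    also have "(\<Sum>\<^sub>\<infinity>k. a k * wave \<kappa> k x + of_real t * (pd_coeff \<kappa> i a k * wave \<kappa> k x)) = trig \<kappa> a x + (\<Sum>\<^sub>\<infinity>k. of_real t * (pd_coeff \<kappa> i a k * wave \<kappa> k x))"
      unfolding trig_def by (intro infsum_add s1 s2)
    also have "(\<Sum>\<^sub>\<infinity>k. of_real t * (pd_coeff \<kappa> i a k * wave \<kappa> k x)) = of_real t * trig \<kappa> (pd_coeff \<kappa> i a) x"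
      unfolding trig_def by (rule infsum_cmult_right) (auto intro!: trig_term_summable decays_pd_coeff a)
    finally show ?thesis .
  qed
  show ?thesis
    unfolding has_vector_derivative_def
  proof (rule has_derivativeI_sandwich[of 1 _ _ _ _ "\<lambda>t. \<bar>t\<bar> * C"])
    show "bounded_linear (\<lambda>h. h *\<^sub>R trig \<kappa> (pd_coeff \<kappa> i a) x)" by (rule bounded_linear_scaleR_left)
    show "((\<lambda>t. \<bar>t\<bar> * C) \<longlongrightarrow> 0) (at 0)"
      by (rule tendsto_mult_left_zero[OF tendsto_rabs_zero[OF tendsto_ident_at]])
    fix t :: real assume "t \<noteq> 0"
    have "trig \<kappa> a (x + t *\<^sub>R axis i 1) - trig \<kappa> a (x + 0 *\<^sub>R axis i 1) - (t - 0) *\<^sub>R trig \<kappa> (pd_coeff \<kappa> i a) x = infsum (R t) UNIV"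
      unfolding expand[of t] by (simp add: scaleR_conv_of_real)
    then show "norm (trig \<kappa> a (x + t *\<^sub>R axis i 1) - trig \<kappa> a (x + 0 *\<^sub>R axis i 1) - (t - 0) *\<^sub>R trig \<kappa> (pd_coeff \<kappa> i a) x) / norm (t - 0) \<le> \<bar>t\<bar> * C"
    proof -
      assume eq: "trig \<kappa> a (x + t *\<^sub>R axis i 1) - trig \<kappa> a (x + 0 *\<^sub>R axis i 1) - (t - 0) *\<^sub>R trig \<kappa> (pd_coeff \<kappa> i a) x = infsum (R t) UNIV"
      have "t\<^sup>2 * C = (\<bar>t\<bar> * C) * \<bar>t\<bar>" by (simp add: power2_eq_square)
      with Rsum[of t] have "norm (infsum (R t) UNIV) / \<bar>t\<bar> \<le> \<bar>t\<bar> * C"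
        using \<open>t \<noteq> 0\<close> by (subst pos_divide_le_eq) auto
      then show ?thesis unfolding eq by simp
    qed
  qed auto
qed

lemma has_vector_derivative_vec_lambda:
  fixes h :: "'n::finite \<Rightarrow> real \<Rightarrow> real"
  assumes "\<And>m. (h m has_vector_derivative h' m) (at x)"
  shows "((\<lambda>t. \<chi> m. h m t) has_vector_derivative (\<chi> m. h' m)) (at x)"
  unfolding has_vector_derivative_def
proof (rule has_derivative_componentwise_within[THEN iffD2], rule ballI)
  fix b :: "real ^ 'n" assume "b \<in> Basis"
  then obtain m where "b = axis m 1" by (auto simp: Basis_vec_def)
  then show "((\<lambda>t. (\<chi> m. h m t) \<bullet> b) has_derivative (\<lambda>t. (t *\<^sub>R (\<chi> m. h' m)) \<bullet> b)) (at x)"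
    using assms[of m] by (simp add: inner_axis has_vector_derivative_def)
qed

text \<open>\<open>foldr\<close> composes the multipliers in the order in which
  \<open>iter_pd\<close> nests the derivatives; trigonometric series are closed under both, so the
  induction never leaves this class.\<close>

lemma iter_pd_trig:
  fixes a :: "2 \<Rightarrow> int \<times> int \<Rightarrow> complex"
  assumes "\<And>m. decays (a m)"
  shows "iter_pd is (\<lambda>x. \<chi> m. Re (trig \<kappa> (a m) x)) = (\<lambda>x. \<chi> m. Re (trig \<kappa> (foldr (pd_coeff \<kappa>) is (a m)) x))"
    and "decays (foldr (pd_coeff \<kappa>) is (a m))"
    and "((\<lambda>t. (\<chi> m. Re (trig \<kappa> (foldr (pd_coeff \<kappa>) is (a m)) (x + t *\<^sub>R axis i 1))) :: real ^ 2)
       has_vector_derivative (\<chi> m. Re (trig \<kappa> (foldr (pd_coeff \<kappa>) (i # is) (a m)) x))) (at 0)"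
proof -
  have dec: "decays (foldr (pd_coeff \<kappa>) is (a m))" for "is" m
    by (induction "is") (auto simp: assms decays_pd_coeff)
  have der: "((\<lambda>t. (\<chi> m. Re (trig \<kappa> (foldr (pd_coeff \<kappa>) is (a m)) (x + t *\<^sub>R axis i 1))) :: real ^ 2)
       has_vector_derivative (\<chi> m. Re (trig \<kappa> (foldr (pd_coeff \<kappa>) (i # is) (a m)) x))) (at 0)" for "is" x i
  proof (rule has_vector_derivative_vec_lambda)
    fix m
    from bounded_linear.has_vector_derivative[OF bounded_linear_Re trig_partial_derivative[OF dec[of "is" m], of \<kappa> x i]]
    show "((\<lambda>t. Re (trig \<kappa> (foldr (pd_coeff \<kappa>) is (a m)) (x + t *\<^sub>R axis i 1)))
       has_vector_derivative Re (trig \<kappa> (foldr (pd_coeff \<kappa>) (i # is) (a m)) x)) (at 0)"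
      by simp
  qed
  show "iter_pd is (\<lambda>x. \<chi> m. Re (trig \<kappa> (a m) x)) = (\<lambda>x. \<chi> m. Re (trig \<kappa> (foldr (pd_coeff \<kappa>) is (a m)) x))"
  proof (induction "is")
    case (Cons i "is")
    show ?case unfolding iter_pd.simps Cons.IH using der by (intro ext vector_derivative_at)
  qed simp
  show "decays (foldr (pd_coeff \<kappa>) is (a m))" by (rule dec)
  show "((\<lambda>t. (\<chi> m. Re (trig \<kappa> (foldr (pd_coeff \<kappa>) is (a m)) (x + t *\<^sub>R axis i 1))) :: real ^ 2)
       has_vector_derivative (\<chi> m. Re (trig \<kappa> (foldr (pd_coeff \<kappa>) (i # is) (a m)) x))) (at 0)" by (rule der)
qed

lemma smooth_field_trig:
  fixes a :: "2 \<Rightarrow> int \<times> int \<Rightarrow> complex"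
  assumes "\<And>m. decays (a m)"
  shows "smooth_field (\<lambda>x. \<chi> m. Re (trig \<kappa> (a m) x))"
  unfolding smooth_field_def iter_pd_trig(1)[OF assms]
proof (intro allI conjI)
  show "continuous_on UNIV (\<lambda>x. (\<chi> m. Re (trig \<kappa> (foldr (pd_coeff \<kappa>) is (a m)) x)) :: real ^ 2)" for "is"
    by (intro continuous_intros continuous_trig iter_pd_trig(2) assms)
  show "(\<lambda>t. (\<chi> m. Re (trig \<kappa> (foldr (pd_coeff \<kappa>) is (a m)) (x + t *\<^sub>R axis i 1))) :: real ^ 2) differentiable at 0" for "is" i x
    using iter_pd_trig(3)[OF assms] by (rule differentiableI_vector)
qed

section \<open>Fourier coefficients of a trigonometric series\<close>

text \<open>The antiderivative is periodic as well. The indicator form matches one factor of the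
  product integral over the square.\<close>

lemma integral_cis_period:
  fixes c :: real
  assumes "c \<noteq> 0" "c * L = 2 * pi * of_int j" "0 \<le> L"
  shows "(\<integral>y. indicator {0..L} y *\<^sub>R cis (c * y) \<partial>lborel) = 0"
proof -
  have cont: "continuous_on {0..L} (\<lambda>y. cis (c * y))"
    unfolding cis_conv_exp by (intro continuous_intros)
  have "((\<lambda>y. cis (c * y)) has_integral (cis (c * L) / (\<i> * of_real c) - cis (c * 0) / (\<i> * of_real c))) {0..L}"
  proof (rule fundamental_theorem_of_calculus[OF assms(3)])
    fix y
    show "((\<lambda>y. cis (c * y) / (\<i> * of_real c)) has_vector_derivative cis (c * y)) (at y within {0..L})"
      using has_vector_derivative_divide[OF has_vector_derivative_cis[of c y], of "\<i> * of_real c"] assms(1) by simp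
  qed
  moreover have "cis (c * L) = 1" unfolding assms(2) by (simp add: cis_multiple_2pi)
  ultimately have "((\<lambda>y. cis (c * y)) has_integral 0) {0..L}" by simp
  moreover have "set_integrable lborel {0..L} (\<lambda>y. cis (c * y))"
    unfolding set_integrable_def using cont by (intro borel_integrable_compact) auto
  ultimately have "(LINT y:{0..L}|lborel. cis (c * y)) = 0"
    by (simp add: set_borel_integral_eq_integral integral_unique)
  then show ?thesis by (simp add: set_lebesgue_integral_def)
qed

text \<open>The wave and the indicator of the square both factor over the coordinates, so the
  integral is a product of one-dimensional ones; a nonzero frequency has a nonzero component, whose
  factor vanishes.\<close>

lemma integral_wave_box:
  assumes "L > 0"
  shows "(wave (kappa0 L) n has_integral (if n = 0 then of_real (L\<^sup>2) else 0)) (cbox 0 (\<chi> i. L))"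
proof (cases "n = 0")
  case True
  have "((\<lambda>x :: real ^ 2. 1 :: complex) has_integral (of_real (measure lborel (cbox 0 (\<chi> i. L) :: (real ^ 2) set)))) (cbox 0 (\<chi> i. L))"
    using has_integral_const[of "1::complex" "0 :: real ^ 2" "\<chi> i. L"] by (simp add: scaleR_conv_of_real)
  moreover have "measure lborel (cbox 0 (\<chi> i. L) :: (real ^ 2) set) = L\<^sup>2"
    using assms by (simp add: content_cbox_if_cart interval_eq_empty_cart power2_eq_square)
  moreover have "wave (kappa0 L) n = (\<lambda>x. 1)" using True by (simp add: wave_def fun_eq_iff)
  ultimately show ?thesis using True by simp
next
  case False
  define \<kappa> where "\<kappa> = kappa0 L"
  let ?B = "Basis :: (real ^ 2) set"
  let ?Q = "cbox 0 (\<chi> i. L) :: (real ^ 2) set"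
  define N :: "real ^ 2" where "N = (\<chi> i. freq i n)"
  have wave: "wave \<kappa> n x = (\<Prod>b\<in>?B. cis (\<kappa> * (N \<bullet> b) * (x \<bullet> b)))" for x
  proof -
    have "real_of_int (fst n) * x $ 1 + real_of_int (snd n) * x $ 2 = N \<bullet> x"
      by (simp add: inner_vec_def sum_2 N_def freq_def)
    also have "\<dots> = (\<Sum>b\<in>?B. (N \<bullet> b) * (x \<bullet> b))" by (rule euclidean_inner)
    finally have "wave \<kappa> n x = exp (\<Sum>b\<in>?B. \<i> * of_real (\<kappa> * (N \<bullet> b) * (x \<bullet> b)))"
      by (simp add: wave_def cis_conv_exp sum_distrib_left mult_ac)
    then show ?thesis by (simp add: exp_sum cis_conv_exp)
  qed
  define \<phi> where "\<phi> b y = indicator {0..L} y *\<^sub>R cis (\<kappa> * (N \<bullet> b) * y)" for b :: "real ^ 2" and y :: real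
  have ind: "indicator ?Q x *\<^sub>R wave \<kappa> n x = (\<Prod>b\<in>?B. \<phi> b (x \<bullet> b))" for x
  proof -
    have Q: "x \<in> ?Q \<longleftrightarrow> (\<forall>b\<in>?B. x \<bullet> b \<in> {0..L})"
      by (auto simp: mem_box Basis_vec_def inner_axis)
    have "(indicator ?Q x :: real) = (\<Prod>b\<in>?B. indicator {0..L} (x \<bullet> b))"
    proof (cases "x \<in> ?Q")
      case True
      then have "\<forall>b\<in>?B. x \<bullet> b \<in> {0..L}" using Q by blast
      then show ?thesis using True by simp
    next
      case False
      then obtain b where "b \<in> ?B" "x \<bullet> b \<notin> {0..L}" using Q by blast
      then have "(\<Prod>b\<in>?B. indicator {0..L} (x \<bullet> b) :: real) = 0"
        by (intro prod_zero) (auto intro!: bexI[of _ b] simp: indicator_def)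
      then show ?thesis using False by simp
    qed
    then show ?thesis unfolding wave \<phi>_def
      by (simp add: scaleR_conv_of_real prod.distrib)
  qed
  have \<phi>_int: "integrable lborel (\<phi> b)" for b
    unfolding \<phi>_def cis_conv_exp by (intro borel_integrable_compact continuous_intros) auto
  interpret product_sigma_finite "\<lambda>_ :: real ^ 2. lborel :: real measure" by standard
  have "(\<integral>x. indicator ?Q x *\<^sub>R wave \<kappa> n x \<partial>lborel) = (\<integral>x. (\<Prod>b\<in>?B. \<phi> b (x \<bullet> b)) \<partial>lborel)"
    by (simp add: ind)
  also have "\<dots> = (\<integral>f. (\<Prod>b\<in>?B. \<phi> b ((\<Sum>b\<in>?B. f b *\<^sub>R b) \<bullet> b)) \<partial>(\<Pi>\<^sub>M b\<in>?B. lborel))"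
  proof (subst lborel_eq, rule integral_distr)
    have [measurable]: "\<phi> b \<in> borel_measurable borel" for b using \<phi>_int[of b] by (simp add: borel_measurable_integrable)
    show "(\<lambda>x. \<Prod>b\<in>?B. \<phi> b (x \<bullet> b)) \<in> borel_measurable borel" by measurable
  qed measurable
  also have "\<dots> = (\<integral>f. (\<Prod>b\<in>?B. \<phi> b (f b)) \<partial>(\<Pi>\<^sub>M b\<in>?B. lborel))"
    by (simp add: inner_sum_left_Basis)
  also have "\<dots> = (\<Prod>b\<in>?B. integral\<^sup>L lborel (\<phi> b))"
    by (rule product_integral_prod) (auto simp: \<phi>_int)
  also have "\<dots> = 0"
  proof -
    obtain i where i: "freq i n \<noteq> 0"
    proof -
      have "freq 1 n \<noteq> 0 \<or> freq 2 n \<noteq> 0" using False by (cases n) (auto simp: freq_def zero_prod_def)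
      then show ?thesis using that by blast
    qed
    have \<kappa>: "\<kappa> > 0" "\<kappa> * L = 2 * pi" using assms by (auto simp: \<kappa>_def kappa0_def)
    have b: "axis i 1 \<in> ?B" by (auto simp: Basis_vec_def)
    have "integral\<^sup>L lborel (\<phi> (axis i 1)) = 0"
      unfolding \<phi>_def
    proof (rule integral_cis_period[where j = "if i = 1 then fst n else snd n"])
      show "\<kappa> * (N \<bullet> axis i 1) \<noteq> 0" using i \<kappa> by (simp add: N_def inner_axis)
      have "\<kappa> * (N \<bullet> axis i 1) * L = (\<kappa> * L) * freq i n" by (simp add: N_def inner_axis)
      then show "\<kappa> * (N \<bullet> axis i 1) * L = 2 * pi * of_int (if i = 1 then fst n else snd n)"
        unfolding \<kappa>(2) by (simp add: freq_def)
    qed (use assms in auto)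
    then show ?thesis using b by (intro prod_zero) auto
  qed
  finally have zero: "(LINT x:?Q|lborel. wave \<kappa> n x) = 0" by (simp add: set_lebesgue_integral_def)
  have "set_integrable lborel ?Q (wave \<kappa> n)"
    unfolding set_integrable_def by (intro borel_integrable_compact continuous_wave) auto
  from set_borel_integral_eq_integral[OF this] zero
  show ?thesis using False unfolding \<kappa>_def by (simp add: has_integral_iff)
qed

text \<open>Uniform convergence allows integration term by term. By orthogonality every finite
  partial sum that contains k already has the integral L^2 a_k, so the net of integrals is
  eventually constant.\<close>

lemma trig_fourier_coefficient:
  assumes a: "decays a" and L: "L > 0"
  shows "((\<lambda>x. trig (kappa0 L) a x * wave (kappa0 L) (- k) x) has_integral of_real (L\<^sup>2) * a k) (cbox 0 (\<chi> i. L))"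
proof -
  let ?Q = "cbox 0 (\<chi> i. L) :: (real ^ 2) set"
  let ?\<kappa> = "kappa0 L"
  have mult: "wave ?\<kappa> l x * wave ?\<kappa> (- k) x = wave ?\<kappa> (l - k) x" for l x
    by (simp add: wave_def cis_mult algebra_simps)
  have "uniform_limit ?Q (\<lambda>X x. \<Sum>l\<in>X. a l * wave ?\<kappa> (l - k) x) (\<lambda>x. \<Sum>\<^sub>\<infinity>l. a l * wave ?\<kappa> (l - k) x) (finite_subsets_at_top UNIV)"
    by (rule Weierstrass_m_test_general[OF _ decays_summable[OF a]]) (simp add: norm_mult)
  moreover have "(\<lambda>x. \<Sum>\<^sub>\<infinity>l. a l * wave ?\<kappa> (l - k) x) = (\<lambda>x. trig ?\<kappa> a x * wave ?\<kappa> (- k) x)"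
  proof
    fix x
    show "(\<Sum>\<^sub>\<infinity>l. a l * wave ?\<kappa> (l - k) x) = trig ?\<kappa> a x * wave ?\<kappa> (- k) x"
      unfolding trig_def mult[symmetric] mult.assoc[symmetric]
      by (rule infsum_cmult_left) (use trig_term_summable[OF a] in auto)
  qed
  ultimately have ul: "uniform_limit ?Q (\<lambda>X x. \<Sum>l\<in>X. a l * wave ?\<kappa> (l - k) x) (\<lambda>x. trig ?\<kappa> a x * wave ?\<kappa> (- k) x) (finite_subsets_at_top UNIV)"
    by simp
  obtain I J where IJ: "\<And>X. ((\<lambda>x. \<Sum>l\<in>X. a l * wave ?\<kappa> (l - k) x) has_integral I X) ?Q"
      "((\<lambda>x. trig ?\<kappa> a x * wave ?\<kappa> (- k) x) has_integral J) ?Q" "(I \<longlongrightarrow> J) (finite_subsets_at_top UNIV)"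
    by (rule uniform_limit_integral_cbox[OF ul]) (auto intro!: continuous_intros continuous_wave)
  have "eventually (\<lambda>X. I X = of_real (L\<^sup>2) * a k) (finite_subsets_at_top UNIV)"
    unfolding eventually_finite_subsets_at_top
  proof (intro exI[of _ "{k}"] conjI allI impI)
    fix X :: "(int \<times> int) set" assume X: "finite X \<and> {k} \<subseteq> X \<and> X \<subseteq> UNIV"
    have "((\<lambda>x. \<Sum>l\<in>X. a l * wave ?\<kappa> (l - k) x) has_integral (\<Sum>l\<in>X. a l * (if l - k = 0 then of_real (L\<^sup>2) else 0))) ?Q"
      using X by (intro has_integral_sum has_integral_mult_right integral_wave_box L) auto
    moreover have "(\<Sum>l\<in>X. a l * (if l - k = 0 then of_real (L\<^sup>2) else 0)) = (\<Sum>l\<in>X. if l = k then of_real (L\<^sup>2) * a k else 0)"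
      by (intro sum.cong) auto
    ultimately show "I X = of_real (L\<^sup>2) * a k"
      using X IJ(1)[of X] by (auto dest: has_integral_unique)
  qed auto
  then have "(I \<longlongrightarrow> of_real (L\<^sup>2) * a k) (finite_subsets_at_top UNIV)" by (rule tendsto_eventually)
  with IJ(3) have "J = of_real (L\<^sup>2) * a k" by (rule tendsto_unique[rotated]) auto
  with IJ(2) show ?thesis by simp
qed

lemma cnj_trig:
  assumes "\<And>k. a (- k) = cnj (a k)"
  shows "cnj (trig \<kappa> a x) = trig \<kappa> a x"
proof -
  have "cnj (trig \<kappa> a x) = (\<Sum>\<^sub>\<infinity>k. cnj (a k * wave \<kappa> k x))" unfolding trig_def by (rule infsum_cnj[symmetric])
  also have "\<dots> = (\<Sum>\<^sub>\<infinity>k. a (- k) * wave \<kappa> (- k) x)"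
    by (rule infsum_cong) (simp add: assms wave_def cis_cnj algebra_simps)
  also have "\<dots> = trig \<kappa> a x"
    unfolding trig_def
    by (rule infsum_reindex_bij_betw[where g = uminus]) (auto intro!: bij_betw_byWitness[where f' = uminus])
  finally show ?thesis .
qed

text \<open>\<open>Cclass\<close> also asks for a smooth periodic real field with these
  coefficients; the Fourier series itself is that field.\<close>

lemma rapid_imp_smooth_rep:
  assumes u: "rapid (enorm u)" "inH u" and L: "L > 0"
  shows "\<exists>f. smooth_rep L u f"
proof -
  define a where "a m k = u k $ m" for m :: 2 and k
  have dec: "decays (a m)" for m
    unfolding decays_def
  proof
    fix s
    obtain C \<sigma> where "wsum s (enorm u) \<le> ennreal (C * exp (\<sigma> * (real s)\<^sup>2))" using rapidE[OF u(1)] by metis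
    also have "\<dots> < \<infinity>" by simp
    finally have "wsum s (enorm u) < \<infinity>" .
    then have "lsum (\<lambda>k. ennreal (kn k ^ s * norm (u k))) < \<infinity>"
      by (simp add: wsum_def enorm_def ennreal_mult)
    then have "(\<lambda>k. kn k ^ s * norm (u k)) summable_on UNIV"
      by (subst summable_on_iff_lsum_finite) auto
    then show "(\<lambda>k. kn k ^ s * norm (a m k)) summable_on UNIV"
      by (rule summable_on_comparison_test)
         (auto simp: a_def intro!: mult_left_mono Finite_Cartesian_Product.norm_nth_le)
  qed
  have sym: "a m (- k) = cnj (a m k)" for m k
  proof -
    have "u (- fst k, - snd k) = vcnj (u k)" using u(2) unfolding inH_def by blast
    then show ?thesis by (simp add: a_def vcnj_def uminus_prod_def)
  qed
  let ?\<kappa> = "kappa0 L"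
  \<comment> \<open>The real part only fixes the type: by the symmetry of the coefficients the
    series is real, as the next fact shows.\<close>
  define f where "f = (\<lambda>x. (\<chi> m. Re (trig ?\<kappa> (a m) x)) :: real ^ 2)"
  have real: "complex_of_real (f x $ m) = trig ?\<kappa> (a m) x" for x m
  proof -
    have "trig ?\<kappa> (a m) x \<in> \<real>"
      unfolding Reals_cnj_iff by (rule cnj_trig) (rule sym)
    then show ?thesis by (simp add: f_def)
  qed
  have "f (x + L *\<^sub>R axis i 1) = f x" for x i
  proof -
    have "wave ?\<kappa> k (x + L *\<^sub>R axis i 1) = wave ?\<kappa> k x" for k
    proof -
      have "?\<kappa> * freq i k * L = 2 * pi * of_int (if i = 1 then fst k else snd k)"
        using L by (simp add: kappa0_def freq_def)
      then show ?thesis unfolding wave_shift by (simp add: cis_multiple_2pi)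
    qed
    then show ?thesis by (simp add: f_def trig_def)
  qed
  moreover have "u k $ m = (1 / (complex_of_real L)\<^sup>2) * integral (cbox 0 (\<chi> i. L))
           (\<lambda>x. complex_of_real (f x $ m) * cis (- kappa0 L * (real_of_int (fst k) * x $ 1 + real_of_int (snd k) * x $ 2)))" for k m
  proof -
    have w: "wave ?\<kappa> (- k) x = cis (- kappa0 L * (real_of_int (fst k) * x $ 1 + real_of_int (snd k) * x $ 2))" for x
      by (simp add: wave_def algebra_simps)
    have "integral (cbox 0 (\<chi> i. L))
           (\<lambda>x. complex_of_real (f x $ m) * cis (- kappa0 L * (real_of_int (fst k) * x $ 1 + real_of_int (snd k) * x $ 2)))
         = of_real (L\<^sup>2) * a m k"
      unfolding real w[symmetric] by (rule integral_unique[OF trig_fourier_coefficient[OF dec L]])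
    then show ?thesis using L by (simp add: a_def)
  qed
  moreover have "smooth_field f" unfolding f_def by (rule smooth_field_trig[OF dec])
  ultimately show ?thesis unfolding smooth_rep_def by blast
qed

theorem theorem11p1:
  fixes L \<nu> :: real and g :: fcoef
  assumes "L > 0" and "\<nu> > 0" and "inH g"
    and "attractor L \<nu> g \<inter> (\<Union>\<sigma>\<in>{0<..}. Cclass L \<nu> \<sigma>) \<noteq> {}"
  shows "attractor L \<nu> g \<subseteq> (\<Union>\<sigma>\<in>{0<..}. Cclass L \<nu> \<sigma>)"
proof -
  obtain v\<^sub>0 \<sigma> where v0: "v\<^sub>0 \<in> attractor L \<nu> g" "v\<^sub>0 \<in> Cclass L \<nu> \<sigma>"
    using assms(4) by blast
  then obtain v N where v: "nse_solution L \<nu> g v" "v 0 = v\<^sub>0" "\<And>t. sqrt (Hnorm2 L (v t)) \<le> N"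
    unfolding attractor_def by blast
  interpret v: bounded_solution L \<nu> g v N
    using assms v by unfold_locales auto
  have g: "rapid (enorm g)"
    by (rule v.rapid_force) (use Cclass_imp_rapid[OF v0(2) assms(1,2)] v(2) in simp)
  show ?thesis
  proof
    fix u\<^sub>0 assume "u\<^sub>0 \<in> attractor L \<nu> g"
    then obtain u M where u: "inH u\<^sub>0" "nse_solution L \<nu> g u" "u 0 = u\<^sub>0" "\<And>t. sqrt (Hnorm2 L (u t)) \<le> M"
      unfolding attractor_def by blast
    interpret u: bounded_solution L \<nu> g u M
      using assms u by unfold_locales auto
    have rapid: "rapid (enorm u\<^sub>0)" using u.rapid_solution[OF g] u(3) by simp
    obtain \<rho> c0 where "\<rho> > 0" "\<And>\<alpha>. Apow_summable L \<alpha> u\<^sub>0"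
      "\<And>\<alpha>. Apow_norm2 L \<alpha> u\<^sub>0 / (\<nu>\<^sup>2 * kappa0 L ^ (2 * \<alpha>)) \<le> c0 * exp (\<rho> * (real \<alpha>)\<^sup>2)"
      using rapid_imp_Apow_bound[OF rapid assms(1,2)] by blast
    with u(1) rapid_imp_smooth_rep[OF rapid u(1) assms(1)] have "u\<^sub>0 \<in> Cclass L \<nu> \<rho>"
      unfolding Cclass_def by blast
    with \<open>\<rho> > 0\<close> show "u\<^sub>0 \<in> (\<Union>\<sigma>\<in>{0<..}. Cclass L \<nu> \<sigma>)" by auto
  qed
qed

end
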